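(* Let $\Gamma=(G,\sigma)$ be a signed graph with $G=(V,E)$, $n=|V|$, let $p\ge1$, and let $\lambda_1\le\dots\le\lambda_n$ be the variational eigenvalues of $\Delta_p^\sigma$. Suppose $k,r\ge1$ are integers with $$\lambda_1\le\dots\le\lambda_{k-1}<\lambda_k=\lambda_{k+1}=\dots=\lambda_{k+r-1}<\lambda_{k+r}\le\dots\le\lambda_n$$ (the first strict inequality being void if $k=1$ and the second if $k+r-1=n$). Let $f$ be an eigenfunction of $\Delta_p^\sigma$ corresponding to $\lambda=\lambda_k$ which has minimal support. Then $$\mathfrak S(f)\le k\quad\text{and}\quad\overline{\mathfrak S}(f)\le n-k-r+2.$$ In addition, when $p=1$, one has $\mathfrak S(f)=1$; moreover, when $p=1$ and $\Gamma$ is balanced, the number of zeros of $f$ (vertices $x$ with $f(x)=0$) is at least $k+r-2$.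
   Context: Setting. $G=(V,E)$ is a finite simple undirected graph, $n=|V|$, with edge measure $w:E\to(0,\infty)$, vertex weight $\mu:V\to(0,\infty)$, potential $\kappa:V\to\mathbb R$ and signature $\sigma:E\to\{-1,1\}$; $\Gamma=(G,\sigma)$ is a signed graph. Values are written $w_{xy},\sigma_{xy},\mu_x,\kappa_x$, and $x\sim y$ means $\{x,y\}\in E$. Put $\Phi_p(t)=|t|^{p-2}t$ for $t\neq0$ and $\Phi_p(0)=0$. $\Gamma$ is balanced if there is $\tau:V\to\{-1,1\}$ with $\tau(x)\sigma_{xy}\tau(y)=1$ for all $\{x,y\}\in E$. Eigenpairs. For $p>1$, $\Delta_p^\sigma f(x)=\sum_{y\sim x}w_{xy}\Phi_p(f(x)-\sigma_{xy}f(y))+\kappa_x\Phi_p(f(x))$, and a nonzero $f:V\to\mathbb R$ is an eigenfunction with eigenvalue $\lambda\in\mathbb R$ if $\Delta_p^\sigma f(x)=\lambda\mu_x\Phi_p(f(x))$ for all $x\in V$. For $p=1$, let $\mathrm{Sgn}(t)=\{1\}$ if $t>0$, $[-1,1]$ if $t=0$, $\{-1\}$ if $t<0$; a nonzero $f:V\to\mathbb R$ is an eigenfunction of $\Delta_1^\sigma$ with eigenvalue $\lambda$ if there are numbers $z_{xy}\in\mathrm{Sgn}(f(x)-\sigma_{xy}f(y))$ (for all ordered pairs $x\sim y$) with $z_{xy}=-\sigma_{xy}z_{yx}$, and $z_x,z_x'\in\mathrm{Sgn}(f(x))$, such that $\sum_{y\sim x}w_{xy}z_{xy}+\kappa_xz_x=\lambda\mu_xz'_x$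 for all $x\in V$. Minimal support. $\mathrm{supp}(g)=\{x:g(x)\ne0\}$. An eigenfunction $f$ corresponding to $\lambda$ has minimal support if every eigenfunction $g$ corresponding to $\lambda$ with $\mathrm{supp}(g)\subset\mathrm{supp}(f)$ satisfies $\mathrm{supp}(g)=\mathrm{supp}(f)$. Variational eigenvalues. $\mathcal S_p=\{f\in\mathbb R^V:\sum_x\mu_x|f(x)|^p=1\}$. For a compact set $S=-S$ its index (Krasnoselskii genus) $\gamma(S)$ is $0$ if $S=\emptyset$, otherwise the least positive integer $k$ for which an odd continuous map $S\to\mathbb R^k\setminus\{0\}$ exists ($\infty$ if none). $\mathcal F_k(\mathcal S_p)$ is the family of compact $A=-A\subset\mathcal S_p$ with $\gamma(A)\ge k$. With $\mathcal R_p^\sigma(f)=\frac{\sum_{\{x,y\}\in E}w_{xy}|f(x)-\sigma_{xy}f(y)|^p+\sum_{x\in V}\kappa_x|f(x)|^p}{\sum_{x\in V}\mu_x|f(x)|^p}$, set $\lambda_k=\inf_{S\in\mathcal F_k(\mathcal S_p)}\sup_{f\in S}\mathcal R_p^\sigma(f)$, $k=1,\dots,n$. Strong nodal domains. For a signature $s$ on $G$ and $f:V\to\mathbb R$, a sequence $x_1,\dots,x_m$ of vertices is a strong nodal domain walk of $f$ with respect to $(G,s)$ if $x_i\sim x_{i+1}$ and $f(x_i)s_{x_ix_{i+1}}f(x_{i+1})>0$ for all $i<m$. On $\{x:f(x)\ne0\}$ let $x,y$ be equivalent if $x=y$ or a strong nodal domain walk connects them; the number of strong nodal domains of $f$ with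 respect to $(G,s)$ is the number of equivalence classes. It is denoted $\mathfrak S(f)$ for $s=\sigma$ and $\overline{\mathfrak S}(f)$ for $s=-\sigma$. *)

theory Defs
  imports "HOL-Analysis.Analysis"
begin

(* The vertex set is the whole finite type 'v, so n = CARD('v), and functions on the vertices
   are vectors in real^'v. Edges are two-element sets. Weights and signatures are total
   functions on vertex sets, of which only the values on the edge set E are ever used. *)

definition simple_graph :: "'v::finite set set \<Rightarrow> bool" where
  "simple_graph E \<longleftrightarrow> (\<forall>e\<in>E. card e = 2)"

definition signature :: "'v::finite set set \<Rightarrow> ('v set \<Rightarrow> real) \<Rightarrow> bool" where
  "signature E s \<longleftrightarrow> (\<forall>e\<in>E. s e \<in> {-1, 1})"

definition nbrs :: "'v::finite set set \<Rightarrow> 'v \<Rightarrow> 'v set" where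
  "nbrs E x = {y. {x, y} \<in> E}"

definition balanced :: "'v::finite set set \<Rightarrow> ('v set \<Rightarrow> real) \<Rightarrow> bool" where
  "balanced E \<sigma> \<longleftrightarrow>
     (\<exists>\<tau> :: 'v \<Rightarrow> real. (\<forall>x. \<tau> x \<in> {-1, 1}) \<and>
        (\<forall>x y. {x, y} \<in> E \<longrightarrow> \<tau> x * \<sigma> {x, y} * \<tau> y = 1))"


definition Phi :: "real \<Rightarrow> real \<Rightarrow> real" where
  "Phi p t = (if t = 0 then 0 else \<bar>t\<bar> powr (p - 2) * t)"

definition Sgn :: "real \<Rightarrow> real set" where
  "Sgn t = (if t > 0 then {1} else if t = 0 then {-1..1} else {-1})"

definition p_laplacian ::
  "'v::finite set set \<Rightarrow> ('v set \<Rightarrow> real) \<Rightarrow> ('v \<Rightarrow> real) \<Rightarrow> ('v set \<Rightarrow> real) \<Rightarrow> real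
     \<Rightarrow> real^'v \<Rightarrow> 'v \<Rightarrow> real" where
  "p_laplacian E w \<kappa> \<sigma> p f x =
     (\<Sum>y\<in>nbrs E x. w {x, y} * Phi p (f $ x - \<sigma> {x, y} * f $ y)) + \<kappa> x * Phi p (f $ x)"

definition p_eigenfunction ::
  "'v::finite set set \<Rightarrow> ('v set \<Rightarrow> real) \<Rightarrow> ('v \<Rightarrow> real) \<Rightarrow> ('v \<Rightarrow> real) \<Rightarrow> ('v set \<Rightarrow> real)
     \<Rightarrow> real \<Rightarrow> real \<Rightarrow> real^'v \<Rightarrow> bool" where
  "p_eigenfunction E w \<mu> \<kappa> \<sigma> p l f \<longleftrightarrow>
     f \<noteq> 0 \<and> (\<forall>x. p_laplacian E w \<kappa> \<sigma> p f x = l * \<mu> x * Phi p (f $ x))"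

definition one_eigenfunction ::
  "'v::finite set set \<Rightarrow> ('v set \<Rightarrow> real) \<Rightarrow> ('v \<Rightarrow> real) \<Rightarrow> ('v \<Rightarrow> real) \<Rightarrow> ('v set \<Rightarrow> real)
     \<Rightarrow> real \<Rightarrow> real^'v \<Rightarrow> bool" where
  "one_eigenfunction E w \<mu> \<kappa> \<sigma> l f \<longleftrightarrow>
     f \<noteq> 0 \<and>
     (\<exists>(z :: 'v \<Rightarrow> 'v \<Rightarrow> real) (u :: 'v \<Rightarrow> real) (u' :: 'v \<Rightarrow> real).
        (\<forall>x y. {x, y} \<in> E \<longrightarrow>
           z x y \<in> Sgn (f $ x - \<sigma> {x, y} * f $ y) \<and> z x y = - \<sigma> {x, y} * z y x) \<and>
        (\<forall>x. u x \<in> Sgn (f $ x) \<and> u' x \<in> Sgn (f $ x)) \<and>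
        (\<forall>x. (\<Sum>y\<in>nbrs E x. w {x, y} * z x y) + \<kappa> x * u x = l * \<mu> x * u' x))"

definition eigenfunction ::
  "'v::finite set set \<Rightarrow> ('v set \<Rightarrow> real) \<Rightarrow> ('v \<Rightarrow> real) \<Rightarrow> ('v \<Rightarrow> real) \<Rightarrow> ('v set \<Rightarrow> real)
     \<Rightarrow> real \<Rightarrow> real \<Rightarrow> real^'v \<Rightarrow> bool" where
  "eigenfunction E w \<mu> \<kappa> \<sigma> p l f \<longleftrightarrow>
     (if p = 1 then one_eigenfunction E w \<mu> \<kappa> \<sigma> l f else p_eigenfunction E w \<mu> \<kappa> \<sigma> p l f)"

definition support :: "real^'v::finite \<Rightarrow> 'v set" where
  "support f = {x. f $ x \<noteq> 0}"

definition minimal_support ::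
  "'v::finite set set \<Rightarrow> ('v set \<Rightarrow> real) \<Rightarrow> ('v \<Rightarrow> real) \<Rightarrow> ('v \<Rightarrow> real) \<Rightarrow> ('v set \<Rightarrow> real)
     \<Rightarrow> real \<Rightarrow> real \<Rightarrow> real^'v \<Rightarrow> bool" where
  "minimal_support E w \<mu> \<kappa> \<sigma> p l f \<longleftrightarrow>
     (\<forall>g. eigenfunction E w \<mu> \<kappa> \<sigma> p l g \<and> support g \<subseteq> support f \<longrightarrow> support g = support f)"


(* The term of the edge e in the numerator of the Rayleigh quotient. For a signature it does
   not depend on the order of the two endpoints, see edge_term_eq below. *)
definition edge_term ::
  "('v::finite set \<Rightarrow> real) \<Rightarrow> real \<Rightarrow> real^'v \<Rightarrow> 'v set \<Rightarrow> real" where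
  "edge_term \<sigma> p f e = (THE a. \<exists>x y. e = {x, y} \<and> a = \<bar>f $ x - \<sigma> e * f $ y\<bar> powr p)"

lemma edge_term_eq:
  assumes "\<sigma> {x, y} \<in> {-1, 1}"
  shows "edge_term \<sigma> p f {x, y} = \<bar>f $ x - \<sigma> {x, y} * f $ y\<bar> powr p"
  unfolding edge_term_def
proof (rule the_equality)
  show "\<exists>a b. {x, y} = {a, b} \<and>
          \<bar>f $ x - \<sigma> {x, y} * f $ y\<bar> powr p = \<bar>f $ a - \<sigma> {x, y} * f $ b\<bar> powr p"
    by blast
next
  fix t
  assume "\<exists>a b. {x, y} = {a, b} \<and> t = \<bar>f $ a - \<sigma> {x, y} * f $ b\<bar> powr p"
  then obtain a b where ab: "{x, y} = {a, b}" "t = \<bar>f $ a - \<sigma> {x, y} * f $ b\<bar> powr p"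
    by blast
  have "\<bar>f $ y - \<sigma> {x, y} * f $ x\<bar> = \<bar>f $ x - \<sigma> {x, y} * f $ y\<bar>"
    using assms by (auto simp: abs_minus_commute add.commute)
  with ab show "t = \<bar>f $ x - \<sigma> {x, y} * f $ y\<bar> powr p"
    by (auto simp: doubleton_eq_iff)
qed

definition rayleigh ::
  "'v::finite set set \<Rightarrow> ('v set \<Rightarrow> real) \<Rightarrow> ('v \<Rightarrow> real) \<Rightarrow> ('v \<Rightarrow> real) \<Rightarrow> ('v set \<Rightarrow> real)
     \<Rightarrow> real \<Rightarrow> real^'v \<Rightarrow> real" where
  "rayleigh E w \<mu> \<kappa> \<sigma> p f =
     ((\<Sum>e\<in>E. w e * edge_term \<sigma> p f e) + (\<Sum>x\<in>UNIV. \<kappa> x * \<bar>f $ x\<bar> powr p)) /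
     (\<Sum>x\<in>UNIV. \<mu> x * \<bar>f $ x\<bar> powr p)"

definition p_sphere :: "('v::finite \<Rightarrow> real) \<Rightarrow> real \<Rightarrow> (real^'v) set" where
  "p_sphere \<mu> p = {f. (\<Sum>x\<in>UNIV. \<mu> x * \<bar>f $ x\<bar> powr p) = 1}"

definition odd_map_to_punctured :: "(real^'v::finite) set \<Rightarrow> nat \<Rightarrow> bool" where
  "odd_map_to_punctured S k \<longleftrightarrow>
     (\<exists>h :: real^'v \<Rightarrow> nat \<Rightarrow> real.
        continuous_map (top_of_set S) (subtopology (Euclidean_space k) (- {\<lambda>i. 0})) h \<and>
        (\<forall>f\<in>S. \<forall>i. h (- f) i = - h f i))"

(* The infimum of the empty set in enat is infinity. *)
definition krasnoselskii_genus :: "(real^'v::finite) set \<Rightarrow> enat" where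
  "krasnoselskii_genus S =
     (if S = {} then 0 else Inf {enat k | k. 1 \<le> k \<and> odd_map_to_punctured S k})"

definition genus_family :: "('v::finite \<Rightarrow> real) \<Rightarrow> real \<Rightarrow> nat \<Rightarrow> (real^'v) set set" where
  "genus_family \<mu> p k =
     {A. compact A \<and> A = uminus ` A \<and> A \<subseteq> p_sphere \<mu> p \<and> enat k \<le> krasnoselskii_genus A}"

(* For 1 \<le> k \<le> CARD('v) the infimum and the suprema are over nonempty bounded sets of reals;
   outside this range of k the value is meaningless. *)
definition variational_eigenvalue ::
  "'v::finite set set \<Rightarrow> ('v set \<Rightarrow> real) \<Rightarrow> ('v \<Rightarrow> real) \<Rightarrow> ('v \<Rightarrow> real) \<Rightarrow> ('v set \<Rightarrow> real)
     \<Rightarrow> real \<Rightarrow> nat \<Rightarrow> real" where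
  "variational_eigenvalue E w \<mu> \<kappa> \<sigma> p k =
     (INF S\<in>genus_family \<mu> p k. SUP f\<in>S. rayleigh E w \<mu> \<kappa> \<sigma> p f)"


definition strong_nodal_walk ::
  "'v::finite set set \<Rightarrow> ('v set \<Rightarrow> real) \<Rightarrow> real^'v \<Rightarrow> 'v list \<Rightarrow> bool" where
  "strong_nodal_walk E s f xs \<longleftrightarrow>
     successively (\<lambda>x y. {x, y} \<in> E \<and> f $ x * s {x, y} * f $ y > 0) xs"

definition strong_nodal_rel ::
  "'v::finite set set \<Rightarrow> ('v set \<Rightarrow> real) \<Rightarrow> real^'v \<Rightarrow> ('v \<times> 'v) set" where
  "strong_nodal_rel E s f =
     {(x, y). x \<in> support f \<and> y \<in> support f \<and>
        (x = y \<or> (\<exists>xs. xs \<noteq> [] \<and> strong_nodal_walk E s f xs \<and> hd xs = x \<and> last xs = y))}"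

definition num_strong_nodal_domains ::
  "'v::finite set set \<Rightarrow> ('v set \<Rightarrow> real) \<Rightarrow> real^'v \<Rightarrow> nat" where
  "num_strong_nodal_domains E s f = card (support f // strong_nodal_rel E s f)"

end

theory Submission
  imports Defs
begin

text \<open>
  Fix the eigenvalue \<open>\<lambda>\<close> and consider \<open>J f = numerator - \<lambda> \<cdot> denominator\<close> of the Rayleigh quotient, so that the quotient of
  \<open>f \<noteq> 0\<close> is at most \<open>\<lambda>\<close> iff \<open>J f \<le> 0\<close>. Pairing the eigenvalue equation of \<open>f\<close> with \<open>\<bar>t\<bar>\<^sup>p f\<close> and using the convexity of
  \<open>\<bar>x\<bar>\<^sup>p\<close> on each edge shows that \<open>J (t f) \<le> 0\<close> if \<open>t\<close> is constant on the nodal domains for \<open>\<sigma>\<close>, and \<open>J (t f) \<ge> 0\<close> if \<open>t\<close> is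
  constant on the nodal domains for \<open>- \<sigma>\<close> (\<open>energy_rescale_le\<close>, \<open>energy_rescale_ge\<close>).

  Suppose that \<open>f\<close> has more domains than claimed. Take the restrictions of \<open>f\<close> to as many domains as the bound
  allows; at least one domain is left out. Their span \<open>X\<close> consists of functions with strictly smaller support than \<open>f\<close>, and
  so contains no eigenfunction for \<open>\<lambda>\<close> because the support of \<open>f\<close> is minimal. This contradicts the minimax
  principle. For \<open>\<sigma>\<close>, the unit sphere of \<open>X\<close> has genus \<open>k\<close> and lies in \<open>J \<le> 0\<close>; as it contains no critical point at
  level \<open>\<lambda>\<close>, it can be pushed strictly below \<open>\<lambda>\<close> by an odd map, so that \<open>\<lambda>\<^sub>k < \<lambda>\<close> (\<open>variational_less\<close>). For \<open>- \<sigma>\<close>, the space \<open>X\<close> lies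
  in \<open>J \<ge> 0\<close> and has codimension \<open>k + r - 2\<close>, so that it meets every odd deformation of a set of genus \<open>k + r - 1\<close>; if it had no critical
  point at level \<open>\<lambda>\<close>, almost optimal sets for \<open>\<lambda>\<^bsub>k+r-1\<^esub> = \<lambda>\<close> could be deformed so that they meet \<open>X\<close> only below this level (\<open>eigenfunction_in_linking_subspace\<close>).

  Both steps need a descent field that is odd and continuous. It is constructed for \<open>p \<ge> 1\<close> uniformly, with the
  subdifferential of \<open>\<bar>t\<bar>\<^sup>p\<close> in place of a derivative (\<open>odd_descent_field\<close>, \<open>energy_no_descent\<close>). The lower bound for the
  genus is the Borsuk-Ulam theorem, which is deduced here from Tucker's combinatorial lemma on a
  centrally symmetric version of Kuhn's triangulation of the cube (\<open>tucker\<close>, \<open>borsuk_ulam_subspace\<close>).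

  For \<open>p = 1\<close> the restriction of \<open>f\<close> to one nodal domain is again an eigenfunction, so that minimality leaves only one
  domain. If moreover the graph is balanced, switching makes \<open>f\<close> positive on its support up to a global sign; then every vertex of the support is a
  domain for \<open>- \<sigma>\<close>, and the bound on their number is a bound on the size of the support.
\<close>

section \<open>Kuhn simplices in a lattice cube\<close>

text \<open>Kuhn triangulates the cube \<open>[0,N]\<close> in the coordinates \<open>I\<close> by the chains of lattice points in which any two points
  differ by at most one in every coordinate. Describing a simplex by its vertex set, without a base point and a
  permutation, makes its faces (subsets) and the restriction to \<open>x\<^sub>i = 0\<close> (the same set, smaller \<open>I\<close>) trivial.
  The coordinates outside \<open>I\<close> are pinned to the default value 0.\<close>
definition kuhn_chains :: "nat \<Rightarrow> nat set \<Rightarrow> nat \<Rightarrow> (nat \<Rightarrow> nat) set set" where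
  "kuhn_chains N I j = {S. finite S \<and> card S = j \<and>
     (\<forall>y\<in>S. \<forall>i. y i \<le> N \<and> (i \<notin> I \<longrightarrow> y i = 0)) \<and>
     (\<forall>y\<in>S. \<forall>z\<in>S. (y \<le> z \<or> z \<le> y) \<and> (\<forall>i. y i \<le> z i + 1))}"

lemma finite_kuhn_chains: "finite I \<Longrightarrow> finite (kuhn_chains N I j)"
proof -
  assume I: "finite I"
  have "kuhn_chains N I j \<subseteq> Pow {f. \<forall>i. (i \<in> I \<longrightarrow> f i \<in> {..N}) \<and> (i \<notin> I \<longrightarrow> f i = 0)}"
    by (auto simp: kuhn_chains_def)
  then show ?thesis
    using finite_set_of_finite_funs[OF I, of "{..N}" 0] by (meson finite_Pow_iff finite_atMost finite_subset)
qed

lemma kuhn_chains_subset: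
  assumes "S \<in> kuhn_chains N I j" "T \<subseteq> S"
  shows "T \<in> kuhn_chains N I (card T)"
proof -
  define P where "P y \<longleftrightarrow> (\<forall>i. y i \<le> N \<and> (i \<notin> I \<longrightarrow> y i = 0))" for y
  define Q where "Q y z \<longleftrightarrow> (y \<le> z \<or> z \<le> y) \<and> (\<forall>i. y i \<le> z i + 1)" for y z :: "nat \<Rightarrow> nat"
  have K: "kuhn_chains N I k = {S. finite S \<and> card S = k \<and> (\<forall>y\<in>S. P y) \<and> (\<forall>y\<in>S. \<forall>z\<in>S. Q y z)}" for k
    by (simp only: kuhn_chains_def P_def Q_def)
  show ?thesis using assms finite_subset[of T S] by (auto simp: K)
qed

lemma sum_eq_plus_card_increases:
  fixes y z :: "nat \<Rightarrow> nat"
  assumes "finite I" "y \<le> z" "\<And>i. z i \<le> y i + 1" "\<And>i. i \<notin> I \<Longrightarrow> z i = 0"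
  shows "sum z I = sum y I + card {i. y i < z i}"
proof -
  have "z i = y i + (if y i < z i then 1 else 0)" for i
    using assms(3)[of i] assms(2)[THEN le_funD, of i] by auto
  then have "sum z I = sum y I + (\<Sum>i\<in>I. if y i < z i then 1 else 0)"
    by (metis (no_types, lifting) sum.cong sum.distrib)
  also have "(\<Sum>i\<in>I. if y i < z i then 1 else (0::nat)) = card {i\<in>I. y i < z i}"
    using assms(1) by (simp add: sum.If_cases Int_def)
  also have "{i\<in>I. y i < z i} = {i. y i < z i}" using assms(4) by force
  finally show ?thesis .
qed

lemma kuhn_chain_ends:
  assumes "S \<in> kuhn_chains N I j" "0 < j"
  obtains b t where "b \<in> S" "t \<in> S" "\<And>y. y \<in> S \<Longrightarrow> b \<le> y" "\<And>y. y \<in> S \<Longrightarrow> y \<le> t"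
proof -
  have S: "finite S" "S \<noteq> {}" "\<And>y z. y \<in> S \<Longrightarrow> z \<in> S \<Longrightarrow> y \<le> z \<or> z \<le> y"
    using assms by (auto simp: kuhn_chains_def)
  obtain b where "b \<in> S" "\<forall>y\<in>S. y \<le> b \<longrightarrow> b = y"
    using finite_has_minimal[OF S(1,2)] by blast
  moreover obtain t where "t \<in> S" "\<forall>y\<in>S. t \<le> y \<longrightarrow> t = y"
    using finite_has_maximal[OF S(1,2)] by blast
  ultimately show ?thesis using that S(3) by (metis order_refl)
qed

lemma sum_eq_imp_eq:
  fixes y z :: "nat \<Rightarrow> nat"
  assumes "finite I" "y \<le> z" "\<And>i. i \<notin> I \<Longrightarrow> z i = 0" "sum z I \<le> sum y I"
  shows "y = z"
proof (rule ccontr)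
  assume "y \<noteq> z"
  then obtain i where i: "y i < z i" using assms(2) by (metis antisym le_funI linorder_not_less)
  then have "i \<in> I" using assms(3) by force
  then have "sum y I < sum z I" using i assms(1,2) by (intro sum_strict_mono_ex1) (auto simp: le_fun_def)
  then show False using assms(4) by simp
qed

lemma kuhn_chain_inj:
  assumes "S \<in> kuhn_chains N I j" "finite I"
  shows "inj_on (\<lambda>y. sum y I) S"
proof (rule inj_onI)
  fix y z assume yz: "y \<in> S" "z \<in> S" "sum y I = sum z I"
  have 0: "\<And>i. i \<notin> I \<Longrightarrow> y i = 0 \<and> z i = 0" and "y \<le> z \<or> z \<le> y"
    using assms(1) yz by (auto simp: kuhn_chains_def)
  then show "y = z" using sum_eq_imp_eq[of I y z] sum_eq_imp_eq[of I z y] assms(2) yz(3) by auto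
qed

text \<open>The coordinate sum is a rank function on a chain: it is injective there, and all ranks lie between the rank of the
  least point \<open>b\<close> and that of the greatest point \<open>t\<close>, which exceeds it by the number of coordinates that increase.\<close>
lemma kuhn_chain_card_le:
  assumes S: "S \<in> kuhn_chains N I j" and I: "finite I" and b: "b \<in> S" "\<And>y. y \<in> S \<Longrightarrow> b \<le> y"
    and t: "t \<in> S" "\<And>y. y \<in> S \<Longrightarrow> y \<le> t"
  shows "(\<lambda>y. sum y I) ` S \<subseteq> {sum b I .. sum b I + card {i. b i < t i}}"
    and "{i. b i < t i} \<subseteq> I" and "j \<le> card {i. b i < t i} + 1" and "sum t I = sum b I + card {i. b i < t i}"
proof -
  have 0: "\<And>i. i \<notin> I \<Longrightarrow> t i = 0" "\<And>i. t i \<le> b i + 1"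
    using S b t by (auto simp: kuhn_chains_def)
  show st: "sum t I = sum b I + card {i. b i < t i}" using sum_eq_plus_card_increases[OF I] b t 0 by auto
  show im: "(\<lambda>y. sum y I) ` S \<subseteq> {sum b I .. sum b I + card {i. b i < t i}}"
  proof
    fix r assume "r \<in> (\<lambda>y. sum y I) ` S"
    then obtain y where y: "y \<in> S" "r = sum y I" by auto
    have "sum b I \<le> sum y I" "sum y I \<le> sum t I"
      using b(2)[OF y(1)] t(2)[OF y(1)] by (auto intro!: sum_mono simp: le_fun_def)
    then show "r \<in> {sum b I .. sum b I + card {i. b i < t i}}" using y(2) st by auto
  qed
  show "{i. b i < t i} \<subseteq> I" using 0 by force
  have "j = card ((\<lambda>y. sum y I) ` S)"
    using card_image[OF kuhn_chain_inj[OF S I]] S by (simp add: kuhn_chains_def)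
  also have "\<dots> \<le> card {sum b I .. sum b I + card {i. b i < t i}}" using im by (intro card_mono) auto
  finally show "j \<le> card {i. b i < t i} + 1" by simp
qed

lemma kuhn_chains_bound:
  assumes S: "S \<in> kuhn_chains N I j" and I: "finite I"
  shows "j \<le> card I + 1"
proof (cases "j = 0")
  case False
  obtain b t where bt: "b \<in> S" "t \<in> S" "\<And>y. y \<in> S \<Longrightarrow> b \<le> y" "\<And>y. y \<in> S \<Longrightarrow> y \<le> t"
    using kuhn_chain_ends[OF S] False by auto
  have "card {i. b i < t i} \<le> card I"
    using kuhn_chain_card_le(2)[OF S I bt(1,3,2,4)] I by (intro card_mono) auto
  then show ?thesis using kuhn_chain_card_le(3)[OF S I bt(1,3,2,4)] by auto
qed simp

definition boundary_facet :: "nat \<Rightarrow> nat set \<Rightarrow> (nat \<Rightarrow> nat) set \<Rightarrow> bool" where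
  "boundary_facet N I S \<longleftrightarrow> (\<exists>i\<in>I. (\<forall>y\<in>S. y i = 0) \<or> (\<forall>y\<in>S. y i = N))"

text \<open>The pseudomanifold property. A facet has \<open>d = card I\<close> points whose ranks are distinct and span at most \<open>d + 1\<close>
  consecutive values. If they span \<open>d + 1\<close> values, exactly one intermediate rank is missing, the two neighbours of the gap
  differ in two coordinates, and these can be raised in either order: two extensions, and no coordinate is constant on
  the facet. If they span \<open>d\<close> values, exactly one coordinate \<open>a\<close> is constant, and the facet can be extended by raising
  \<open>a\<close> at the top or lowering \<open>a\<close> at the bottom, as far as the cube allows.\<close>
lemma kuhn_facet_extensions:
  assumes I: "finite I" "I \<noteq> {}" and N: "0 < N" and S: "S \<in> kuhn_chains N I (card I)"
  shows "odd (card {x. x \<notin> S \<and> insert x S \<in> kuhn_chains N I (Suc (card I))}) \<longleftrightarrow> boundary_facet N I S"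
proof -
  define d where "d = card I"
  have d: "0 < d" using I by (simp add: d_def card_gt_0_iff)
  obtain b t where bt: "b \<in> S" "t \<in> S" "\<And>y. y \<in> S \<Longrightarrow> b \<le> y" "\<And>y. y \<in> S \<Longrightarrow> y \<le> t"
    using kuhn_chain_ends[OF S] d d_def by auto
  note cl = kuhn_chain_card_le[OF S I(1) bt(1,3,2,4)]
  define D where "D = {i. b i < t i}"
  have Scl: "\<And>y z i. y \<in> S \<Longrightarrow> z \<in> S \<Longrightarrow> y i \<le> z i + 1"
    and Sle: "\<And>y i. y \<in> S \<Longrightarrow> y i \<le> N" and S0: "\<And>y i. y \<in> S \<Longrightarrow> i \<notin> I \<Longrightarrow> y i = 0"
    and Sch: "\<And>y z. y \<in> S \<Longrightarrow> z \<in> S \<Longrightarrow> y \<le> z \<or> z \<le> y" and Sf: "finite S" and Sc: "card S = d"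
    using S by (auto simp: kuhn_chains_def d_def)
  define E where "E = {x. x \<notin> S \<and> insert x S \<in> kuhn_chains N I (Suc d)}"
  have E_iff: "x \<in> E \<longleftrightarrow> x \<notin> S \<and> (\<forall>i. x i \<le> N \<and> (i \<notin> I \<longrightarrow> x i = 0)) \<and>
      (\<forall>y\<in>S. (y \<le> x \<or> x \<le> y) \<and> (\<forall>i. x i \<le> y i + 1 \<and> y i \<le> x i + 1))" for x
    unfolding E_def kuhn_chains_def using Scl Sle S0 Sch Sf Sc by auto
  have Dle: "card D \<le> d" "D \<subseteq> I" using cl(2) I(1) by (auto simp: D_def d_def intro: card_mono)
  have tD: "t i = b i + (if i \<in> D then 1 else 0)" for i
    using le_funD[OF bt(3)[OF bt(2)], of i] Scl[OF bt(2,1), of i] by (auto simp: D_def)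
  have inj: "inj_on (\<lambda>y. sum y I) S" using kuhn_chain_inj[OF S I(1)] .
  have img: "card ((\<lambda>y. sum y I) ` S) = d" using card_image[OF inj] Sc by simp
  \<comment> \<open>Two comparable points of equal rank coincide, so that a new vertex needs a rank of its own.\<close>
  have newrank: "sum x I \<notin> (\<lambda>y. sum y I) ` S" if x: "x \<in> E" for x
  proof
    assume "sum x I \<in> (\<lambda>y. sum y I) ` S"
    then obtain y where y: "y \<in> S" "sum x I = sum y I" by auto
    have "y \<le> x \<or> x \<le> y" "\<And>i. i \<notin> I \<Longrightarrow> x i = 0" "x \<notin> S" using x y(1) E_iff by auto
    then show False using sum_eq_imp_eq[of I x y] sum_eq_imp_eq[of I y x] y S0 I(1) by (metis order_refl)
  qed
  show ?thesis
  proof (cases "card D = d")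
    case True
    then have DI: "D = I" using Dle I(1) by (metis card_subset_eq d_def)
    have nb: "\<not> boundary_facet N I S"
    proof
      assume "boundary_facet N I S"
      then obtain i where i: "i \<in> I" "(\<forall>y\<in>S. y i = 0) \<or> (\<forall>y\<in>S. y i = N)" by (auto simp: boundary_facet_def)
      then have "t i = b i" using bt(1,2) by metis
      then show False using tD[of i] i(1) DI by simp
    qed
    have "card ({sum b I .. sum b I + d} - (\<lambda>y. sum y I) ` S) = 1"
      using cl(1) img True by (subst card_Diff_subset) (auto simp: D_def Sf)
    \<comment> \<open>The rank that is missing from the facet; a new vertex must have it.\<close>
    then obtain r where r: "{sum b I .. sum b I + d} - (\<lambda>y. sum y I) ` S = {r}"
      by (metis card_1_singletonE)
    have rk: "q \<in> (\<lambda>y. sum y I) ` S \<longleftrightarrow> q \<noteq> r" if "q \<in> {sum b I .. sum b I + d}" for q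
      using r that by blast
    have rb: "r \<noteq> sum b I" "r \<noteq> sum b I + d"
      using r bt(1,2) cl(4) True D_def by (metis DiffD2 image_eqI insertI1)+
    have rin: "sum b I < r" "r < sum b I + d" using r rb by (metis DiffD1 atLeastAtMost_iff insertI1 le_neq_implies_less)+
    have "r - 1 \<in> (\<lambda>y. sum y I) ` S" "r + 1 \<in> (\<lambda>y. sum y I) ` S" using rin by (subst rk; auto)+
    then obtain y z where yz: "y \<in> S" "sum y I = r - 1" "z \<in> S" "sum z I = r + 1" by (metis (no_types, lifting) imageE)
    have mono: "u \<le> v" if "u \<in> S" "v \<in> S" "sum u I \<le> sum v I" for u v
    proof -
      have "v = u" if "v \<le> u" using sum_eq_imp_eq[of I v u] that \<open>sum u I \<le> sum v I\<close> S0[OF \<open>u \<in> S\<close>] I(1) by auto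
      then show ?thesis using Sch that by blast
    qed
    have yz': "y \<le> z" using mono yz by auto
    have "card {i. y i < z i} = 2"
      using sum_eq_plus_card_increases[OF I(1) yz'] Scl[OF yz(3,1)] S0[OF yz(3)] yz rin by auto
    then obtain a c where ac: "{i. y i < z i} = {a, c}" "a \<noteq> c" by (meson card_2_iff)
    have acI: "a \<in> I" "c \<in> I" using ac S0[OF yz(3)] by (metis (mono_tags) gr_zeroI insertCI less_nat_zero_code mem_Collect_eq)+
    have zy: "z i = y i + (if i = a \<or> i = c then 1 else 0)" for i
    proof (cases "y i < z i")
      case True
      then have "i \<in> {a, c}" using ac(1) by blast
      then show ?thesis using Scl[OF yz(3,1), of i] True by auto
    next
      case False
      then have "i \<notin> {a, c}" using ac(1) by blast
      then show ?thesis using le_funD[OF yz', of i] False by auto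
    qed
    define pa where "pa = y(a := y a + 1)"
    define pc where "pc = y(c := y c + 1)"
    have upd: "sum (y(e := y e + 1)) I = sum y I + 1" if "e \<in> I" for e
    proof -
      have "sum (y(e := y e + 1)) (I - {e}) = sum y (I - {e})" by (rule sum.cong) auto
      then show ?thesis using sum.remove[OF I(1) that, of y] sum.remove[OF I(1) that, of "y(e := y e + 1)"] by simp
    qed
    have sp: "sum pa I = r" "sum pc I = r"
      using yz(2) rin upd acI by (auto simp: pa_def pc_def)
    have mid: "q \<in> E" if q: "y \<le> q" "q \<le> z" "sum q I = r" for q
      unfolding E_iff
    proof (intro conjI ballI allI impI)
      show "q \<notin> S" using q(3) r by blast
      show "q i \<le> N" for i using le_funD[OF q(2), of i] Sle[OF yz(3), of i] by simp
      show "i \<notin> I \<Longrightarrow> q i = 0" for i using le_funD[OF q(2), of i] S0[OF yz(3), of i] by simp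
      fix u assume u: "u \<in> S"
      have "sum u I \<noteq> r" using u r by blast
      then consider "sum u I \<le> r - 1" | "sum u I \<ge> r + 1" by linarith
      then show "u \<le> q \<or> q \<le> u"
      proof cases
        case 1 then show ?thesis using mono[OF u yz(1)] yz(2) q(1) by (auto intro: order_trans)
      next
        case 2 then show ?thesis using mono[OF yz(3) u] yz(4) q(2) by (auto intro: order_trans)
      qed
      fix i
      show "q i \<le> u i + 1" using le_funD[OF q(2), of i] Scl[OF yz(3) u, of i] by simp
      show "u i \<le> q i + 1" using le_funD[OF q(1), of i] Scl[OF u yz(1), of i] by simp
    qed
    have "E = {pa, pc}"
    proof (intro set_eqI iffI)
      fix x assume "x \<in> {pa, pc}"
      moreover have "y \<le> pa" "pa \<le> z" "y \<le> pc" "pc \<le> z" using zy ac(2) by (auto simp: pa_def pc_def le_fun_def)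
      ultimately show "x \<in> E" using mid sp by auto
    next
      fix x assume x: "x \<in> E"
      have xb: "b \<le> x \<or> x \<le> b" "x \<le> t \<or> t \<le> x" "\<And>i. x i \<le> b i + 1" "\<And>i. t i \<le> x i + 1" "\<And>i. i \<notin> I \<Longrightarrow> x i = 0" "x \<notin> S"
        using x bt(1,2) unfolding E_iff by auto
      have "b \<le> x"
      proof (rule ccontr)
        assume "\<not> b \<le> x"
        then have "x \<le> b" using xb by auto
        moreover have "b \<le> x" unfolding le_fun_def
        proof
          fix i show "b i \<le> x i" using xb(4)[of i] tD[of i] S0[OF bt(1), of i] DI by (cases "i \<in> I") auto
        qed
        ultimately show False using xb(6) bt(1) by (metis antisym)
      qed
      moreover have "x \<le> t"
      proof (rule ccontr)
        assume "\<not> x \<le> t"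
        then have "t \<le> x" using xb by auto
        moreover have "x \<le> t" unfolding le_fun_def
        proof
          fix i show "x i \<le> t i" using xb(3,5)[of i] tD[of i] S0[OF bt(1), of i] DI by (cases "i \<in> I") auto
        qed
        ultimately show False using xb(6) bt(2) by (metis antisym)
      qed
      ultimately have "sum x I \<in> {sum b I .. sum b I + d}"
        using cl(4) True by (auto simp: le_fun_def D_def intro!: sum_mono) (metis sum_mono)
      then have sx: "sum x I = r" using rk newrank[OF x] by blast
      have "y \<le> x \<or> x \<le> y" "x \<le> z \<or> z \<le> x" using x yz unfolding E_iff by auto
      moreover have "\<not> x \<le> y" 
      proof
        assume "x \<le> y" then have "sum x I \<le> sum y I" by (simp add: le_fun_def sum_mono)
        then show False using sx yz rin by simp
      qed
      moreover have "\<not> z \<le> x" 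
      proof
        assume "z \<le> x" then have "sum z I \<le> sum x I" by (simp add: le_fun_def sum_mono)
        then show False using sx yz rin by simp
      qed
      ultimately have yxz: "y \<le> x" "x \<le> z" by auto
      have "card {i. y i < x i} = 1"
      proof -
        have "x i \<le> y i + 1" for i using le_funD[OF yxz(2), of i] zy[of i] by (auto split: if_splits)
        then show ?thesis using sum_eq_plus_card_increases[OF I(1) yxz(1)] xb(5) sx yz rin by auto
      qed
      then obtain e where e: "{i. y i < x i} = {e}" by (metis card_1_singletonE)
      have "e = a \<or> e = c"
      proof -
        have "y e < x e" using e by auto
        then have "y e < z e" using le_funD[OF yxz(2), of e] by simp
        then show ?thesis using ac by blast
      qed
      moreover have "x = y(e := y e + 1)"
      proof
        fix i
        show "x i = (y(e := y e + 1)) i"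
        proof (cases "i = e")
          case True
          have "y e < x e" using e by auto
          then show ?thesis using True le_funD[OF yxz(2), of e] zy[of e] by (auto split: if_splits)
        next
          case False
          then have "\<not> y i < x i" using e by auto
          then show ?thesis using False le_funD[OF yxz(1), of i] by simp
        qed
      qed
      ultimately show "x \<in> {pa, pc}" by (auto simp: pa_def pc_def)
    qed
    moreover have "pa \<noteq> pc" using ac(2) by (auto simp: pa_def pc_def fun_eq_iff)
    ultimately have "card E = 2" by simp
    then show ?thesis using nb by (simp add: E_def d_def)
  next
    case False
    have cD: "card D + 1 = d" using cl(3) Dle(1) False by (auto simp: D_def d_def)
    then have "card (I - D) = 1" using Dle(2) I(1) d_def by (simp add: card_Diff_subset finite_subset)
    then obtain a where a: "I - D = {a}" by (metis card_1_singletonE)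
    then have aI: "a \<in> I" "a \<notin> D" "\<And>i. i \<in> I \<Longrightarrow> i \<noteq> a \<Longrightarrow> i \<in> D" by auto
    have surj: "(\<lambda>y. sum y I) ` S = {sum b I .. sum t I}"
      using cl(1,4) img cD by (intro card_subset_eq) (auto simp: D_def)
    have Sa: "y a = b a" if "y \<in> S" for y
      using le_funD[OF bt(3)[OF that], of a] le_funD[OF bt(4)[OF that], of a] tD[of a] aI(2) by auto
    have Eeq: "E = {x. x = t(a := t a + 1) \<and> t a < N \<or> x = b(a := b a - 1) \<and> 0 < b a}"
    proof (intro set_eqI iffI; unfold mem_Collect_eq)
      fix x assume "x = t(a := t a + 1) \<and> t a < N \<or> x = b(a := b a - 1) \<and> 0 < b a"
      then show "x \<in> E"
      proof
        assume x: "x = t(a := t a + 1) \<and> t a < N"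
        have tx: "t \<le> x" using x by (auto simp: le_fun_def)
        show "x \<in> E" unfolding E_iff
        proof (intro conjI ballI allI impI)
          show "x \<notin> S" using Sa[of x] Sa[OF bt(2)] x by auto
          show "x i \<le> N" for i using x Sle[OF bt(2), of i] by auto
          show "i \<notin> I \<Longrightarrow> x i = 0" for i using x S0[OF bt(2), of i] aI by auto
          fix u assume u: "u \<in> S"
          show "u \<le> x \<or> x \<le> u" using bt(4)[OF u] tx by auto
          fix i
          show "u i \<le> x i + 1" using le_funD[OF bt(4)[OF u], of i] le_funD[OF tx, of i] by simp
          show "x i \<le> u i + 1" using Scl[OF bt(2) u, of i] x Sa[OF u] Sa[OF bt(2)] by auto
        qed
      next
        assume x: "x = b(a := b a - 1) \<and> 0 < b a"
        have bx: "x \<le> b" using x by (auto simp: le_fun_def)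
        show "x \<in> E" unfolding E_iff
        proof (intro conjI ballI allI impI)
          show "x \<notin> S" using Sa[of x] x by auto
          show "x i \<le> N" for i using x Sle[OF bt(1), of i] by auto
          show "i \<notin> I \<Longrightarrow> x i = 0" for i using x S0[OF bt(1), of i] aI by auto
          fix u assume u: "u \<in> S"
          show "u \<le> x \<or> x \<le> u" using bt(3)[OF u] bx by auto
          fix i
          show "x i \<le> u i + 1" using le_funD[OF bt(3)[OF u], of i] le_funD[OF bx, of i] by simp
          show "u i \<le> x i + 1" using Scl[OF u bt(1), of i] x Sa[OF u] by auto
        qed
      qed
    next
      fix x assume x: "x \<in> E"
      have xb: "b \<le> x \<or> x \<le> b" "x \<le> t \<or> t \<le> x" "\<And>i. x i \<le> b i + 1" "\<And>i. t i \<le> x i + 1" 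
        "\<And>i. x i \<le> N" "\<And>i. i \<notin> I \<Longrightarrow> x i = 0" "x \<notin> S"
        using x bt(1,2) unfolding E_iff by auto
      have "\<not> (b \<le> x \<and> x \<le> t)"
      proof
        assume "b \<le> x \<and> x \<le> t"
        then have "sum x I \<in> {sum b I .. sum t I}" by (simp add: le_fun_def sum_mono)
        then show False using newrank[OF x] surj by blast
      qed
      then consider "x \<le> b" | "t \<le> x" using xb by auto
      then show "x = t(a := t a + 1) \<and> t a < N \<or> x = b(a := b a - 1) \<and> 0 < b a"
      proof cases
        case 1
        have xi: "x i = b i" if "i \<noteq> a" for i
          using le_funD[OF 1, of i] xb(4,6)[of i] tD[of i] aI(3)[OF _ that] S0[OF bt(1), of i] by (cases "i \<in> I") auto
        have "x a \<noteq> b a" using xi xb(7) bt(1) by (metis ext)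
        then have "x a = b a - 1" "0 < b a" using le_funD[OF 1, of a] xb(4)[of a] tD[of a] aI(2) by auto
        then show ?thesis using xi by (auto simp: fun_eq_iff)
      next
        case 2
        have xi: "x i = t i" if "i \<noteq> a" for i
          using le_funD[OF 2, of i] xb(3,6)[of i] tD[of i] aI(3)[OF _ that] S0[OF bt(2), of i] by (cases "i \<in> I") auto
        have "x a \<noteq> t a" using xi xb(7) bt(2) by (metis ext)
        then have "x a = t a + 1" using le_funD[OF 2, of a] xb(3)[of a] tD[of a] aI(2) by auto
        then show ?thesis using xi xb(5)[of a] by (auto simp: fun_eq_iff)
      qed
    qed
    have ab: "t a = b a" "b a \<le> N" using tD[of a] aI Sle[OF bt(1)] by auto
    have bnd: "boundary_facet N I S \<longleftrightarrow> b a = 0 \<or> b a = N"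
    proof
      assume "boundary_facet N I S"
      then obtain i where i: "i \<in> I" "(\<forall>y\<in>S. y i = 0) \<or> (\<forall>y\<in>S. y i = N)" by (auto simp: boundary_facet_def)
      then have "t i = b i" using bt(1,2) by metis
      then have "i = a" using tD[of i] aI(3)[OF i(1)] by (cases "i \<in> D") auto
      then show "b a = 0 \<or> b a = N" using i(2) bt(1) by metis
    next
      assume "b a = 0 \<or> b a = N"
      then show "boundary_facet N I S" unfolding boundary_facet_def using Sa aI(1) by metis
    qed
    have ne: "t(a := t a + 1) \<noteq> b(a := b a - 1)" using ab by (metis add_diff_cancel_right' diff_add_inverse2 diff_le_self fun_upd_same lessI linorder_not_less Suc_eq_plus1)
    have "odd (card E) \<longleftrightarrow> b a = 0 \<or> b a = N"
    proof -
      consider "b a = 0" | "b a = N" "0 < b a" | "0 < b a" "b a < N" using ab by linarith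
      then show ?thesis
      proof cases
        case 1 then have "E = {t(a := t a + 1)}" using ab N by (auto simp: Eeq)
        then show ?thesis using 1 by simp
      next
        case 2 then have "E = {b(a := b a - 1)}" using ab N by (auto simp: Eeq)
        then show ?thesis using 2 by simp
      next
        case 3 then have "E = {t(a := t a + 1), b(a := b a - 1)}" using ab by (auto simp: Eeq)
        then have "card E = 2" using ne by simp
        then show ?thesis using 3 by simp
      qed
    qed
    then show ?thesis using bnd by (simp add: E_def d_def)
  qed
qed


text \<open>The door-in, door-out principle of Sperner type arguments: a simplex that carries the \<open>d\<close> wanted labels and a further one
  has exactly one facet carrying precisely the wanted labels, while a simplex repeating a wanted label has two such facets.\<close>
lemma odd_facets_with_labels_iff:
  fixes lab :: "'a \<Rightarrow> 'b"
  assumes S: "finite S" "card S = Suc (card L)" and L: "finite L"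
  shows "odd (card {x\<in>S. lab ` (S - {x}) = L}) \<longleftrightarrow> L \<subset> lab ` S"
proof (cases "L \<subset> lab ` S")
  case True
  have "card L < card (lab ` S)" using True S(1) by (intro psubset_card_mono) auto
  moreover have "card (lab ` S) \<le> card S" using S(1) by (rule card_image_le)
  ultimately have cl: "card (lab ` S) = card S" using S(2) by simp
  then have inj: "inj_on lab S" using S(1) by (simp add: eq_card_imp_inj_on)
  have "card (lab ` S - L) = 1" using cl S L True by (subst card_Diff_subset) auto
  then obtain l where l: "lab ` S - L = {l}" by (metis card_1_singletonE)
  then have "l \<in> lab ` S" by auto
  then obtain x0 where x0: "x0 \<in> S" "lab x0 = l" by auto
  have "lab ` (S - {x}) = L \<longleftrightarrow> x = x0" if "x \<in> S" for x
  proof -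
    have "lab ` (S - {x}) = lab ` S - {lab x}" using inj that by (auto simp: inj_on_def)
    moreover have "lab ` S = insert l L" "l \<notin> L" using l True by auto
    moreover have "lab x = l \<longleftrightarrow> x = x0" using inj that x0 by (auto simp: inj_on_def)
    moreover have "lab x \<in> insert l L" using that calculation(2) by blast
    ultimately show ?thesis by auto
  qed
  then have "{x\<in>S. lab ` (S - {x}) = L} = {x0}" using x0 by auto
  then show ?thesis using True by simp
next
  case False
  let ?X = "{x\<in>S. lab ` (S - {x}) = L}"
  have "even (card ?X)"
  proof (cases "?X = {}")
    case True
    then show ?thesis by (simp only: card.empty) simp
  next
    case False': False
    then obtain w where w: "w \<in> S" "lab ` (S - {w}) = L" by auto
    then have lS: "lab ` S = L" using False by blast
    then have "\<not> inj_on lab S" using S(2) by (metis card_image n_not_Suc_n)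
    then obtain x x' where x: "x \<in> S" "x' \<in> S" "x \<noteq> x'" "lab x = lab x'" by (auto simp: inj_on_def)
    have "?X = {x, x'}"
    proof (intro set_eqI iffI)
      fix y assume y: "y \<in> ?X"
      show "y \<in> {x, x'}"
      proof (rule ccontr)
        assume n: "y \<notin> {x, x'}"
        have "card (S - {y}) = card L" using y S by simp
        then have "inj_on lab (S - {y})" using y S(1) by (intro eq_card_imp_inj_on) auto
        then show False using x n by (auto simp: inj_on_def)
      qed
    next
      fix y assume "y \<in> {x, x'}"
      moreover have "lab ` (S - {u}) = lab ` S" if "u \<in> S" "v \<in> S" "v \<noteq> u" "lab u = lab v" for u v
      proof -
        have "lab u \<in> lab ` (S - {u})" using that by auto
        then have "lab ` insert u (S - {u}) = lab ` (S - {u})" by auto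
        then show ?thesis using that(1) by (simp add: insert_absorb)
      qed
      then have "lab ` (S - {x}) = lab ` S" "lab ` (S - {x'}) = lab ` S" using x by metis+
      ultimately show "y \<in> ?X" using x lS by auto
    qed
    then show ?thesis using x by simp
  qed
  then show ?thesis using False by blast
qed

text \<open>Double counting of the pairs (facet with label set \<open>L\<close>, simplex containing it): by simplices with the door principle,
  by facets with the pseudomanifold property.\<close>
lemma kuhn_facet_parity:
  fixes lab :: "(nat \<Rightarrow> nat) \<Rightarrow> 'b"
  assumes I: "finite I" "I \<noteq> {}" and N: "0 < N" and L: "finite L" "card L = card I"
  shows "even (card {S \<in> kuhn_chains N I (Suc (card I)). L \<subset> lab ` S}) \<longleftrightarrow>
    even (card {S \<in> kuhn_chains N I (card I). lab ` S = L \<and> boundary_facet N I S})"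
proof -
  define F where "F = {T \<in> kuhn_chains N I (card I). lab ` T = L}"
  define K where "K = kuhn_chains N I (Suc (card I))"
  have fin: "finite F" "finite K" using finite_kuhn_chains[OF I(1)] by (auto simp: F_def K_def)
  have up: "odd (card {S\<in>K. T \<subset> S}) \<longleftrightarrow> boundary_facet N I T" if T: "T \<in> F" for T
  proof -
    have T': "finite T" "card T = card I" "T \<in> kuhn_chains N I (card I)" using T by (auto simp: F_def kuhn_chains_def)
    have "{S\<in>K. T \<subset> S} = (\<lambda>x. insert x T) ` {x. x \<notin> T \<and> insert x T \<in> K}"
    proof (intro set_eqI iffI)
      fix S assume "S \<in> {S\<in>K. T \<subset> S}"
      then have S: "S \<in> K" "T \<subset> S" "finite S" "card S = Suc (card I)" by (auto simp: K_def kuhn_chains_def)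
      then have "card (S - T) = 1" using T' by (subst card_Diff_subset) auto
      then obtain x where "S - T = {x}" by (metis card_1_singletonE)
      then have "S = insert x T" "x \<notin> T" using S(2) by auto
      then show "S \<in> (\<lambda>x. insert x T) ` {x. x \<notin> T \<and> insert x T \<in> K}" using S(1) by blast
    qed auto
    moreover have "inj_on (\<lambda>x. insert x T) {x. x \<notin> T \<and> insert x T \<in> K}" by (auto simp: inj_on_def)
    ultimately have "card {S\<in>K. T \<subset> S} = card {x. x \<notin> T \<and> insert x T \<in> K}" by (simp add: card_image)
    then show ?thesis using kuhn_facet_extensions[OF I N T'(3)] by (simp add: K_def)
  qed
  have down: "odd (card {T\<in>F. T \<subset> S}) \<longleftrightarrow> L \<subset> lab ` S" if S: "S \<in> K" for S
  proof -
    have S': "finite S" "card S = Suc (card I)" using S by (auto simp: K_def kuhn_chains_def)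
    have "{T\<in>F. T \<subset> S} = (\<lambda>x. S - {x}) ` {x\<in>S. lab ` (S - {x}) = L}"
    proof (intro set_eqI iffI)
      fix T assume "T \<in> {T\<in>F. T \<subset> S}"
      then have T: "T \<in> F" "T \<subset> S" "finite T" "card T = card I" by (auto simp: F_def kuhn_chains_def)
      then have "card (S - T) = 1" using S' by (subst card_Diff_subset) auto
      then obtain x where "S - T = {x}" by (metis card_1_singletonE)
      then have "T = S - {x}" "x \<in> S" using T(2) by auto
      then show "T \<in> (\<lambda>x. S - {x}) ` {x\<in>S. lab ` (S - {x}) = L}" using T(1) F_def by blast
    next
      fix T assume "T \<in> (\<lambda>x. S - {x}) ` {x\<in>S. lab ` (S - {x}) = L}"
      then obtain x where x: "x \<in> S" "T = S - {x}" "lab ` T = L" by auto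
      then have "card T = card I" using S' by simp
      then have "T \<in> kuhn_chains N I (card I)"
        using kuhn_chains_subset[of S N I "Suc (card I)" T] S x(2) by (auto simp: K_def)
      then show "T \<in> {T\<in>F. T \<subset> S}" using x by (auto simp: F_def)
    qed
    moreover have "inj_on (\<lambda>x. S - {x}) {x\<in>S. lab ` (S - {x}) = L}" by (auto simp: inj_on_def)
    ultimately have "card {T\<in>F. T \<subset> S} = card {x\<in>S. lab ` (S - {x}) = L}" by (simp add: card_image)
    then show ?thesis using odd_facets_with_labels_iff[of S L lab] S' L by simp
  qed
  have "(\<Sum>T\<in>F. card {S\<in>K. T \<subset> S}) = (\<Sum>S\<in>K. card {T\<in>F. T \<subset> S})"
    using fin by (intro sum_multicount_gen) auto
  then have "even (card {T\<in>F. odd (card {S\<in>K. T \<subset> S})}) \<longleftrightarrow> even (card {S\<in>K. odd (card {T\<in>F. T \<subset> S})})"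
    using even_sum_iff[OF fin(1), of "\<lambda>T. card {S\<in>K. T \<subset> S}"]
      even_sum_iff[OF fin(2), of "\<lambda>S. card {T\<in>F. T \<subset> S}"] by simp
  moreover have "{T\<in>F. odd (card {S\<in>K. T \<subset> S})} = {T\<in>F. boundary_facet N I T}" using up by auto
  moreover have "{S\<in>K. odd (card {T\<in>F. T \<subset> S})} = {S\<in>K. L \<subset> lab ` S}" using down by auto
  moreover have "{T\<in>F. boundary_facet N I T} = {S \<in> kuhn_chains N I (card I). lab ` S = L \<and> boundary_facet N I S}"
    by (auto simp: F_def)
  ultimately show ?thesis by (simp add: K_def)
qed

section \<open>Tucker's lemma\<close>

text \<open>A sign vector names an orthant of \<open>\<int>\<^sup>n\<close> of any dimension: its support is the set of free coordinates. Reflecting Kuhn's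
  triangulation of \<open>[0,N]\<close> into every orthant gives a triangulation of \<open>[-N,N]\<^sup>n\<close> that is symmetric under \<open>x \<mapsto> -x\<close>.\<close>
definition sign_vectors :: "nat \<Rightarrow> (nat \<Rightarrow> int) set" where
  "sign_vectors n = {s. \<forall>i. (i \<in> {..<n} \<longrightarrow> s i \<in> {-1, 0, 1}) \<and> (i \<notin> {..<n} \<longrightarrow> s i = 0)}"

definition sign_support :: "(nat \<Rightarrow> int) \<Rightarrow> nat set" where
  "sign_support s = {i. s i \<noteq> 0}"

definition orthant_point :: "(nat \<Rightarrow> int) \<Rightarrow> (nat \<Rightarrow> nat) \<Rightarrow> nat \<Rightarrow> int" where
  "orthant_point s y = (\<lambda>i. s i * int (y i))"

definition sign_labels :: "(nat \<Rightarrow> int) \<Rightarrow> (nat \<times> int) set" where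
  "sign_labels s = (\<lambda>i. (i, s i)) ` sign_support s"

lemma finite_sign_vectors: "finite (sign_vectors n)"
proof -
  have "finite {s. \<forall>i. (i \<in> {..<n} \<longrightarrow> s i \<in> {-1, 0, 1 :: int}) \<and> (i \<notin> {..<n} \<longrightarrow> s i = 0)}"
    by (rule finite_set_of_finite_funs[OF finite_lessThan]) simp
  then show ?thesis unfolding sign_vectors_def .
qed

lemma sign_vectorsD:
  assumes "s \<in> sign_vectors n"
  shows "\<bar>s i\<bar> \<le> 1" "n \<le> i \<Longrightarrow> s i = 0" "s i \<noteq> 0 \<Longrightarrow> \<bar>s i\<bar> = 1 \<and> i < n"
proof -
  have *: "(i \<in> {..<n} \<longrightarrow> s i \<in> {-1, 0, 1}) \<and> (i \<notin> {..<n} \<longrightarrow> s i = 0)"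
    using assms[unfolded sign_vectors_def mem_Collect_eq] by (rule spec)
  show "\<bar>s i\<bar> \<le> 1" "n \<le> i \<Longrightarrow> s i = 0" "s i \<noteq> 0 \<Longrightarrow> \<bar>s i\<bar> = 1 \<and> i < n"
    using * by (cases "i < n"; auto)+
qed

lemma sign_vectorsI:
  assumes "\<And>i. i < n \<Longrightarrow> \<bar>s i\<bar> \<le> 1" "\<And>i. n \<le> i \<Longrightarrow> s i = 0"
  shows "s \<in> sign_vectors n"
  unfolding sign_vectors_def mem_Collect_eq
proof (intro allI conjI impI)
  fix i
  show "s i \<in> {-1, 0, 1}" if "i \<in> {..<n}" using assms(1)[of i] that by auto
  show "s i = 0" if "i \<notin> {..<n}" using assms(2)[of i] that by auto
qed

lemma finite_sign_support:
  assumes "s \<in> sign_vectors n"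
  shows "finite (sign_support s)"
proof (rule finite_subset)
  show "sign_support s \<subseteq> {..<n}"
  proof
    fix i assume "i \<in> sign_support s"
    then have "s i \<noteq> 0" by (simp add: sign_support_def)
    from sign_vectorsD(3)[OF assms this] show "i \<in> {..<n}" by simp
  qed
qed simp

lemma card_sign_labels: "card (sign_labels s) = card (sign_support s)"
  unfolding sign_labels_def by (rule card_image) (auto simp: inj_on_def)

lemma mem_sign_labels_iff: "(i, v) \<in> sign_labels s \<longleftrightarrow> s i = v \<and> v \<noteq> 0"
  unfolding sign_labels_def sign_support_def by auto

lemma sign_labels_inj:
  assumes "sign_labels s = sign_labels s'"
  shows "s = s'"
proof
  fix i
  have "s i = v \<and> v \<noteq> 0 \<longleftrightarrow> s' i = v \<and> v \<noteq> 0" for v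
    using assms mem_sign_labels_iff by blast
  from this[of "s i"] this[of "s' i"] show "s i = s' i" by metis
qed

lemma kuhn_chainsD:
  assumes "S \<in> kuhn_chains N I j"
  shows "finite S" "card S = j" "y \<in> S \<Longrightarrow> y i \<le> N" "y \<in> S \<Longrightarrow> i \<notin> I \<Longrightarrow> y i = 0"
    "y \<in> S \<Longrightarrow> z \<in> S \<Longrightarrow> y i \<le> z i + 1"
proof -
  have P: "\<forall>y\<in>S. \<forall>i. y i \<le> N \<and> (i \<notin> I \<longrightarrow> y i = 0)"
    and Q: "\<forall>y\<in>S. \<forall>z\<in>S. (y \<le> z \<or> z \<le> y) \<and> (\<forall>i. y i \<le> z i + 1)"
    and "finite S" "card S = j"
    using assms[unfolded kuhn_chains_def mem_Collect_eq] by - (elim conjE, assumption)+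
  then show "finite S" "card S = j" by -
  show "y i \<le> N" if "y \<in> S" using P[THEN bspec, OF that, THEN spec, of i] by simp
  show "y i = 0" if "y \<in> S" "i \<notin> I" using P[THEN bspec, OF that(1), THEN spec, of i] that(2) by simp
  show "y i \<le> z i + 1" if "y \<in> S" "z \<in> S"
    using Q[THEN bspec, OF that(1), THEN bspec, OF that(2)] by simp
qed

lemma kuhn_chains_change:
  assumes S: "S \<in> kuhn_chains N I j" and 0: "\<And>y i. y \<in> S \<Longrightarrow> i \<notin> J \<Longrightarrow> y i = 0"
  shows "S \<in> kuhn_chains N J j"
proof -
  define Q where "Q y z \<longleftrightarrow> (y \<le> z \<or> z \<le> y) \<and> (\<forall>i. y i \<le> z i + 1)" for y z :: "nat \<Rightarrow> nat"
  have K: "kuhn_chains N I j = {S. finite S \<and> card S = j \<and> (\<forall>y\<in>S. \<forall>i. y i \<le> N \<and> (i \<notin> I \<longrightarrow> y i = 0)) \<and> (\<forall>y\<in>S. \<forall>z\<in>S. Q y z)}" for I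
    by (simp only: kuhn_chains_def Q_def)
  have "\<forall>y\<in>S. \<forall>z\<in>S. Q y z" "finite S" "card S = j"
    using S[unfolded K mem_Collect_eq] by - (elim conjE, assumption)+
  moreover have "\<forall>y\<in>S. \<forall>i. y i \<le> N \<and> (i \<notin> J \<longrightarrow> y i = 0)" using 0 kuhn_chainsD(3)[OF S] by simp
  ultimately show ?thesis by (simp only: K mem_Collect_eq)
qed

text \<open>The nonzero sign vectors fall into pairs \<open>{s, -s}\<close>, and the sign of the first nonzero entry selects one from each pair.\<close>
lemma even_sum_antipodal:
  fixes g :: "(nat \<Rightarrow> int) \<Rightarrow> nat"
  assumes "\<And>s. s \<in> sign_vectors n \<Longrightarrow> g (\<lambda>i. - s i) = g s"
  shows "even (sum g (sign_vectors n - {\<lambda>i. 0}))"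
proof -
  define A where "A e = {s \<in> sign_vectors n - {\<lambda>i. 0}. s (LEAST i. s i \<noteq> 0) = e}" for e :: int
  have ne: "s (LEAST i. s i \<noteq> 0) \<noteq> 0" if "s \<noteq> (\<lambda>i. 0)" for s :: "nat \<Rightarrow> int"
  proof -
    have "\<exists>i. s i \<noteq> 0" using that by (metis ext)
    then obtain i where "s i \<noteq> 0" ..
    then show ?thesis by (rule LeastI)
  qed
  have neg: "(\<lambda>i. - s i) \<in> A (- e)" if "s \<in> A e" for s e
  proof -
    have s: "s \<in> sign_vectors n" "s \<noteq> (\<lambda>i. 0)" "s (LEAST i. s i \<noteq> 0) = e" using that by (auto simp: A_def)
    have "(\<lambda>i. - s i) \<in> sign_vectors n" using sign_vectorsD[OF s(1)] by (intro sign_vectorsI) auto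
    moreover have "(\<lambda>i. - s i) \<noteq> (\<lambda>i. 0)" using s(2) by (auto simp: fun_eq_iff)
    ultimately show ?thesis using s(3) by (simp add: A_def)
  qed
  have fin: "finite (A e)" for e using finite_sign_vectors by (auto simp: A_def)
  have un: "sign_vectors n - {\<lambda>i. 0} = A 1 \<union> A (-1)"
  proof
    show "sign_vectors n - {\<lambda>i. 0} \<subseteq> A 1 \<union> A (-1)"
    proof
      fix s assume s: "s \<in> sign_vectors n - {\<lambda>i. 0}"
      then have "\<bar>s (LEAST i. s i \<noteq> 0)\<bar> = 1" using ne[of s] sign_vectorsD(3)[of s n] by auto
      then have "s (LEAST i. s i \<noteq> 0) = 1 \<or> s (LEAST i. s i \<noteq> 0) = -1" by linarith
      then show "s \<in> A 1 \<union> A (-1)" using s unfolding A_def by blast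
    qed
  qed (auto simp: A_def)
  have bij: "bij_betw (\<lambda>s i. - s i) (A 1) (A (-1))"
    using neg[of _ 1] neg[of _ "-1"] by (intro bij_betwI[where g = "\<lambda>s i. - s i"]) auto
  have "sum g (A (-1)) = sum (\<lambda>s. g (\<lambda>i. - s i)) (A 1)"
    using sum.reindex_bij_betw[OF bij, of g] by simp
  also have "\<dots> = sum g (A 1)" using assms by (intro sum.cong) (auto simp: A_def)
  finally have "sum g (sign_vectors n - {\<lambda>i. 0}) = 2 * sum g (A 1)"
    unfolding un using fin by (subst sum.union_disjoint) (auto simp: A_def)
  then show ?thesis by simp
qed

text \<open>Suppose that no two neighbouring points carry opposite labels. In the orthant \<open>s\<close> let \<open>C s\<close> be the top-dimensional
  simplices that carry all labels proper to \<open>s\<close> and a further one, and let \<open>F s\<close> be the boundary facets that carry exactly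
  the proper labels; \<open>B s\<close> consists of those lying on a coordinate hyperplane. By \<open>kuhn_facet_parity\<close> the number
  \<open>card (C s) + card (B s) + card (F s - B s)\<close> is even for \<open>s \<noteq> 0\<close>. The further label of a member of \<open>C s\<close> cannot use a
  coordinate of \<open>s\<close>, since it would be opposite to a proper label; so it names a larger orthant \<open>s'\<close> for which the same
  simplex lies in \<open>B s'\<close>, and the sums of \<open>card (C s)\<close> over all \<open>s\<close> and of \<open>card (B s)\<close> over all \<open>s \<noteq> 0\<close> agree. The facets in
  \<open>F s - B s\<close> lie on the surface of the cube and cancel in antipodal pairs. What remains modulo 2 is the single simplex \<open>{0}\<close>
  in the orthant \<open>0\<close>, and 1 is not even.\<close>
theorem tucker:
  fixes lab :: "(nat \<Rightarrow> int) \<Rightarrow> nat \<times> int"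
  assumes N: "0 < N"
    and lab: "\<And>x. (\<forall>i. \<bar>x i\<bar> \<le> int N) \<Longrightarrow> (\<forall>i\<ge>n. x i = 0) \<Longrightarrow> fst (lab x) < n \<and> \<bar>snd (lab x)\<bar> = 1"
    and anti: "\<And>x i. (\<forall>i. \<bar>x i\<bar> \<le> int N) \<Longrightarrow> (\<forall>i\<ge>n. x i = 0) \<Longrightarrow> \<bar>x i\<bar> = int N \<Longrightarrow>
      lab (\<lambda>i. - x i) = (fst (lab x), - snd (lab x))"
  obtains x x' where "\<forall>i. \<bar>x i\<bar> \<le> int N" "\<forall>i\<ge>n. x i = 0" "\<forall>i. \<bar>x' i\<bar> \<le> int N" "\<forall>i\<ge>n. x' i = 0"
    "\<forall>i. \<bar>x i - x' i\<bar> \<le> 1" "fst (lab x) = fst (lab x')" "snd (lab x) \<noteq> snd (lab x')"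
proof (rule ccontr)
  note tuckerI = that
  assume neg: "\<not> thesis"
  have nocomp: "snd (lab x) = snd (lab x')" if "\<forall>i. \<bar>x i\<bar> \<le> int N" "\<forall>i\<ge>n. x i = 0" "\<forall>i. \<bar>x' i\<bar> \<le> int N" "\<forall>i\<ge>n. x' i = 0"
    "\<forall>i. \<bar>x i - x' i\<bar> \<le> 1" "fst (lab x) = fst (lab x')" for x x'
  proof (rule ccontr)
    assume "snd (lab x) \<noteq> snd (lab x')"
    with that have thesis by (rule tuckerI)
    with neg show False ..
  qed
  define ol where "ol s y = lab (orthant_point s y)" for s y
  define C where "C s = {S \<in> kuhn_chains N (sign_support s) (Suc (card (sign_support s))). sign_labels s \<subset> ol s ` S}" for s
  define F where "F s = {S \<in> kuhn_chains N (sign_support s) (card (sign_support s)). ol s ` S = sign_labels s \<and> boundary_facet N (sign_support s) S}" for s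
  define B where "B s = {S \<in> kuhn_chains N (sign_support s) (card (sign_support s)). ol s ` S = sign_labels s \<and> (\<exists>i\<in>sign_support s. \<forall>y\<in>S. y i = 0)}" for s
  define \<Sigma> where "\<Sigma> = sign_vectors n"
  have pt: "\<forall>i. \<bar>orthant_point s y i\<bar> \<le> int N" "\<forall>i\<ge>n. orthant_point s y i = 0"
    if "s \<in> \<Sigma>" "S \<in> kuhn_chains N I j" "y \<in> S" for s S I j y
  proof -
    have "\<bar>s i\<bar> * int (y i) \<le> 1 * int N" for i
      using sign_vectorsD(1)[of s n i] kuhn_chainsD(3)[OF that(2,3), of i] that(1) by (intro mult_mono) (auto simp: \<Sigma>_def)
    then show "\<forall>i. \<bar>orthant_point s y i\<bar> \<le> int N" by (simp add: orthant_point_def abs_mult)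
    show "\<forall>i\<ge>n. orthant_point s y i = 0" using sign_vectorsD(2)[of s n] that(1) by (simp add: orthant_point_def \<Sigma>_def)
  qed
  have near: "\<forall>i. \<bar>orthant_point s y i - orthant_point s z i\<bar> \<le> 1"
    if "s \<in> \<Sigma>" "S \<in> kuhn_chains N I j" "y \<in> S" "z \<in> S" for s S I j y z
  proof
    fix i
    have "\<bar>int (y i) - int (z i)\<bar> \<le> 1"
      using kuhn_chainsD(5)[OF that(2), of y z i] kuhn_chainsD(5)[OF that(2), of z y i] that(3,4) by auto
    then have "\<bar>s i\<bar> * \<bar>int (y i) - int (z i)\<bar> \<le> 1 * 1"
      using sign_vectorsD(1)[of s n i] that(1) by (intro mult_mono) (auto simp: \<Sigma>_def)
    then show "\<bar>orthant_point s y i - orthant_point s z i\<bar> \<le> 1"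
      by (simp add: orthant_point_def abs_mult[symmetric] right_diff_distrib)
  qed
  have fs: "finite (sign_support s)" if "s \<in> \<Sigma>" for s using that finite_sign_support by (auto simp: \<Sigma>_def)
  have finC: "finite (C s)" "finite (F s)" "finite (B s)" if "s \<in> \<Sigma>" for s
    using finite_kuhn_chains[OF fs[OF that]] by (auto simp: C_def F_def B_def)
  have BF: "B s \<subseteq> F s" for s by (auto simp: B_def F_def boundary_facet_def)
  have parity: "even (card (C s) + card (B s) + card (F s - B s))" if "s \<in> \<Sigma> - {\<lambda>i. 0}" for s
  proof -
    have s: "s \<in> \<Sigma>" "sign_support s \<noteq> {}" using that by (auto simp: sign_support_def)
    have "even (card (C s)) = even (card (F s))"
      unfolding C_def F_def using fs[OF s(1)] s(2) N card_sign_labels[of s]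
      by (intro kuhn_facet_parity) (auto simp: sign_labels_def)
    moreover have "card (F s) = card (B s) + card (F s - B s)"
      using BF finC[OF s(1)] by (metis card_Diff_subset card_mono le_add_diff_inverse)
    ultimately show ?thesis by (simp only: even_add) blast
  qed
  have outer_sub: "F s - B s \<subseteq> F (\<lambda>i. - s i) - B (\<lambda>i. - s i)" if s: "s \<in> \<Sigma>" for s
  proof
    fix S assume S: "S \<in> F s - B s"
    have supp: "sign_support (\<lambda>i. - s i) = sign_support s" by (simp add: sign_support_def)
    have K: "S \<in> kuhn_chains N (sign_support s) (card (sign_support s))" "ol s ` S = sign_labels s" "boundary_facet N (sign_support s) S"
      "\<not> (\<exists>i\<in>sign_support s. \<forall>y\<in>S. y i = 0)" using S unfolding F_def B_def by blast+
    obtain i where i: "i \<in> sign_support s" "\<forall>y\<in>S. y i = N" using K(3,4) unfolding boundary_facet_def by blast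
    have flip: "ol (\<lambda>i. - s i) y = (fst (ol s y), - snd (ol s y))" if "y \<in> S" for y
    proof -
      have yi: "y i = N" using i(2) that by (rule bspec)
      have "\<bar>s i\<bar> = 1" using sign_vectorsD(3)[of s n i] i(1) s by (simp add: \<Sigma>_def sign_support_def)
      then have "\<bar>orthant_point s y i\<bar> = int N" using yi by (simp add: orthant_point_def abs_mult)
      then have "lab (\<lambda>i. - orthant_point s y i) = (fst (lab (orthant_point s y)), - snd (lab (orthant_point s y)))"
        using pt[OF s K(1) that] by (rule_tac anti) auto
      moreover have "orthant_point (\<lambda>i. - s i) y = (\<lambda>i. - orthant_point s y i)" by (simp add: orthant_point_def)
      ultimately show ?thesis by (simp add: ol_def)
    qed
    have "ol (\<lambda>i. - s i) ` S = (\<lambda>l. (fst l, - snd l)) ` (ol s ` S)" using flip by (simp add: image_image cong: image_cong)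
    also have "\<dots> = sign_labels (\<lambda>i. - s i)" unfolding K(2) by (simp add: sign_labels_def supp image_image)
    finally show "S \<in> F (\<lambda>i. - s i) - B (\<lambda>i. - s i)" using K unfolding F_def B_def supp by blast
  qed
  have outer: "even (\<Sum>s\<in>\<Sigma> - {\<lambda>i. 0}. card (F s - B s))"
    unfolding \<Sigma>_def
  proof (rule even_sum_antipodal)
    fix s assume "s \<in> sign_vectors n"
    moreover from this have "(\<lambda>i. - s i) \<in> sign_vectors n" using sign_vectorsD[of s n] by (intro sign_vectorsI) auto
    ultimately have "F (\<lambda>i. - s i) - B (\<lambda>i. - s i) = F s - B s"
      using outer_sub[of s] outer_sub[of "\<lambda>i. - s i"] by (auto simp: \<Sigma>_def)
    then show "card (F (\<lambda>i. - s i) - B (\<lambda>i. - s i)) = card (F s - B s)" by simp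
  qed
  \<comment> \<open>The inverse of enlarging the orthant: forget the sign of the coordinate that vanishes on the whole simplex.\<close>
  define z where "z S s = (\<lambda>i. if \<forall>y\<in>S. y i = 0 then 0 else s i)" for S :: "(nat \<Rightarrow> nat) set" and s :: "nat \<Rightarrow> int"
  have z0: "z S s i = 0" if "\<forall>y\<in>S. y i = 0" for S s i unfolding z_def using that by (rule if_P)
  have z1: "z S s i = s i" if "\<not> (\<forall>y\<in>S. y i = 0)" for S s i unfolding z_def using that by (rule if_not_P)
  have z2: "z S s i = s i" if "i \<notin> sign_support s" for S s i
    using z0[of S i s] z1[of S i s] that by (cases "\<forall>y\<in>S. y i = 0") (simp_all only: sign_support_def mem_Collect_eq simp_thms)
  have ptz: "ol (z S s) y = ol s y" if "y \<in> S" for S s y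
  proof -
    have "orthant_point (z S s) y i = orthant_point s y i" for i
    proof (cases "\<forall>y\<in>S. y i = 0")
      case True
      then have "y i = 0" using that by (rule bspec)
      then show ?thesis by (simp add: orthant_point_def)
    next
      case False
      then have "z S s i = s i" by (rule z1)
      then show ?thesis by (simp add: orthant_point_def)
    qed
    then show ?thesis unfolding ol_def by presburger
  qed
  have Bz: "z S s \<in> \<Sigma>" "S \<in> C (z S s)" "\<And>i j. i \<in> sign_support s \<Longrightarrow> j \<in> sign_support s \<Longrightarrow> \<forall>y\<in>S. y i = 0 \<Longrightarrow> \<forall>y\<in>S. y j = 0 \<Longrightarrow> i = j"
    if s: "s \<in> \<Sigma>" and S: "S \<in> B s" for S s
  proof -
    have K: "S \<in> kuhn_chains N (sign_support s) (card (sign_support s))" "ol s ` S = sign_labels s" 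
      "\<exists>i\<in>sign_support s. \<forall>y\<in>S. y i = 0" using S unfolding B_def by blast+
    \<comment> \<open>Two vanishing coordinates would leave too few dimensions for the length of the chain.\<close>
    show uniq: "i = j" if ij: "i \<in> sign_support s" "j \<in> sign_support s" "\<forall>y\<in>S. y i = 0" "\<forall>y\<in>S. y j = 0" for i j
    proof (rule ccontr)
      assume "i \<noteq> j"
      have "S \<in> kuhn_chains N (sign_support s - {i, j}) (card (sign_support s))"
      proof (rule kuhn_chains_change[OF K(1)])
        fix y k assume "y \<in> S" "k \<notin> sign_support s - {i, j}"
        then show "y k = 0" using kuhn_chainsD(4)[OF K(1), of y k] bspec[OF ij(3), of y] bspec[OF ij(4), of y] by auto
      qed
      then have "card (sign_support s) \<le> card (sign_support s - {i, j}) + 1"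
        using fs[OF s] by (intro kuhn_chains_bound) auto
      also have "card (sign_support s - {i, j}) = card (sign_support s) - 2"
        using ij \<open>i \<noteq> j\<close> fs[OF s] by (subst card_Diff_subset) auto
      moreover have "card {i, j} \<le> card (sign_support s)" using ij fs[OF s] by (intro card_mono) auto
      ultimately show False using \<open>i \<noteq> j\<close> by simp
    qed
    show "z S s \<in> \<Sigma>" unfolding \<Sigma>_def
      using sign_vectorsD[of s n] s by (intro sign_vectorsI) (auto simp: z_def \<Sigma>_def)
    obtain i where i: "i \<in> sign_support s" "\<forall>y\<in>S. y i = 0" using K(3) by blast
    have zi: "z S s j = (if j = i then 0 else s j)" for j
    proof (cases "j = i")
      case True then show ?thesis using z0[OF i(2)] by (simp only: simp_thms if_True)
    next
      case False
      then have "j \<notin> sign_support s \<or> \<not> (\<forall>y\<in>S. y j = 0)" using uniq[OF i(1) _ i(2)] by metis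
      then have "z S s j = s j" using z1 z2 by metis
      then show ?thesis using False by (simp only: if_False)
    qed
    have supp: "sign_support (z S s) = sign_support s - {i}" unfolding sign_support_def zi by auto
    have "card (sign_support s) = Suc (card (sign_support (z S s)))"
      unfolding supp using i(1) fs[OF s] by (metis card_Suc_Diff1)
    moreover have "S \<in> kuhn_chains N (sign_support (z S s)) (card (sign_support s))"
    proof (rule kuhn_chains_change[OF K(1)])
      fix y k assume "y \<in> S" "k \<notin> sign_support (z S s)"
      then show "y k = 0" using kuhn_chainsD(4)[OF K(1), of y k] bspec[OF i(2), of y] supp by auto
    qed
    moreover have "ol (z S s) ` S = sign_labels s" using ptz K(2) by (metis image_cong)
    moreover have "sign_labels (z S s) \<subset> sign_labels s"
    proof
      show "sign_labels (z S s) \<subseteq> sign_labels s" unfolding sign_labels_def supp zi by auto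
      have "(i, s i) \<in> sign_labels s" using i by (auto simp: sign_labels_def)
      moreover have "(i, s i) \<notin> sign_labels (z S s)" unfolding sign_labels_def supp by auto
      ultimately show "sign_labels (z S s) \<noteq> sign_labels s" by blast
    qed
    ultimately show "S \<in> C (z S s)" unfolding C_def by simp
  qed
  have inner_bij: "bij_betw (\<lambda>(s, S). (z S s, S)) (SIGMA s:\<Sigma> - {\<lambda>i. 0}. B s) (SIGMA s:\<Sigma>. C s)"
    unfolding bij_betw_def
  proof
    show "inj_on (\<lambda>(s, S). (z S s, S)) (SIGMA s:\<Sigma> - {\<lambda>i. 0}. B s)"
    proof (rule inj_onI)
      fix u u' assume u: "u \<in> (SIGMA s:\<Sigma> - {\<lambda>i. 0}. B s)" "u' \<in> (SIGMA s:\<Sigma> - {\<lambda>i. 0}. B s)"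
        "(\<lambda>(s, S). (z S s, S)) u = (\<lambda>(s, S). (z S s, S)) u'"
      obtain s S s' S' where us: "u = (s, S)" "u' = (s', S')" by (metis surj_pair)
      have "(z S s, S) = (z S' s', S')" using u(3) us by (simp only: prod.case)
      then have eqs: "S' = S" "z S s = z S s'" by (metis prod.inject)+
      have s: "S \<in> B s" "S \<in> B s'" and eq: "z S s = z S s'" using u us eqs by blast+
      have "sign_labels s = ol s ` S" using s unfolding B_def by blast
      also have "\<dots> = ol s' ` S" using ptz[of _ S s] ptz[of _ S s'] eq by (metis image_cong)
      also have "\<dots> = sign_labels s'" using s unfolding B_def by blast
      finally have "s = s'" by (rule sign_labels_inj)
      then show "u = u'" using us eqs by simp
    qed
    show "(\<lambda>(s, S). (z S s, S)) ` (SIGMA s:\<Sigma> - {\<lambda>i. 0}. B s) = (SIGMA s:\<Sigma>. C s)"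
    proof
      show "(\<lambda>(s, S). (z S s, S)) ` (SIGMA s:\<Sigma> - {\<lambda>i. 0}. B s) \<subseteq> (SIGMA s:\<Sigma>. C s)"
        using Bz(1,2) by fastforce
      show "(SIGMA s:\<Sigma>. C s) \<subseteq> (\<lambda>(s, S). (z S s, S)) ` (SIGMA s:\<Sigma> - {\<lambda>i. 0}. B s)"
      proof (rule subsetI, elim SigmaE, simp only:)
        fix s S assume s: "s \<in> \<Sigma>" and S: "S \<in> C s"
        have K: "S \<in> kuhn_chains N (sign_support s) (Suc (card (sign_support s)))" "sign_labels s \<subset> ol s ` S"
          using S unfolding C_def by blast+
        obtain l where l: "l \<in> ol s ` S" "l \<notin> sign_labels s" using K(2) by blast
        obtain j e where je: "l = (j, e)" by (metis surj_pair)
        obtain y where y: "y \<in> S" "ol s y = (j, e)" using l(1) je by auto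
        have jn: "j < n" "\<bar>e\<bar> = 1" using lab[OF pt[OF s K(1) y(1)]] y(2) by (auto simp: ol_def)
        \<comment> \<open>Otherwise \<open>(j, s j)\<close> and its opposite would both occur on the simplex.\<close>
        have js: "j \<notin> sign_support s"
        proof
          assume j: "j \<in> sign_support s"
          then have "(j, s j) \<in> ol s ` S" using K(2) by (auto simp: sign_labels_def)
          then obtain y' where y': "y' \<in> S" "ol s y' = (j, s j)" by auto
          have "snd (ol s y) = snd (ol s y')" unfolding ol_def
            using nocomp[OF pt[OF s K(1) y(1)] pt[OF s K(1) y'(1)] near[OF s K(1) y(1) y'(1)]] y(2) y'(2)
            by (simp add: ol_def)
          then have "l = (j, s j)" using y y' je by simp
          then show False using l(2) j by (auto simp: sign_labels_def)
        qed
        define s' where "s' = s(j := e)"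
        have supp': "sign_support s' = insert j (sign_support s)" using jn by (auto simp: s'_def sign_support_def)
        have lab': "sign_labels s' = insert (j, e) (sign_labels s)"
          unfolding sign_labels_def supp' using js by (auto simp: s'_def image_iff)
        have c': "card (sign_support s') = Suc (card (sign_support s))" unfolding supp' using js fs[OF s] by simp
        have y0: "y j = 0" if "y \<in> S" for y using kuhn_chainsD(4)[OF K(1) that js] .
        have ol': "ol s' y = ol s y" if "y \<in> S" for y
        proof -
          have "orthant_point s' y = orthant_point s y" using y0[OF that] by (auto simp: orthant_point_def s'_def)
          then show ?thesis by (simp add: ol_def)
        qed
        have "sign_labels s' = ol s ` S"
        proof (rule card_seteq)
          show "finite (ol s ` S)" using kuhn_chainsD(1)[OF K(1)] by simp
          show "sign_labels s' \<subseteq> ol s ` S" unfolding lab' by (rule insert_subsetI[OF l(1)[unfolded je] psubset_imp_subset[OF K(2)]])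
          have "card (ol s ` S) \<le> card S" using kuhn_chainsD(1)[OF K(1)] by (rule card_image_le)
          also have "\<dots> = card (sign_labels s')" using c' kuhn_chainsD(2)[OF K(1)] by (simp add: card_sign_labels)
          finally show "card (ol s ` S) \<le> card (sign_labels s')" .
        qed
        then have "ol s' ` S = sign_labels s'" using ol' by (metis image_cong)
        moreover have "S \<in> kuhn_chains N (sign_support s') (card (sign_support s'))"
          unfolding c'
        proof (rule kuhn_chains_change[OF K(1)])
          fix y k assume "y \<in> S" "k \<notin> sign_support s'"
          then show "y k = 0" using kuhn_chainsD(4)[OF K(1), of y k] supp' by auto
        qed
        moreover have j': "j \<in> sign_support s'" "\<forall>y\<in>S. y j = 0" using supp' y0 by auto
        ultimately have SB: "S \<in> B s'" unfolding B_def by blast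
        have s'S: "s' \<in> \<Sigma>" unfolding \<Sigma>_def
          using sign_vectorsD[of s n] s jn by (intro sign_vectorsI) (auto simp: s'_def \<Sigma>_def)
        moreover have "s' \<noteq> (\<lambda>i. 0)" using j'(1) by (auto simp: sign_support_def)
        moreover have "z S s' = s"
        proof
          fix i
          show "z S s' i = s i"
          proof (cases "i = j")
            case True
            then show ?thesis using z0[OF j'(2)] js by (simp add: sign_support_def)
          next
            case False
            then have "i \<notin> sign_support s' \<or> \<not> (\<forall>y\<in>S. y i = 0)" using Bz(3)[OF s'S SB j'(1) _ j'(2)] by metis
            then have "z S s' i = s' i" using z1 z2 by metis
            then show ?thesis using False by (simp add: s'_def)
          qed
        qed
        ultimately show "(s, S) \<in> (\<lambda>(s, S). (z S s, S)) ` (SIGMA s:\<Sigma> - {\<lambda>i. 0}. B s)"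
          using SB by (intro image_eqI[of _ _ "(s', S)"]) auto
      qed
    qed
  qed
  have fin\<Sigma>: "finite \<Sigma>" by (simp add: \<Sigma>_def finite_sign_vectors)
  have zero: "(\<lambda>i. 0) \<in> \<Sigma>" unfolding \<Sigma>_def by (rule sign_vectorsI) auto
  have "(\<Sum>s\<in>\<Sigma> - {\<lambda>i. 0}. card (B s)) = card (SIGMA s:\<Sigma> - {\<lambda>i. 0}. B s)"
    using finC fin\<Sigma> by (subst card_SigmaI) auto
  also have "\<dots> = card (SIGMA s:\<Sigma>. C s)" using bij_betw_same_card[OF inner_bij] .
  also have "\<dots> = (\<Sum>s\<in>\<Sigma>. card (C s))" using finC fin\<Sigma> by (subst card_SigmaI) auto
  also have "\<dots> = card (C (\<lambda>i. 0)) + (\<Sum>s\<in>\<Sigma> - {\<lambda>i. 0}. card (C s))" using fin\<Sigma> zero by (rule sum.remove)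
  finally have sums: "(\<Sum>s\<in>\<Sigma> - {\<lambda>i. 0}. card (B s)) = card (C (\<lambda>i. 0)) + (\<Sum>s\<in>\<Sigma> - {\<lambda>i. 0}. card (C s))" .
  have C0: "C (\<lambda>i. 0) = {{\<lambda>i. 0}}"
  proof -
    have supp0: "sign_support (\<lambda>i. 0) = {}" by (simp add: sign_support_def)
    show ?thesis
    proof (intro set_eqI iffI)
      fix S assume "S \<in> C (\<lambda>i. 0)"
      then have K: "S \<in> kuhn_chains N {} 1" unfolding C_def supp0 by simp
      then obtain y where y: "S = {y}" using kuhn_chainsD(2)[OF K] by (metis card_1_singletonE)
      have "y = (\<lambda>i. 0)" using kuhn_chainsD(4)[OF K, of y] y by (intro ext) simp
      then show "S \<in> {{\<lambda>i. 0}}" using y by simp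
    next
      fix S :: "(nat \<Rightarrow> nat) set" assume "S \<in> {{\<lambda>i. 0}}"
      then have S: "S = {\<lambda>i. 0}" by simp
      have "S \<in> kuhn_chains N {} 1" unfolding kuhn_chains_def S by simp
      then show "S \<in> C (\<lambda>i. 0)" unfolding C_def supp0 using S by (auto simp: sign_labels_def supp0)
    qed
  qed
  have "even (\<Sum>s\<in>\<Sigma> - {\<lambda>i. 0}. card (C s) + card (B s) + card (F s - B s))"
    using parity by (intro dvd_sum) auto
  then have "even ((\<Sum>s\<in>\<Sigma> - {\<lambda>i. 0}. card (C s)) + (\<Sum>s\<in>\<Sigma> - {\<lambda>i. 0}. card (B s)))"
    using outer by (simp add: sum.distrib)
  then show False unfolding sums C0 by simp
qed

section \<open>The Borsuk-Ulam theorem\<close>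

text \<open>Parametrize half of a cube surface in \<open>X\<close> by \<open>x \<mapsto> (x, 1 - max \<bar>x\<^sub>i\<bar>)\<close> in an orthonormal basis; on the boundary of the
  parameter cube the last coordinate vanishes, so that the map is odd there. If \<open>h\<close> had no zero, some component would exceed
  a fixed \<open>e > 0\<close> at every point, and the index and sign of the first such component would label a fine lattice as in Tucker's
  lemma. Neighbours with opposite labels would then contradict uniform continuity.\<close>
theorem borsuk_ulam_subspace:
  fixes X :: "'a::euclidean_space set" and h :: "'a \<Rightarrow> nat \<Rightarrow> real"
  assumes X: "subspace X" and k: "k < dim X"
    and cont: "\<And>i. i < k \<Longrightarrow> continuous_on (X - {0}) (\<lambda>v. h v i)"
    and odd: "\<And>v i. v \<in> X \<Longrightarrow> v \<noteq> 0 \<Longrightarrow> i < k \<Longrightarrow> h (- v) i = - h v i"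
  shows "\<exists>v\<in>X. v \<noteq> 0 \<and> (\<forall>i<k. h v i = 0)"
proof (rule ccontr)
  assume "\<not> ?thesis"
  then have nz: "\<exists>i<k. h v i \<noteq> 0" if "v \<in> X" "v \<noteq> 0" for v using that by blast
  define n where "n = dim X - 1"
  have dX: "dim X = Suc n" using k by (simp add: n_def)
  have kn: "k \<le> n" using k dX by simp
  obtain B where B: "B \<subseteq> X" "pairwise orthogonal B" "\<And>x. x \<in> B \<Longrightarrow> norm x = 1" "independent B"
    "card B = dim X" "span B = X"
    using orthonormal_basis_subspace[OF X] by blast
  have "finite B" using B(4) by (rule independent_imp_finite)
  then obtain b where b: "bij_betw b {..<Suc n} B"
    using ex_bij_betw_nat_finite[of B] B(5) dX by (auto simp: atLeast0LessThan)
  have bX: "b i \<in> X" "norm (b i) = 1" if "i < Suc n" for i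
    using b that B(1,3) by (auto simp: bij_betw_def)
  have bij: "b i \<bullet> b j = (if i = j then 1 else 0)" if "i < Suc n" "j < Suc n" for i j
  proof (cases "i = j")
    case True then show ?thesis using bX(2)[OF that(1)] by (simp add: norm_eq_1)
  next
    case False
    then have "b i \<noteq> b j" using b that by (auto simp: bij_betw_def inj_on_def)
    moreover have "b i \<in> B" "b j \<in> B" using b that by (auto simp: bij_betw_def)
    ultimately have "orthogonal (b i) (b j)" using B(2) by (auto simp: pairwise_def)
    then show ?thesis using False by (simp add: orthogonal_def)
  qed
  have "k \<noteq> 0"
  proof
    assume "k = 0"
    moreover have "b 0 \<in> X" "b 0 \<noteq> 0" using bX[of 0] by auto
    ultimately show False using nz by blast
  qed
  then have n0: "0 < n" using kn by simp
  \<comment> \<open>All sample points have norm between 1/2 and \<open>n + 1\<close>, hence stay in this compact set away from 0.\<close>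
  define C where "C = X \<inter> (cball 0 (Suc n) - ball 0 (1/2))"
  have "compact C" unfolding C_def by (intro closed_Int_compact closed_subspace X compact_diff compact_cball open_ball)
  have CX: "C \<subseteq> X - {0}" by (auto simp: C_def)
  have contC: "continuous_on C (\<lambda>v. h v i)" if "i < k" for i
    using cont[OF that] CX by (rule continuous_on_subset)
  have "\<exists>e>0. \<forall>v\<in>C. e \<le> (\<Sum>i<k. \<bar>h v i\<bar>)"
  proof (cases "C = {}")
    case False
    have "continuous_on C (\<lambda>v. \<Sum>i<k. \<bar>h v i\<bar>)" using contC by (intro continuous_intros) auto
    from continuous_attains_inf[OF \<open>compact C\<close> False this]
    obtain u where u: "u \<in> C" "\<forall>v\<in>C. (\<Sum>i<k. \<bar>h u i\<bar>) \<le> (\<Sum>i<k. \<bar>h v i\<bar>)" by blast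
    obtain i where "i < k" "h u i \<noteq> 0" using nz u(1) CX by blast
    then have "0 < (\<Sum>i<k. \<bar>h u i\<bar>)" by (intro sum_pos2[of _ i]) auto
    then show ?thesis using u(2) by blast
  qed (auto intro: exI[of _ 1])
  then obtain e0 where e0: "0 < e0" "\<forall>v\<in>C. e0 \<le> (\<Sum>i<k. \<bar>h v i\<bar>)" by blast
  define e where "e = e0 / k"
  have e: "0 < e" using e0 \<open>k \<noteq> 0\<close> by (simp add: e_def)
  have big: "\<exists>i. i < k \<and> e \<le> \<bar>h v i\<bar>" if "v \<in> C" for v
  proof (rule ccontr)
    assume "\<nexists>i. i < k \<and> e \<le> \<bar>h v i\<bar>"
    then have "(\<Sum>i<k. \<bar>h v i\<bar>) < (\<Sum>i<k. e)" using \<open>k \<noteq> 0\<close> by (intro sum_strict_mono) auto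
    then show False using e0(2) that \<open>k \<noteq> 0\<close> by (auto simp: e_def)
  qed
  have "\<exists>d>0. \<forall>u\<in>C. \<forall>v\<in>C. dist u v < d \<longrightarrow> \<bar>h u i - h v i\<bar> < e" if "i < k" for i
    using compact_uniformly_continuous[OF contC[OF that] \<open>compact C\<close>] e
    unfolding uniformly_continuous_on_def dist_real_def by (metis dist_commute abs_minus_commute)
  then obtain d where d: "\<And>i. i < k \<Longrightarrow> 0 < d i"
    "\<And>i u v. i < k \<Longrightarrow> u \<in> C \<Longrightarrow> v \<in> C \<Longrightarrow> dist u v < d i \<Longrightarrow> \<bar>h u i - h v i\<bar> < e"
    by metis
  define D where "D = Min (d ` {..<k})"
  have D: "0 < D" "\<And>i. i < k \<Longrightarrow> D \<le> d i"
  proof -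
    have "finite (d ` {..<k})" "d ` {..<k} \<noteq> {}" using \<open>k \<noteq> 0\<close> by (auto simp: lessThan_empty_iff)
    then show "0 < D" unfolding D_def using d(1) by (subst Min_gr_iff) auto
    show "D \<le> d i" if "i < k" for i unfolding D_def using that by (intro Min_le) auto
  qed
  obtain N :: nat where N: "Suc n / D < N" using reals_Archimedean2 by blast
  have N0: "0 < N" using N D(1) by (metis divide_nonneg_pos gr0I not_less of_nat_0 of_nat_0_le_iff)
  have ND: "Suc n / N < D" using N N0 D(1) by (simp add: field_simps)
  define M where "M x = Max ((\<lambda>i. \<bar>x i\<bar>) ` {..<n})" for x :: "nat \<Rightarrow> int"
  define c where "c x i = (if i < n then real_of_int (x i) / N else 1 - real_of_int (M x) / N)" for x i
  define P where "P x = (\<Sum>i<Suc n. c x i *\<^sub>R b i)" for x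
  have M_ge: "\<bar>x i\<bar> \<le> M x" if "i < n" for x i using that by (auto simp: M_def)
  have M_in: "\<exists>i<n. M x = \<bar>x i\<bar>" for x
  proof -
    have "M x \<in> (\<lambda>i. \<bar>x i\<bar>) ` {..<n}" unfolding M_def using n0 by (intro Max_in) auto
    then show ?thesis by auto
  qed
  have Pb: "P x \<bullet> b j = c x j" if "j < Suc n" for x j
  proof -
    have "P x \<bullet> b j = (\<Sum>i<Suc n. if i = j then c x i else 0)"
      unfolding P_def inner_sum_left using bij that by (intro sum.cong) auto
    then show ?thesis using that by simp
  qed
  have PC: "P x \<in> C" if x: "\<forall>i. \<bar>x i\<bar> \<le> int N" for x
  proof -
    have MN: "0 \<le> M x" "M x \<le> N" using M_in[of x] x by auto
    have c1: "\<bar>c x i\<bar> \<le> 1" for i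
    proof (cases "i < n")
      case True
      have "\<bar>real_of_int (x i)\<bar> \<le> N" using x[rule_format, of i] by linarith
      then show ?thesis using True N0 by (simp add: c_def)
    next
      case False
      then show ?thesis using MN N0 by (auto simp: c_def abs_le_iff field_simps)
    qed
    have "norm (P x) \<le> (\<Sum>i<Suc n. norm (c x i *\<^sub>R b i))" unfolding P_def by (rule norm_sum)
    also have "\<dots> \<le> (\<Sum>i<Suc n. 1)" using c1 bX(2) by (intro sum_mono) simp
    finally have up: "norm (P x) \<le> Suc n" by simp
    have "\<exists>j<Suc n. 1/2 \<le> \<bar>c x j\<bar>"
    proof (cases "N \<le> 2 * M x")
      case True
      obtain i where i: "i < n" "M x = \<bar>x i\<bar>" using M_in by blast
      have "real N \<le> 2 * \<bar>real_of_int (x i)\<bar>" using True i(2) by linarith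
      then show ?thesis using i(1) N0 by (intro exI[of _ i]) (auto simp: c_def field_simps)
    next
      case False
      then have "2 * real_of_int (M x) \<le> N" by linarith
      then show ?thesis using N0 by (intro exI[of _ n]) (auto simp: c_def field_simps)
    qed
    then obtain j where j: "j < Suc n" "1/2 \<le> \<bar>c x j\<bar>" by blast
    have "\<bar>P x \<bullet> b j\<bar> \<le> norm (P x)" using Cauchy_Schwarz_ineq2[of "P x" "b j"] bX(2)[OF j(1)] by simp
    then have "1/2 \<le> norm (P x)" using Pb[OF j(1)] j(2) by simp
    moreover have "P x \<in> X" unfolding P_def using X bX(1) by (intro subspace_sum subspace_scale) auto
    ultimately show ?thesis using up by (simp add: C_def)
  qed
  define idx where "idx x = (LEAST i. i < k \<and> e \<le> \<bar>h (P x) i\<bar>)" for x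
  define lab where "lab x = (idx x, if 0 < h (P x) (idx x) then 1 else -1 :: int)" for x
  have idx: "idx x < k" "e \<le> \<bar>h (P x) (idx x)\<bar>" if "\<forall>i. \<bar>x i\<bar> \<le> int N" for x
    using LeastI_ex[OF big[OF PC[OF that]]] by (auto simp: idx_def)
  obtain x x' where x: "\<forall>i. \<bar>x i\<bar> \<le> int N" "\<forall>i. \<bar>x' i\<bar> \<le> int N" "\<forall>i. \<bar>x i - x' i\<bar> \<le> 1"
    "fst (lab x) = fst (lab x')" "snd (lab x) \<noteq> snd (lab x')"
  proof (rule tucker[OF N0, of n lab])
    fix x :: "nat \<Rightarrow> int" assume x: "\<forall>i. \<bar>x i\<bar> \<le> int N" "\<forall>i\<ge>n. x i = 0"
    show "fst (lab x) < n \<and> \<bar>snd (lab x)\<bar> = 1" using idx(1)[OF x(1)] kn by (simp add: lab_def)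
    fix i assume i: "\<bar>x i\<bar> = int N"
    have "i < n" using i x(2) N0 by (metis abs_zero not_le of_nat_0_less_iff order_less_irrefl)
    then have "int N \<le> M x" using M_ge[of i x] i by simp
    moreover have "M x \<le> int N" using M_in[of x] x(1) by metis
    ultimately have MN: "M x = int N" by simp
    have Mm: "M (\<lambda>i. - x i) = M x" by (simp add: M_def)
    have "c (\<lambda>i. - x i) j = - c x j" for j using MN Mm N0 by (simp add: c_def)
    then have Pm: "P (\<lambda>i. - x i) = - P x" by (simp add: P_def sum_negf)
    have "P x \<in> X" "P x \<noteq> 0" using PC[OF x(1)] CX by auto
    then have hm: "h (P (\<lambda>i. - x i)) i = - h (P x) i" if "i < k" for i unfolding Pm using odd that by simp
    have "idx (\<lambda>i. - x i) = idx x" unfolding idx_def using hm by (metis abs_minus_cancel)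
    then show "lab (\<lambda>i. - x i) = (fst (lab x), - snd (lab x))"
      using hm[OF idx(1)[OF x(1)]] idx(2)[OF x(1)] e by (auto simp: lab_def)
  qed blast
  have "dist (P x) (P x') \<le> (\<Sum>i<Suc n. norm ((c x i - c x' i) *\<^sub>R b i))"
    unfolding P_def dist_norm sum_subtractf[symmetric] scaleR_left_diff_distrib[symmetric] by (rule norm_sum)
  also have "\<dots> \<le> (\<Sum>i<Suc n. 1 / N)"
  proof (rule sum_mono)
    fix i assume i: "i \<in> {..<Suc n}"
    have "\<bar>c x i - c x' i\<bar> \<le> 1 / N"
    proof (cases "i < n")
      case True
      have "\<bar>real_of_int (x i) - real_of_int (x' i)\<bar> \<le> 1" using x(3)[rule_format, of i] by linarith
      then show ?thesis using True N0 by (simp add: c_def diff_divide_distrib[symmetric] divide_right_mono)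
    next
      case False
      obtain j j' where j: "j < n" "M x = \<bar>x j\<bar>" "j' < n" "M x' = \<bar>x' j'\<bar>" using M_in by metis
      have "M x \<le> M x' + 1" using j(2) M_ge[OF j(1), of x'] x(3)[rule_format, of j] by linarith
      moreover have "M x' \<le> M x + 1" using j(4) M_ge[OF j(3), of x] x(3)[rule_format, of j'] by linarith
      ultimately have "\<bar>real_of_int (M x') - real_of_int (M x)\<bar> \<le> 1" by linarith
      then show ?thesis using False N0 by (simp add: c_def diff_divide_distrib[symmetric] divide_right_mono)
    qed
    then show "norm ((c x i - c x' i) *\<^sub>R b i) \<le> 1 / N" using bX(2)[of i] i by simp
  qed
  also have "\<dots> < D" using ND by simp
  finally have close: "dist (P x) (P x') < D" .
  have i: "idx x = idx x'" "idx x < k" using x(4) idx(1)[OF x(1)] by (simp_all add: lab_def)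
  have "\<bar>h (P x) (idx x) - h (P x') (idx x)\<bar> < e"
    using d(2)[OF i(2) PC[OF x(1)] PC[OF x(2)]] close D(2)[OF i(2)] by simp
  moreover have "(0 < h (P x) (idx x)) \<noteq> (0 < h (P x') (idx x))" using x(5) i(1) by (auto simp: lab_def split: if_splits)
  ultimately show False using idx(2)[OF x(1)] idx(2)[OF x(2)] i(1) by (auto simp: abs_if split: if_splits)
qed

section \<open>Subgradients of powers of the absolute value\<close>

text \<open>Up to the factor \<open>p\<close> this is the subdifferential of \<open>\<bar>t\<bar>\<^sup>p\<close>. It puts the single-valued case \<open>p > 1\<close> and the
  set-valued case \<open>p = 1\<close> on the same footing; the descent arguments rest on its being odd, convex and locally bounded, on its
  closed graph, and on a mean value theorem.\<close>
definition subgrad :: "real \<Rightarrow> real \<Rightarrow> real set" where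
  "subgrad p t = (if p = 1 then Sgn t else {Phi p t})"

lemma Sgn_minus: "z \<in> Sgn t \<Longrightarrow> - z \<in> Sgn (- t)"
  by (auto simp: Sgn_def split: if_splits)

lemma Sgn_simps: "Sgn 0 = {-1..1}" "0 < t \<Longrightarrow> Sgn t = {1}" "t < 0 \<Longrightarrow> Sgn t = {-1}"
  by (auto simp: Sgn_def)

lemma Sgn_abs_le: "z \<in> Sgn t \<Longrightarrow> \<bar>z\<bar> \<le> 1"
  by (auto simp: Sgn_def split: if_splits)

lemma Phi_minus: "Phi p (- t) = - Phi p t"
  by (simp add: Phi_def)

lemma subgrad_minus: "z \<in> subgrad p t \<Longrightarrow> - z \<in> subgrad p (- t)"
  by (simp add: subgrad_def Sgn_minus Phi_minus split: if_splits)

lemma subgrad_nonempty: "\<exists>z. z \<in> subgrad p t"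
proof (cases "p = 1")
  case True
  have "sgn t \<in> Sgn t" by (auto simp: Sgn_def)
  then show ?thesis using True by (auto simp: subgrad_def)
qed (auto simp: subgrad_def)

lemma convex_subgrad: "convex (subgrad p t)"
  by (auto simp: subgrad_def Sgn_def)

lemma zero_in_subgrad: "0 \<in> subgrad p 0"
  by (auto simp: subgrad_def Sgn_def Phi_def)

lemma Phi_eq: "Phi p t = max t 0 powr (p - 1) - max (- t) 0 powr (p - 1)"
proof -
  consider "t = 0" | "0 < t" | "t < 0" by linarith
  then show ?thesis
  proof cases
    case 2
    then have "t powr (p - 1) = t powr (p - 2) * t" using powr_add[of t "p - 2" 1] by simp
    then show ?thesis using 2 by (simp add: Phi_def max_def)
  next
    case 3
    then have "(-t) powr (p - 1) = (-t) powr (p - 2) * (-t)" using powr_add[of "-t" "p - 2" 1] by simp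
    then show ?thesis using 3 by (simp add: Phi_def max_def)
  qed (simp add: Phi_def)
qed

lemma isCont_Phi: "1 < p \<Longrightarrow> isCont (Phi p) t"
proof -
  assume "1 < p"
  then have "continuous_on UNIV (\<lambda>t. max t 0 powr (p - 1) - max (- t) 0 powr (p - 1))"
    by (intro continuous_intros continuous_on_powr') auto
  then show ?thesis by (simp add: Phi_eq[abs_def] continuous_on_eq_continuous_at)
qed

lemma subgrad_bounded:
  assumes p: "1 \<le> p" and t: "t \<longlonglongrightarrow> l" and z: "\<And>n. z n \<in> subgrad p (t n)"
  shows "Bseq z"
proof (cases "p = 1")
  case True
  then have "\<bar>z n\<bar> \<le> 1" for n using z[of n] Sgn_abs_le by (simp add: subgrad_def)
  then show ?thesis by (intro BseqI'[of _ 1]) simp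
next
  case False
  then have "z = (\<lambda>n. Phi p (t n))" using z by (auto simp: subgrad_def)
  then have "z \<longlonglongrightarrow> Phi p l" using isCont_tendsto_compose[OF isCont_Phi t, of p] p False by simp
  then show ?thesis using convergent_imp_Bseq convergentI by blast
qed

lemma subgrad_closed_graph:
  assumes p: "1 \<le> p" and t: "t \<longlonglongrightarrow> l" and z: "\<And>n. z n \<in> subgrad p (t n)" "z \<longlonglongrightarrow> u"
  shows "u \<in> subgrad p l"
proof (cases "p = 1")
  case True
  then have zS: "\<And>n. z n \<in> Sgn (t n)" using z(1) by (simp add: subgrad_def)
  then have z1: "z n \<in> {-1..1}" for n using Sgn_abs_le[OF zS[of n]] by (simp add: abs_le_iff)
  have u1: "u \<in> {-1..1}" using closed_sequentially[OF closed_atLeastAtMost _ z(2)] z1 by blast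
  consider "l = 0" | "0 < l" | "l < 0" by linarith
  then have "u \<in> Sgn l"
  proof cases
    case 1 then show ?thesis using u1 by (simp add: Sgn_simps)
  next
    case 2
    have "eventually (\<lambda>n. 0 < t n) sequentially" using order_tendstoD(1)[OF t 2] .
    then have "eventually (\<lambda>n. z n = 1) sequentially" 
    proof eventually_elim
      case (elim n) then show ?case using zS[of n] by (simp add: Sgn_simps)
    qed
    then have "z \<longlonglongrightarrow> 1" by (rule tendsto_eventually)
    then show ?thesis using LIMSEQ_unique[OF z(2)] 2 by (simp add: Sgn_simps)
  next
    case 3
    have "eventually (\<lambda>n. t n < 0) sequentially" using order_tendstoD(2)[OF t 3] .
    then have "eventually (\<lambda>n. z n = -1) sequentially" 
    proof eventually_elim
      case (elim n) then show ?case using zS[of n] by (simp add: Sgn_simps)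
    qed
    then have "z \<longlonglongrightarrow> -1" by (rule tendsto_eventually)
    then show ?thesis using LIMSEQ_unique[OF z(2)] 3 by (simp add: Sgn_simps)
  qed
  then show ?thesis using True by (simp add: subgrad_def)
next
  case False
  then have "z = (\<lambda>n. Phi p (t n))" using z by (auto simp: subgrad_def)
  then have "z \<longlonglongrightarrow> Phi p l" using isCont_tendsto_compose[OF isCont_Phi t, of p] p False by simp
  then show ?thesis using LIMSEQ_unique[OF z(2)] False by (auto simp: subgrad_def)
qed

lemma DERIV_abs_powr:
  assumes p: "1 < p"
  shows "((\<lambda>t. \<bar>t\<bar> powr p) has_real_derivative p * Phi p t) (at t)"
proof -
  consider "t = 0" | "0 < t" | "t < 0" by linarith
  then show ?thesis
  proof cases
    case 1
    have "((\<lambda>h. \<bar>h\<bar> powr (p - 1)) \<longlongrightarrow> 0) (at (0::real))"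
    proof -
      have "continuous_on UNIV (\<lambda>h::real. \<bar>h\<bar> powr (p - 1))" using p by (intro continuous_intros continuous_on_powr') auto
      then have "isCont (\<lambda>h::real. \<bar>h\<bar> powr (p - 1)) 0" by (simp add: continuous_on_eq_continuous_at)
      then show ?thesis using p by (simp add: isCont_def)
    qed
    moreover have "\<bar>\<bar>h\<bar> powr p / h\<bar> = \<bar>h\<bar> powr (p - 1)" for h :: real
    proof (cases "h = 0")
      case False
      then have "\<bar>h\<bar> powr p = \<bar>h\<bar> powr (p - 1) * \<bar>h\<bar>" using powr_add[of "\<bar>h\<bar>" "p - 1" 1] by simp
      then show ?thesis using False by (simp add: abs_divide)
    qed simp
    ultimately have "((\<lambda>h. \<bar>h\<bar> powr p / h) \<longlongrightarrow> 0) (at (0::real))"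
      by (subst tendsto_rabs_zero_iff[symmetric]) simp
    then show ?thesis using 1 p by (simp add: DERIV_def Phi_def)
  next
    case 2
    have e: "p * t powr (p - 1) = p * Phi p t" using 2 powr_add[of t "p - 2" 1] by (simp add: Phi_def)
    have "((\<lambda>t. t powr p) has_real_derivative p * t powr (p - 1)) (at t)"
      using has_real_derivative_powr[OF 2, of p] .
    then have "((\<lambda>t. \<bar>t\<bar> powr p) has_real_derivative p * t powr (p - 1)) (at t)"
      by (rule has_field_derivative_transform_within_open[of _ _ _ "{0<..}"]) (use 2 in auto)
    then show ?thesis unfolding e .
  next
    case 3
    have e: "p * (- t) powr (p - 1) * (-1) = p * Phi p t" using 3 powr_add[of "-t" "p - 2" 1] by (simp add: Phi_def)
    have "((\<lambda>z. z powr p) has_real_derivative p * (- t) powr (p - 1)) (at (- t))"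
      using 3 by (intro has_real_derivative_powr) simp
    moreover have "(uminus has_real_derivative -1) (at t)" by (auto intro!: derivative_eq_intros)
    ultimately have "((\<lambda>t. (- t) powr p) has_real_derivative p * (- t) powr (p - 1) * (-1)) (at t)"
      by (rule DERIV_chain2)
    then have "((\<lambda>t. \<bar>t\<bar> powr p) has_real_derivative p * (- t) powr (p - 1) * (-1)) (at t)"
      by (rule has_field_derivative_transform_within_open[of _ _ _ "{..<0}"]) (use 3 in auto)
    then show ?thesis unfolding e .
  qed
qed

text \<open>The mean value theorem for \<open>\<bar>t\<bar>\<^sup>p\<close>. For \<open>p = 1\<close> and an interval containing 0, the difference quotient itself belongs to
  the subdifferential at 0.\<close>
lemma abs_powr_mvt:
  assumes p: "1 \<le> p"
  obtains \<theta> z where "\<bar>\<theta> - a\<bar> \<le> \<bar>b - a\<bar>" "z \<in> subgrad p \<theta>" "\<bar>b\<bar> powr p - \<bar>a\<bar> powr p = p * z * (b - a)"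
proof (cases "p = 1")
  case True
  have *: "\<exists>\<theta> z. \<bar>\<theta> - a\<bar> \<le> \<bar>b - a\<bar> \<and> z \<in> Sgn \<theta> \<and> \<bar>b\<bar> - \<bar>a\<bar> = z * (b - a)"
  proof -
    consider "a = b" | "0 < a" "0 < b" | "a < 0" "b < 0" | "a \<noteq> b" "a \<le> 0 \<and> 0 \<le> b \<or> b \<le> 0 \<and> 0 \<le> a" by linarith
    then show ?thesis
    proof cases
      case 1
      then show ?thesis using subgrad_nonempty[of 1 a] by (auto simp: subgrad_def)
    next
      case 2 then show ?thesis by (intro exI[of _ a] exI[of _ 1]) (auto simp: Sgn_def)
    next
      case 3 then show ?thesis by (intro exI[of _ a] exI[of _ "-1"]) (auto simp: Sgn_def)
    next
      case 4
      have "\<bar>\<bar>b\<bar> - \<bar>a\<bar>\<bar> \<le> \<bar>b - a\<bar>" by linarith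
      then have "\<bar>(\<bar>b\<bar> - \<bar>a\<bar>) / (b - a)\<bar> \<le> 1" using 4(1) by (simp add: abs_divide)
      then have "(\<bar>b\<bar> - \<bar>a\<bar>) / (b - a) \<in> Sgn 0" unfolding Sgn_simps abs_le_iff by simp
      moreover have "\<bar>0 - a\<bar> \<le> \<bar>b - a\<bar>" using 4(2) by linarith
      moreover have "\<bar>b\<bar> - \<bar>a\<bar> = (\<bar>b\<bar> - \<bar>a\<bar>) / (b - a) * (b - a)" using 4(1) by simp
      ultimately show ?thesis by blast
    qed
  qed
  then show ?thesis using that True by (auto simp: subgrad_def)
next
  case False
  then have p1: "1 < p" using p by simp
  have *: "\<exists>\<theta>. a < \<theta> \<and> \<theta> < b \<and> \<bar>b\<bar> powr p - \<bar>a\<bar> powr p = (b - a) * (p * Phi p \<theta>)" if "a < b" for a b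
    using MVT2[OF that, of "\<lambda>t. \<bar>t\<bar> powr p" "\<lambda>t. p * Phi p t"] DERIV_abs_powr[OF p1] by blast
  consider "a = b" | "a < b" | "b < a" by linarith
  then show ?thesis
  proof cases
    case 1 then show ?thesis using that[of a "Phi p a"] False by (simp add: subgrad_def)
  next
    case 2
    then obtain \<theta> where "a < \<theta>" "\<theta> < b" "\<bar>b\<bar> powr p - \<bar>a\<bar> powr p = (b - a) * (p * Phi p \<theta>)" using * by blast
    then show ?thesis using that[of \<theta> "Phi p \<theta>"] False by (simp add: subgrad_def algebra_simps)
  next
    case 3
    then obtain \<theta> where "b < \<theta>" "\<theta> < a" "\<bar>a\<bar> powr p - \<bar>b\<bar> powr p = (a - b) * (p * Phi p \<theta>)" using *[of b a] by blast
    then show ?thesis using that[of \<theta> "Phi p \<theta>"] False by (simp add: subgrad_def algebra_simps)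
  qed
qed

section \<open>Critical points and descent for sums of powers of linear functionals\<close>

text \<open>The functional \<open>numerator - \<lambda> \<cdot> denominator\<close> of a Rayleigh quotient has this form, with coefficients of both signs.\<close>
definition energy :: "real \<Rightarrow> ('j::finite \<Rightarrow> 'a::euclidean_space) \<Rightarrow> ('j \<Rightarrow> real) \<Rightarrow> 'a \<Rightarrow> real" where
  "energy p a c f = (\<Sum>j\<in>UNIV. c j * \<bar>a j \<bullet> f\<bar> powr p)"

text \<open>A Clarke type gradient (again without the factor \<open>p\<close>) in which the multipliers \<open>z j\<close> are chosen independently of each
  other. Two indices may share the same functional; this is what makes membership of 0 the eigenvalue equation with separate
  multipliers for \<open>\<kappa>\<close> and \<open>\<mu>\<close> when \<open>p = 1\<close>.\<close>
definition energy_grad :: "real \<Rightarrow> ('j::finite \<Rightarrow> 'a::euclidean_space) \<Rightarrow> ('j \<Rightarrow> real) \<Rightarrow> 'a \<Rightarrow> 'a set" where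
  "energy_grad p a c f = {\<Sum>j\<in>UNIV. (c j * z j) *\<^sub>R a j | z. \<forall>j. z j \<in> subgrad p (a j \<bullet> f)}"

lemma energy_gradI:
  "(\<And>j. z j \<in> subgrad p (a j \<bullet> f)) \<Longrightarrow> g = (\<Sum>j\<in>UNIV. (c j * z j) *\<^sub>R a j) \<Longrightarrow> g \<in> energy_grad p a c f"
  unfolding energy_grad_def mem_Collect_eq by (rule exI[of _ z]) simp

lemma energy_gradE:
  assumes "g \<in> energy_grad p a c f"
  shows "\<exists>z. (\<forall>j. z j \<in> subgrad p (a j \<bullet> f)) \<and> g = (\<Sum>j\<in>UNIV. (c j * z j) *\<^sub>R a j)"
  using assms unfolding energy_grad_def mem_Collect_eq by (elim exE conjE) (intro exI conjI)

lemma subgrad_subsequence: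
  fixes \<theta> z :: "nat \<Rightarrow> 'j::finite \<Rightarrow> real"
  assumes p: "1 \<le> p" and \<theta>: "\<And>j. (\<lambda>n. \<theta> n j) \<longlonglongrightarrow> t j" and z: "\<And>n j. z n j \<in> subgrad p (\<theta> n j)"
  shows "\<exists>r u. strict_mono r \<and> (\<forall>j. (\<lambda>n. z (r n) j) \<longlonglongrightarrow> u j) \<and> (\<forall>j. u j \<in> subgrad p (t j))"
proof -
  have "\<exists>K. \<forall>n. \<bar>z n j\<bar> \<le> K" for j
    using subgrad_bounded[OF p \<theta> z, of j] by (auto simp: Bseq_def)
  then obtain K where K: "\<And>n j. \<bar>z n j\<bar> \<le> K j" by metis
  define y where "y n = (\<chi> j. z n j)" for n
  have "norm (y n) \<le> (\<Sum>j\<in>UNIV. K j)" for n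
  proof -
    have "norm (y n) \<le> (\<Sum>j\<in>UNIV. \<bar>y n $ j\<bar>)" by (rule norm_le_l1_cart)
    also have "\<dots> \<le> (\<Sum>j\<in>UNIV. K j)" using K by (intro sum_mono) (simp add: y_def)
    finally show ?thesis .
  qed
  then have "bounded (range y)" by (auto simp: bounded_iff)
  then obtain l r where r: "strict_mono r" "(y \<circ> r) \<longlonglongrightarrow> l" using bounded_imp_convergent_subsequence by blast
  have lim: "(\<lambda>n. z (r n) j) \<longlonglongrightarrow> l $ j" for j
    using tendsto_vec_nth[OF r(2), of j] by (simp add: y_def)
  moreover have "l $ j \<in> subgrad p (t j)" for j
    using subgrad_closed_graph[OF p LIMSEQ_subseq_LIMSEQ[OF \<theta>[of j] r(1)], of "\<lambda>n. z (r n) j"] z lim by (simp add: o_def)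
  ultimately show ?thesis using r(1) by (intro exI[of _ r] exI[of _ "($) l"]) simp
qed

lemma energy_grad_closed_graph:
  assumes p: "1 \<le> p" and f: "f \<longlonglongrightarrow> l" and g: "\<And>n. g n \<in> energy_grad p a c (f n)"
  obtains r u where "strict_mono r" "(\<lambda>n. g (r n)) \<longlonglongrightarrow> u" "u \<in> energy_grad p a c l"
proof -
  have "\<forall>n. \<exists>z. (\<forall>j. z j \<in> subgrad p (a j \<bullet> f n)) \<and> g n = (\<Sum>j\<in>UNIV. (c j * z j) *\<^sub>R a j)"
    using energy_gradE[OF g] by (intro allI)
  then obtain z where z: "\<And>n j. z n j \<in> subgrad p (a j \<bullet> f n)" "\<And>n. g n = (\<Sum>j\<in>UNIV. (c j * z n j) *\<^sub>R a j)"
    by metis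
  have "\<And>j. (\<lambda>n. a j \<bullet> f n) \<longlonglongrightarrow> a j \<bullet> l" using f by (intro tendsto_intros)
  from subgrad_subsequence[where \<theta> = "\<lambda>n j. a j \<bullet> f n" and t = "\<lambda>j. a j \<bullet> l", OF p this z(1)] obtain r u
    where r': "strict_mono r" "\<forall>j. (\<lambda>n. z (r n) j) \<longlonglongrightarrow> u j" "\<forall>j. u j \<in> subgrad p (a j \<bullet> l)"
    by blast
  note r = r'(1) r'(2,3)[rule_format]
  have "(\<lambda>n. g (r n)) \<longlonglongrightarrow> (\<Sum>j\<in>UNIV. (c j * u j) *\<^sub>R a j)" unfolding z(2) using r(2) by (intro tendsto_intros)
  moreover have "(\<Sum>j\<in>UNIV. (c j * u j) *\<^sub>R a j) \<in> energy_grad p a c l" using energy_gradI[OF r(3) refl] .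
  ultimately show ?thesis using that r(1) by blast
qed

lemma energy_grad_minus:
  assumes "g \<in> energy_grad p a c f"
  shows "- g \<in> energy_grad p a c (- f)"
proof -
  obtain z where z': "\<forall>j. z j \<in> subgrad p (a j \<bullet> f)" "g = (\<Sum>j\<in>UNIV. (c j * z j) *\<^sub>R a j)"
    using energy_gradE[OF assms] by blast
  note z = z'(1)[rule_format] z'(2)
  have "\<And>j. - z j \<in> subgrad p (a j \<bullet> (- f))" using subgrad_minus[OF z(1)] by simp
  moreover have "- g = (\<Sum>j\<in>UNIV. (c j * (- z j)) *\<^sub>R a j)" by (simp add: z(2) sum_negf)
  ultimately show ?thesis by (rule energy_gradI)
qed

lemma convex_energy_grad: "convex (energy_grad p a c f)"
proof (rule convexI)
  fix x y and s t :: real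
  assume xy: "x \<in> energy_grad p a c f" "y \<in> energy_grad p a c f" and st: "0 \<le> s" "0 \<le> t" "s + t = 1"
  obtain z where z: "\<forall>j. z j \<in> subgrad p (a j \<bullet> f)" "x = (\<Sum>j\<in>UNIV. (c j * z j) *\<^sub>R a j)"
    using energy_gradE[OF xy(1)] by blast
  obtain z' where z': "\<forall>j. z' j \<in> subgrad p (a j \<bullet> f)" "y = (\<Sum>j\<in>UNIV. (c j * z' j) *\<^sub>R a j)"
    using energy_gradE[OF xy(2)] by blast
  have "\<And>j. s * z j + t * z' j \<in> subgrad p (a j \<bullet> f)"
    using convexD[OF convex_subgrad z(1)[rule_format] z'(1)[rule_format] st] by simp
  moreover have "s *\<^sub>R x + t *\<^sub>R y = (\<Sum>j\<in>UNIV. (c j * (s * z j + t * z' j)) *\<^sub>R a j)"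
    unfolding z(2) z'(2) by (simp add: scaleR_sum_right sum.distrib[symmetric] algebra_simps)
  ultimately show "s *\<^sub>R x + t *\<^sub>R y \<in> energy_grad p a c f" by (rule energy_gradI)
qed

lemma closed_energy_grad: "1 \<le> p \<Longrightarrow> closed (energy_grad p a c f)"
proof (unfold closed_sequential_limits, intro allI impI, elim conjE)
  fix x l assume p: "1 \<le> p" and x: "\<forall>n. x n \<in> energy_grad p a c f" "x \<longlonglongrightarrow> l"
  obtain r u where r: "strict_mono r" "(\<lambda>n. x (r n)) \<longlonglongrightarrow> u" "u \<in> energy_grad p a c f"
    using energy_grad_closed_graph[OF p tendsto_const] x(1) by metis
  have "(\<lambda>n. x (r n)) \<longlonglongrightarrow> l" using LIMSEQ_subseq_LIMSEQ[OF x(2) r(1)] by (simp add: o_def)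
  then show "l \<in> energy_grad p a c f" using LIMSEQ_unique r by blast
qed

text \<open>First-order descent in a form that is uniform in the base point: if moving from \<open>x n\<close> by \<open>s n *\<^sub>R v n\<close> fails to lower
  the energy to first order, then \<open>d\<close> is not a descent direction at the limit. The mean value theorem writes the
  increments through multipliers at nearby points, and the closed graph lets these multipliers converge.\<close>
lemma energy_no_descent:
  assumes p: "1 \<le> p" and lim: "x \<longlonglongrightarrow> l" "s \<longlonglongrightarrow> 0" "v \<longlonglongrightarrow> d" and s: "\<And>n. 0 < s n"
    and nd: "\<And>n. - (s n * s n) \<le> energy p a c (x n + s n *\<^sub>R v n) - energy p a c (x n)"
  obtains g where "g \<in> energy_grad p a c l" "0 \<le> g \<bullet> d"
proof -
  define Q where "Q n j \<theta> z \<longleftrightarrow> \<bar>\<theta> - a j \<bullet> x n\<bar> \<le> \<bar>a j \<bullet> (x n + s n *\<^sub>R v n) - a j \<bullet> x n\<bar> \<and> z \<in> subgrad p \<theta> \<and>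
    \<bar>a j \<bullet> (x n + s n *\<^sub>R v n)\<bar> powr p - \<bar>a j \<bullet> x n\<bar> powr p = p * z * (a j \<bullet> (x n + s n *\<^sub>R v n) - a j \<bullet> x n)"
    for n j \<theta> z
  have "\<exists>\<theta> z. Q n j \<theta> z" for n j
    by (rule abs_powr_mvt[OF p, where a = "a j \<bullet> x n" and b = "a j \<bullet> (x n + s n *\<^sub>R v n)"]) (auto simp: Q_def)
  then obtain \<theta> z where Q: "\<And>n j. Q n j (\<theta> n j) (z n j)" by metis
  have \<theta>: "\<bar>\<theta> n j - a j \<bullet> x n\<bar> \<le> \<bar>a j \<bullet> (x n + s n *\<^sub>R v n) - a j \<bullet> x n\<bar>"
    "z n j \<in> subgrad p (\<theta> n j)"
    "\<bar>a j \<bullet> (x n + s n *\<^sub>R v n)\<bar> powr p - \<bar>a j \<bullet> x n\<bar> powr p = p * z n j * (a j \<bullet> (x n + s n *\<^sub>R v n) - a j \<bullet> x n)"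
    for n j using Q[of n j] unfolding Q_def by blast+
  have step: "a j \<bullet> (x n + s n *\<^sub>R v n) - a j \<bullet> x n = s n * (a j \<bullet> v n)" for n j by (simp add: inner_add_right)
  have t\<theta>: "(\<lambda>n. \<theta> n j) \<longlonglongrightarrow> a j \<bullet> l" for j
  proof -
    have "(\<lambda>n. \<bar>s n * (a j \<bullet> v n)\<bar>) \<longlonglongrightarrow> \<bar>0 * (a j \<bullet> d)\<bar>" using lim by (intro tendsto_intros)
    then have "(\<lambda>n. \<bar>s n * (a j \<bullet> v n)\<bar>) \<longlonglongrightarrow> 0" by simp
    then have "(\<lambda>n. \<theta> n j - a j \<bullet> x n) \<longlonglongrightarrow> 0"
      by (rule Lim_null_comparison[rotated]) (use \<theta>(1) step in simp)
    moreover have "(\<lambda>n. a j \<bullet> x n) \<longlonglongrightarrow> a j \<bullet> l" using lim by (intro tendsto_intros)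
    ultimately have "(\<lambda>n. (\<theta> n j - a j \<bullet> x n) + a j \<bullet> x n) \<longlonglongrightarrow> 0 + a j \<bullet> l" by (rule tendsto_add)
    then show ?thesis by simp
  qed
  obtain r u where r': "strict_mono r" "\<forall>j. (\<lambda>n. z (r n) j) \<longlonglongrightarrow> u j" "\<forall>j. u j \<in> subgrad p (a j \<bullet> l)"
    using subgrad_subsequence[where \<theta> = \<theta> and t = "\<lambda>j. a j \<bullet> l", OF p t\<theta> \<theta>(2)] by blast
  note r = r'(1) r'(2,3)[rule_format]
  define q where "q n = (\<Sum>j\<in>UNIV. c j * z n j * (a j \<bullet> v n))" for n
  have q: "- s n / p \<le> q n" for n
  proof -
    have "energy p a c (x n + s n *\<^sub>R v n) - energy p a c (x n) =
        (\<Sum>j\<in>UNIV. c j * (\<bar>a j \<bullet> (x n + s n *\<^sub>R v n)\<bar> powr p - \<bar>a j \<bullet> x n\<bar> powr p))"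
      by (simp add: energy_def sum_subtractf algebra_simps)
    also have "\<dots> = s n * (p * q n)"
      unfolding \<theta>(3) step q_def by (simp add: sum_distrib_left algebra_simps)
    finally have "s n * (- s n) \<le> s n * (p * q n)" using nd[of n] by simp
    then have "- s n \<le> p * q n" using s[of n] by (simp only: mult_le_cancel_left_pos)
    then show ?thesis using p by (simp add: field_simps)
  qed
  have "(\<lambda>n. q (r n)) \<longlonglongrightarrow> (\<Sum>j\<in>UNIV. c j * u j * (a j \<bullet> d))"
    unfolding q_def using r(2) LIMSEQ_subseq_LIMSEQ[OF lim(3) r(1)] by (intro tendsto_intros) (auto simp: o_def)
  moreover have "(\<lambda>n. - s (r n) / p) \<longlonglongrightarrow> - 0 / p"
    using LIMSEQ_subseq_LIMSEQ[OF lim(2) r(1)] p by (intro tendsto_intros) (auto simp: o_def)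
  ultimately have "- 0 / p \<le> (\<Sum>j\<in>UNIV. c j * u j * (a j \<bullet> d))"
    using q by (intro LIMSEQ_le) auto
  then have "0 \<le> (\<Sum>j\<in>UNIV. (c j * u j) *\<^sub>R a j) \<bullet> d" by (simp add: inner_sum_left)
  moreover have "(\<Sum>j\<in>UNIV. (c j * u j) *\<^sub>R a j) \<in> energy_grad p a c l" using energy_gradI[OF r(3) refl] .
  ultimately show ?thesis using that by blast
qed

text \<open>At a noncritical point, a hyperplane separating 0 from the gradient set gives a descent direction, which works
  in a whole neighbourhood because the graph is closed. Finitely many of these are glued with the weights \<open>infdist f (- U u)\<close>,
  and the resulting field is then made odd.\<close>
lemma odd_descent_field:
  fixes a :: "'j::finite \<Rightarrow> 'a::euclidean_space"
  assumes p: "1 \<le> p" and K: "compact K" "\<And>f. f \<in> K \<Longrightarrow> - f \<in> K"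
    and nc: "\<And>f. f \<in> K \<Longrightarrow> 0 \<notin> energy_grad p a c f"
  obtains v where "continuous_on UNIV v" "\<And>f. v (- f) = - v f"
    "\<And>f g. f \<in> K \<Longrightarrow> g \<in> energy_grad p a c f \<Longrightarrow> g \<bullet> v f < 0"
proof -
  define U where "U u = {f. \<forall>g\<in>energy_grad p a c f. g \<bullet> u < 0}" for u
  have "closed (- U u)" for u
    unfolding closed_sequential_limits
  proof (intro allI impI, elim conjE)
    fix x l assume x: "\<forall>n. x n \<in> - U u" "x \<longlonglongrightarrow> l"
    then have "\<forall>n. \<exists>g. g \<in> energy_grad p a c (x n) \<and> 0 \<le> g \<bullet> u" by (force simp: U_def)
    then obtain g where g: "\<And>n. g n \<in> energy_grad p a c (x n)" "\<And>n. 0 \<le> g n \<bullet> u" by metis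
    obtain r w where r: "(\<lambda>n. g (r n)) \<longlonglongrightarrow> w" "w \<in> energy_grad p a c l"
      using energy_grad_closed_graph[OF p x(2) g(1)] by metis
    have "(\<lambda>n. g (r n) \<bullet> u) \<longlonglongrightarrow> w \<bullet> u" using r(1) by (intro tendsto_intros)
    then have "0 \<le> w \<bullet> u" using g(2) by (intro LIMSEQ_le_const) auto
    then show "l \<in> - U u" using r(2) by (force simp: U_def)
  qed
  then have openU: "open (U u)" "closed (- U u)" for u by (simp_all add: closed_def)
  \<comment> \<open>This keeps \<open>- U u\<close> nonempty, as the distance to the empty set would be 0 by convention.\<close>
  have zero: "0 \<notin> U u" for u
  proof -
    have "(\<Sum>j\<in>UNIV. (c j * 0) *\<^sub>R a j) \<in> energy_grad p a c 0"
      using zero_in_subgrad[of p] by (intro energy_gradI[of "\<lambda>j. 0"]) auto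
    then have "0 \<in> energy_grad p a c 0" by simp
    then show ?thesis by (force simp: U_def)
  qed
  have "\<exists>u. f \<in> U u" if f: "f \<in> K" for f
  proof -
    obtain e b where "0 < b" "\<forall>g\<in>energy_grad p a c f. b < e \<bullet> g"
      using separating_hyperplane_closed_0[OF convex_energy_grad closed_energy_grad[OF p] nc[OF f]] by blast
    then have "f \<in> U (- e)" by (force simp: U_def inner_commute)
    then show ?thesis by blast
  qed
  then have "K \<subseteq> (\<Union>u\<in>UNIV. U u)" by blast
  then obtain T where T: "finite T" "K \<subseteq> (\<Union>u\<in>T. U u)"
    using compactE_image[OF K(1), of UNIV U] openU(1) by (metis subset_UNIV)
  define w where "w f = (\<Sum>u\<in>T. infdist f (- U u) *\<^sub>R u)" for f
  have contw: "continuous_on UNIV w" unfolding w_def by (intro continuous_intros)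
  have w: "g \<bullet> w f < 0" if f: "f \<in> K" and g: "g \<in> energy_grad p a c f" for f g
  proof -
    have pos: "0 < infdist f (- U u)" if "f \<in> U u" for u
      using infdist_pos_not_in_closed[OF openU(2)[of u]] that zero[of u] by blast
    have zer: "infdist f (- U u) = 0" if "f \<notin> U u" for u using that by simp
    obtain u where u: "u \<in> T" "f \<in> U u" using T(2) f by blast
    have le: "infdist f (- U u) * (g \<bullet> u) \<le> 0" for u
    proof (cases "f \<in> U u")
      case True
      then have "g \<bullet> u < 0" using g by (simp add: U_def)
      then show ?thesis using pos[OF True] by (simp add: mult_le_0_iff)
    qed (use zer in simp)
    have "g \<bullet> u < 0" using u(2) g by (simp add: U_def)
    then have lt: "infdist f (- U u) * (g \<bullet> u) < 0" using pos[OF u(2)] by (simp add: mult_less_0_iff)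
    have "g \<bullet> w f = (\<Sum>u\<in>T. infdist f (- U u) * (g \<bullet> u))" by (simp add: w_def inner_sum_right)
    also have "\<dots> < (\<Sum>u\<in>T. 0)" using T(1) u(1) le lt by (intro sum_strict_mono_ex1) auto
    finally show ?thesis by simp
  qed
  define v where "v f = w f - w (- f)" for f
  show ?thesis
  proof
    show "continuous_on UNIV v" unfolding v_def
      by (intro continuous_intros contw continuous_on_compose2[OF contw]) auto
    show "v (- f) = - v f" for f by (simp add: v_def)
    fix f g assume f: "f \<in> K" and g: "g \<in> energy_grad p a c f"
    have "(- g) \<bullet> w (- f) < 0" using w[OF K(2)[OF f] energy_grad_minus[OF g]] .
    then show "g \<bullet> v f < 0" using w[OF f g] by (simp add: v_def inner_diff_right)
  qed
qed

section \<open>Energy inequalities across an edge\<close>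

text \<open>Convexity of \<open>x\<^sup>p\<close> on the closed half line; at the end point 0 it reduces to \<open>r\<^sup>p \<le> r\<close> for \<open>r \<in> [0,1]\<close>.\<close>
lemma convex_powr_nonneg:
  fixes x y p :: real
  assumes p: "1 \<le> p" and xy: "0 \<le> x" "0 \<le> y" and ab: "0 \<le> \<alpha>" "0 \<le> \<beta>" "\<alpha> + \<beta> = 1"
  shows "(\<alpha> * x + \<beta> * y) powr p \<le> \<alpha> * x powr p + \<beta> * y powr p"
proof -
  have scale: "(r * u) powr p \<le> r * u powr p" if "0 \<le> r" "r \<le> 1" "0 \<le> u" for r u :: real
  proof -
    have "r powr p \<le> r powr 1" using that(1,2) p by (intro powr_mono')
    then have "r powr p \<le> r" using that(1) by (cases "r = 0") auto
    then show ?thesis using that by (simp add: powr_mult mult_right_mono)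
  qed
  consider "x = 0" | "y = 0" | "0 < x" "0 < y" using xy by linarith
  then show ?thesis
  proof cases
    case 1 then show ?thesis using scale[of \<beta> y] ab xy p by simp
  next
    case 2 then show ?thesis using scale[of \<alpha> x] ab xy p by simp
  next
    case 3
    have \<alpha>: "1 - \<beta> = \<alpha>" using ab by simp
    have "((1 - \<beta>) * x + \<beta> * y) powr p \<le> (1 - \<beta>) * x powr p + \<beta> * y powr p"
      using convex_onD[OF powr_convex[OF p], of \<beta> x y] 3 ab by simp
    then show ?thesis unfolding \<alpha> .
  qed
qed

lemma subgrad_mult_self: "z \<in> subgrad p t \<Longrightarrow> z * t = \<bar>t\<bar> powr p"
proof -
  assume z: "z \<in> subgrad p t"
  consider "t = 0" | "0 < t" "p = 1" | "t < 0" "p = 1" | "t \<noteq> 0" "p \<noteq> 1" by linarith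
  then show ?thesis
  proof cases
    case 4
    have "\<bar>t\<bar> powr p = \<bar>t\<bar> powr (p - 2) * \<bar>t\<bar> powr 2" using powr_add[of "\<bar>t\<bar>" "p - 2" 2] by simp
    also have "\<bar>t\<bar> powr 2 = t * t" using 4 by (simp add: power2_eq_square)
    finally show ?thesis using z 4 by (simp add: subgrad_def Phi_def)
  qed (use z in \<open>simp_all add: subgrad_def Sgn_simps\<close>)
qed

lemma subgrad_nonzero:
  assumes z: "z \<in> subgrad p t" and t: "t \<noteq> 0"
  shows "z = sgn t * \<bar>t\<bar> powr (p - 1)"
proof -
  have "z * t = \<bar>t\<bar> powr p" using subgrad_mult_self[OF z] .
  also have "\<dots> = \<bar>t\<bar> powr (p - 1) * \<bar>t\<bar>" using t powr_add[of "\<bar>t\<bar>" "p - 1" 1] by simp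
  also have "\<dots> = (sgn t * \<bar>t\<bar> powr (p - 1)) * t" by (simp add: abs_sgn)
  finally show ?thesis using t by simp
qed

text \<open>This and the next lemmas compare, across an edge, the \<open>p\<close>-energy of the rescaled values \<open>s a, t b\<close> with the value that the
  eigenvalue equation assigns to it. Equal scaling factors give equality.\<close>
lemma edge_eq:
  fixes a b s :: real
  assumes "z \<in> subgrad p (a - b)"
  shows "\<bar>s * a - s * b\<bar> powr p = z * (\<bar>s\<bar> powr p * a - \<bar>s\<bar> powr p * b)"
proof -
  have "\<bar>s * a - s * b\<bar> powr p = \<bar>s\<bar> powr p * \<bar>a - b\<bar> powr p"
    by (simp add: right_diff_distrib[symmetric] abs_mult powr_mult)
  also have "\<dots> = \<bar>s\<bar> powr p * (z * (a - b))" using subgrad_mult_self[OF assms] by simp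
  finally show ?thesis by (simp add: algebra_simps)
qed

text \<open>If \<open>a\<close> and \<open>b\<close> have opposite signs, then \<open>\<bar>a - b\<bar> = \<bar>a\<bar> + \<bar>b\<bar>\<close> and \<open>\<bar>s a - t b\<bar> / \<bar>a - b\<bar>\<close> is at most the convex
  combination of \<open>\<bar>s\<bar>\<close> and \<open>\<bar>t\<bar>\<close> with weights proportional to \<open>\<bar>a\<bar>\<close> and \<open>\<bar>b\<bar>\<close>, to which convexity applies.\<close>
lemma edge_le:
  fixes a b s t :: real
  assumes p: "1 \<le> p" and ab: "a * b \<le> 0" and z: "z \<in> subgrad p (a - b)"
  shows "\<bar>s * a - t * b\<bar> powr p \<le> z * (\<bar>s\<bar> powr p * a - \<bar>t\<bar> powr p * b)"
proof (cases "a = b")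
  case True
  then have "a = 0" "b = 0" using ab by (auto simp: mult_le_0_iff)
  then show ?thesis using p by simp
next
  case False
  define d where "d = \<bar>a\<bar> + \<bar>b\<bar>"
  have d: "0 < d" "\<bar>a - b\<bar> = d" using False ab by (auto simp: d_def mult_le_0_iff)
  have zz: "z = sgn (a - b) * d powr (p - 1)" using subgrad_nonzero[OF z] False d by simp
  have "\<bar>s * a - t * b\<bar> \<le> \<bar>s\<bar> * \<bar>a\<bar> + \<bar>t\<bar> * \<bar>b\<bar>" by (metis abs_mult abs_triangle_ineq4)
  then have "\<bar>s * a - t * b\<bar> powr p \<le> (\<bar>s\<bar> * \<bar>a\<bar> + \<bar>t\<bar> * \<bar>b\<bar>) powr p" using p by (intro powr_mono2) auto
  also have "\<bar>s\<bar> * \<bar>a\<bar> + \<bar>t\<bar> * \<bar>b\<bar> = d * ((\<bar>a\<bar> / d) * \<bar>s\<bar> + (\<bar>b\<bar> / d) * \<bar>t\<bar>)" using d by (simp add: field_simps)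
  also have "\<dots> powr p = d powr p * ((\<bar>a\<bar> / d) * \<bar>s\<bar> + (\<bar>b\<bar> / d) * \<bar>t\<bar>) powr p"
    by (rule powr_mult)
  also have "\<dots> \<le> d powr p * ((\<bar>a\<bar> / d) * \<bar>s\<bar> powr p + (\<bar>b\<bar> / d) * \<bar>t\<bar> powr p)"
    using d by (intro mult_left_mono convex_powr_nonneg p) (auto simp: d_def add_divide_distrib[symmetric])
  also have "d powr p = d powr (p - 1) * d" using d powr_add[of d "p - 1" 1] by simp
  also have "d powr (p - 1) * d * ((\<bar>a\<bar> / d) * \<bar>s\<bar> powr p + (\<bar>b\<bar> / d) * \<bar>t\<bar> powr p)
      = d powr (p - 1) * (\<bar>a\<bar> * \<bar>s\<bar> powr p + \<bar>b\<bar> * \<bar>t\<bar> powr p)" using d by (simp add: field_simps)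
  also have "\<bar>a\<bar> = sgn (a - b) * a" using ab False by (auto simp: mult_le_0_iff sgn_if)
  also have "\<bar>b\<bar> = sgn (a - b) * (- b)" using ab False by (auto simp: mult_le_0_iff sgn_if)
  finally show ?thesis unfolding zz by (simp add: algebra_simps)
qed

text \<open>The convex combination is now solved for the larger value: \<open>\<bar>s\<bar>\<close> is at most the combination of
  \<open>\<bar>s a - t b\<bar> / (a - b)\<close> and \<open>\<bar>t\<bar>\<close> with weights \<open>(a - b) / a\<close> and \<open>b / a\<close>.\<close>
lemma edge_ge_aux:
  fixes a b s t :: real
  assumes p: "1 \<le> p" and ab: "0 \<le> b" "b < a"
  shows "(a - b) powr (p - 1) * (\<bar>s\<bar> powr p * a - \<bar>t\<bar> powr p * b) \<le> \<bar>s * a - t * b\<bar> powr p"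
proof -
  define d where "d = a - b"
  define q where "q = \<bar>s * a - t * b\<bar>"
  have d: "0 < d" "0 < a" "0 \<le> q" using ab by (auto simp: d_def q_def)
  have "\<bar>s\<bar> * a = \<bar>(s * a - t * b) + t * b\<bar>" using d by (simp add: abs_mult)
  also have "\<dots> \<le> q + \<bar>t\<bar> * b" unfolding q_def using ab(1) by (metis abs_mult abs_of_nonneg abs_triangle_ineq)
  finally have "\<bar>s\<bar> \<le> (d / a) * (q / d) + (b / a) * \<bar>t\<bar>" using d by (simp add: field_simps)
  then have "\<bar>s\<bar> powr p \<le> ((d / a) * (q / d) + (b / a) * \<bar>t\<bar>) powr p" using p by (intro powr_mono2) auto
  also have "\<dots> \<le> (d / a) * (q / d) powr p + (b / a) * \<bar>t\<bar> powr p"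
    using d ab by (intro convex_powr_nonneg p) (auto simp: d_def add_divide_distrib[symmetric])
  finally have "\<bar>s\<bar> powr p * a \<le> d * (q / d) powr p + b * \<bar>t\<bar> powr p" using d by (simp add: field_simps)
  then have "\<bar>s\<bar> powr p * a - \<bar>t\<bar> powr p * b \<le> d * (q / d) powr p" by (simp add: mult.commute)
  then have "d powr (p - 1) * (\<bar>s\<bar> powr p * a - \<bar>t\<bar> powr p * b) \<le> d powr (p - 1) * (d * (q / d) powr p)"
    using d by (intro mult_left_mono) auto
  also have "\<dots> = d powr p * (q / d) powr p" using d powr_add[of d "p - 1" 1] by simp
  also have "\<dots> = q powr p" using d by (simp add: powr_mult[symmetric])
  finally show ?thesis by (simp add: d_def q_def)
qed

lemma edge_ge_nonneg:
  fixes a b s t :: real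
  assumes p: "1 \<le> p" and ab: "0 \<le> a" "0 \<le> b" and z: "z \<in> subgrad p (a - b)"
  shows "z * (\<bar>s\<bar> powr p * a - \<bar>t\<bar> powr p * b) \<le> \<bar>s * a - t * b\<bar> powr p"
proof -
  consider "b < a" | "a < b" | "a = b" by linarith
  then show ?thesis
  proof cases
    case 1
    then have "z = (a - b) powr (p - 1)" using subgrad_nonzero[OF z] by simp
    then show ?thesis using edge_ge_aux[OF p ab(2) 1] by simp
  next
    case 2
    then have "z = - ((b - a) powr (p - 1))" using subgrad_nonzero[OF z] by simp
    then show ?thesis using edge_ge_aux[OF p ab(1) 2, of t s] by (simp add: algebra_simps abs_minus_commute)
  next
    case 3
    show ?thesis
    proof (cases "p = 1")
      case True
      have "\<bar>z\<bar> \<le> 1" using z True Sgn_abs_le by (simp add: subgrad_def)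
      have "z * (\<bar>s\<bar> * a - \<bar>t\<bar> * a) \<le> \<bar>z\<bar> * \<bar>\<bar>s\<bar> * a - \<bar>t\<bar> * a\<bar>" by (metis abs_ge_self abs_mult)
      also have "\<dots> \<le> 1 * \<bar>\<bar>s\<bar> * a - \<bar>t\<bar> * a\<bar>" using \<open>\<bar>z\<bar> \<le> 1\<close> by (intro mult_right_mono) auto
      also have "\<dots> = \<bar>\<bar>s\<bar> - \<bar>t\<bar>\<bar> * a" using ab by (simp add: left_diff_distrib[symmetric] abs_mult)
      also have "\<dots> \<le> \<bar>s - t\<bar> * a" using ab by (intro mult_right_mono) linarith+
      also have "\<dots> = \<bar>s * a - t * a\<bar>" using ab by (simp add: left_diff_distrib[symmetric] abs_mult)
      finally show ?thesis using True 3 by simp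
    next
      case False
      then have "z = 0" using z 3 by (simp add: subgrad_def Phi_def)
      then show ?thesis by simp
    qed
  qed
qed

lemma edge_ge:
  fixes a b s t :: real
  assumes p: "1 \<le> p" and ab: "0 \<le> a * b" and z: "z \<in> subgrad p (a - b)"
  shows "z * (\<bar>s\<bar> powr p * a - \<bar>t\<bar> powr p * b) \<le> \<bar>s * a - t * b\<bar> powr p"
proof -
  consider "0 \<le> a" "0 \<le> b" | "a \<le> 0" "b \<le> 0" using ab by (auto simp: zero_le_mult_iff)
  then show ?thesis
  proof cases
    case 2
    have "- z \<in> subgrad p (- a - - b)" using subgrad_minus[OF z] by simp
    then have "- z * (\<bar>s\<bar> powr p * (- a) - \<bar>t\<bar> powr p * (- b)) \<le> \<bar>s * (- a) - t * (- b)\<bar> powr p"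
      using 2 by (intro edge_ge_nonneg p) auto
    moreover have "- z * (\<bar>s\<bar> powr p * (- a) - \<bar>t\<bar> powr p * (- b)) = z * (\<bar>s\<bar> powr p * a - \<bar>t\<bar> powr p * b)"
      by (simp add: algebra_simps)
    moreover have "\<bar>s * (- a) - t * (- b)\<bar> = \<bar>s * a - t * b\<bar>" by (simp add: abs_minus_commute)
    ultimately show ?thesis by simp
  qed (use edge_ge_nonneg p z in blast)
qed

section \<open>Eigenfunctions of the signed p-Laplacian and their rescalings\<close>

locale weighted_signed_graph =
  fixes E :: "'v::finite set set" and w \<sigma> :: "'v set \<Rightarrow> real" and \<mu> \<kappa> :: "'v \<Rightarrow> real" and p :: real
  assumes simple: "simple_graph E" and sig: "signature E \<sigma>" and w_pos: "\<And>e. e \<in> E \<Longrightarrow> 0 < w e"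
    and \<mu>_pos: "\<And>x. 0 < \<mu> x" and p: "1 \<le> p"
begin

abbreviation "eigen \<equiv> eigenfunction E w \<mu> \<kappa> \<sigma> p"
abbreviation "minimal_supp \<equiv> minimal_support E w \<mu> \<kappa> \<sigma> p"
abbreviation "rayleigh_q \<equiv> rayleigh E w \<mu> \<kappa> \<sigma> p"

lemma sigma_pm: "{x, y} \<in> E \<Longrightarrow> \<sigma> {x, y} = 1 \<or> \<sigma> {x, y} = -1"
  using sig by (auto simp: signature_def)

lemma edge_neq: "{x, y} \<in> E \<Longrightarrow> x \<noteq> y"
  using simple by (force simp: simple_graph_def)

abbreviation "arcs \<equiv> {(x, y). {x, y} \<in> E}"

lemma sum_arcs: "(\<Sum>(x, y)\<in>arcs. g x y) = (\<Sum>x\<in>UNIV. \<Sum>y\<in>nbrs E x. g x y)"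
proof -
  have "arcs = (SIGMA x:UNIV. nbrs E x)" by (auto simp: nbrs_def)
  then show ?thesis by (simp add: sum.Sigma)
qed

lemma sum_arcs_swap: "(\<Sum>(x, y)\<in>arcs. g x y) = (\<Sum>(x, y)\<in>arcs. g y x)"
  by (rule sum.reindex_bij_witness[of _ prod.swap prod.swap]) (auto simp: insert_commute)

text \<open>Every edge is counted by its two orientations.\<close>
lemma sum_edges:
  fixes h :: "'v set \<Rightarrow> real"
  assumes "\<And>x y. {x, y} \<in> E \<Longrightarrow> h {x, y} = g x y"
  shows "(\<Sum>e\<in>E. h e) = (\<Sum>(x, y)\<in>arcs. g x y / 2)"
proof -
  have "(\<Sum>(x, y)\<in>arcs. g x y / 2) = (\<Sum>(x, y)\<in>arcs. h {x, y} / 2)"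
    using assms by (intro sum.cong) auto
  also have "\<dots> = (\<Sum>e\<in>(\<lambda>(x, y). {x, y}) ` arcs. \<Sum>u\<in>{u\<in>arcs. (\<lambda>(x, y). {x, y}) u = e}. (\<lambda>(x, y). h {x, y} / 2) u)"
    by (rule sum.image_gen) simp
  also have "(\<lambda>(x, y). {x, y}) ` arcs = E"
  proof
    show "E \<subseteq> (\<lambda>(x, y). {x, y}) ` arcs"
    proof
      fix e assume e: "e \<in> E"
      then have "card e = 2" using simple by (auto simp: simple_graph_def)
      then obtain x y where "e = {x, y}" by (meson card_2_iff)
      then show "e \<in> (\<lambda>(x, y). {x, y}) ` arcs" using e by (intro image_eqI[of _ _ "(x, y)"]) auto
    qed
  qed auto
  also have "(\<Sum>e\<in>E. \<Sum>u\<in>{u\<in>arcs. (\<lambda>(x, y). {x, y}) u = e}. (\<lambda>(x, y). h {x, y} / 2) u) = (\<Sum>e\<in>E. h e)"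
  proof (rule sum.cong[OF refl])
    fix e assume e: "e \<in> E"
    then have "card e = 2" using simple by (auto simp: simple_graph_def)
    then obtain x y where xy: "e = {x, y}" "x \<noteq> y" by (meson card_2_iff)
    have "{u\<in>arcs. (\<lambda>(x, y). {x, y}) u = e} = {(x, y), (y, x)}"
      using e xy by (auto simp: doubleton_eq_iff insert_commute)
    then show "(\<Sum>u\<in>{u\<in>arcs. (\<lambda>(x, y). {x, y}) u = e}. (\<lambda>(x, y). h {x, y} / 2) u) = h e"
      using xy by (simp add: insert_commute)
  qed
  finally show ?thesis by simp
qed

text \<open>The index type consists of the ordered pairs of vertices, one copy of the vertices for the potential, and one for the weight.\<close>
definition form :: "('v \<times> 'v) + ('v + 'v) \<Rightarrow> real^'v" where
  "form j = (case j of Inl (x, y) \<Rightarrow> axis x 1 - \<sigma> {x, y} *\<^sub>R axis y 1 | Inr (Inl x) \<Rightarrow> axis x 1 | Inr (Inr x) \<Rightarrow> axis x 1)"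

text \<open>Each edge occurs as two ordered pairs, hence the factor 1/2.\<close>
definition coef :: "real \<Rightarrow> ('v \<times> 'v) + ('v + 'v) \<Rightarrow> real" where
  "coef l j = (case j of Inl (x, y) \<Rightarrow> if {x, y} \<in> E then w {x, y} / 2 else 0 | Inr (Inl x) \<Rightarrow> \<kappa> x | Inr (Inr x) \<Rightarrow> - l * \<mu> x)"

definition numer :: "real^'v \<Rightarrow> real" where
  "numer f = (\<Sum>e\<in>E. w e * edge_term \<sigma> p f e) + (\<Sum>x\<in>UNIV. \<kappa> x * \<bar>f $ x\<bar> powr p)"

definition denom :: "real^'v \<Rightarrow> real" where
  "denom f = (\<Sum>x\<in>UNIV. \<mu> x * \<bar>f $ x\<bar> powr p)"

abbreviation "J l \<equiv> energy p form (coef l)"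

lemma inner_form [simp]: "form (Inl (x, y)) \<bullet> f = f $ x - \<sigma> {x, y} * f $ y"
   "form (Inr (Inl x)) \<bullet> f = f $ x" "form (Inr (Inr x)) \<bullet> f = f $ x"
  by (simp_all add: form_def inner_diff_left inner_axis')

lemma sum_sum_type: "(\<Sum>j\<in>UNIV. F j) = (\<Sum>x\<in>UNIV. F (Inl x)) + (\<Sum>y\<in>UNIV. F (Inr y))"
  for F :: "'b::finite + 'c::finite \<Rightarrow> 'd::comm_monoid_add"
  unfolding UNIV_Plus_UNIV[symmetric] by (subst sum.Plus) auto

lemma sum_index: "(\<Sum>j\<in>UNIV. coef l j *\<^sub>R F j) = (\<Sum>(x, y)\<in>arcs. (w {x, y} / 2) *\<^sub>R F (Inl (x, y))) +
    ((\<Sum>x\<in>UNIV. \<kappa> x *\<^sub>R F (Inr (Inl x))) + (\<Sum>x\<in>UNIV. (- l * \<mu> x) *\<^sub>R F (Inr (Inr x))))"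
  for F :: "_ \<Rightarrow> 'b::real_vector"
proof -
  have "(\<Sum>u\<in>UNIV. coef l (Inl u) *\<^sub>R F (Inl u)) = (\<Sum>(x, y)\<in>arcs. (w {x, y} / 2) *\<^sub>R F (Inl (x, y)))"
    by (rule sum.mono_neutral_cong_right) (auto simp: coef_def)
  then show ?thesis by (simp add: sum_sum_type coef_def)
qed

lemma energy_eq: "J l f = numer f - l * denom f"
proof -
  have "(\<Sum>e\<in>E. w e * edge_term \<sigma> p f e) = (\<Sum>(x, y)\<in>arcs. w {x, y} * \<bar>f $ x - \<sigma> {x, y} * f $ y\<bar> powr p / 2)"
    using sig by (intro sum_edges) (simp add: edge_term_eq signature_def)
  moreover have "J l f = (\<Sum>j\<in>UNIV. coef l j *\<^sub>R \<bar>form j \<bullet> f\<bar> powr p)" by (simp add: energy_def)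
  ultimately show ?thesis unfolding sum_index numer_def denom_def
    by (simp add: sum_distrib_left sum_negf algebra_simps)
qed

text \<open>Both definitions of an eigenfunction, in terms of \<open>subgrad\<close>. For \<open>p > 1\<close> the antisymmetry of \<open>z\<close> is automatic.\<close>
lemma eigenfunction_iff: "eigen l f \<longleftrightarrow> f \<noteq> 0 \<and> (\<exists>z u u'.
    (\<forall>x y. {x, y} \<in> E \<longrightarrow> z x y \<in> subgrad p (f $ x - \<sigma> {x, y} * f $ y) \<and> z x y = - \<sigma> {x, y} * z y x) \<and>
    (\<forall>x. u x \<in> subgrad p (f $ x) \<and> u' x \<in> subgrad p (f $ x)) \<and>
    (\<forall>x. (\<Sum>y\<in>nbrs E x. w {x, y} * z x y) + \<kappa> x * u x = l * \<mu> x * u' x))"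
  (is "?L \<longleftrightarrow> ?R")
proof (cases "p = 1")
  case True
  then show ?thesis by (simp add: eigenfunction_def one_eigenfunction_def subgrad_def)
next
  case False
  have sub: "z \<in> subgrad p t \<longleftrightarrow> z = Phi p t" for z t using False by (simp add: subgrad_def)
  have anti: "Phi p (f $ x - \<sigma> {x, y} * f $ y) = - \<sigma> {x, y} * Phi p (f $ y - \<sigma> {y, x} * f $ x)" if "{x, y} \<in> E" for x y
    using sigma_pm[OF that] Phi_minus[of p "f $ y - f $ x"] by (auto simp: insert_commute add.commute)
  show ?thesis
  proof
    assume ?L
    then have "f \<noteq> 0" "\<forall>x. p_laplacian E w \<kappa> \<sigma> p f x = l * \<mu> x * Phi p (f $ x)"
      using False by (auto simp: eigenfunction_def p_eigenfunction_def)
    then show ?R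
      unfolding sub p_laplacian_def using anti
      by (intro conjI exI[of _ "\<lambda>x y. Phi p (f $ x - \<sigma> {x, y} * f $ y)"] exI[of _ "\<lambda>x. Phi p (f $ x)"]) auto
  next
    assume ?R
    then obtain z u u' where f: "f \<noteq> 0" and z: "\<And>x y. {x, y} \<in> E \<Longrightarrow> z x y = Phi p (f $ x - \<sigma> {x, y} * f $ y)"
      and u: "\<And>x. u x = Phi p (f $ x)" "\<And>x. u' x = Phi p (f $ x)"
      and eq: "\<And>x. (\<Sum>y\<in>nbrs E x. w {x, y} * z x y) + \<kappa> x * u x = l * \<mu> x * u' x"
      unfolding sub by blast
    have "p_laplacian E w \<kappa> \<sigma> p f x = l * \<mu> x * Phi p (f $ x)" for x
    proof -
      have "(\<Sum>y\<in>nbrs E x. w {x, y} * Phi p (f $ x - \<sigma> {x, y} * f $ y)) = (\<Sum>y\<in>nbrs E x. w {x, y} * z x y)"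
        using z by (intro sum.cong) (auto simp: nbrs_def)
      then show ?thesis using eq[of x] u by (simp add: p_laplacian_def)
    qed
    then show "eigen l f" using f False by (simp add: eigenfunction_def p_eigenfunction_def)
  qed
qed

text \<open>The gradient set does not relate the multipliers of the two orientations of an edge. Averaging them antisymmetrically
  stays in the convex set \<open>subgrad\<close> and does not change the equation at any vertex.\<close>
lemma critical_imp_eigenfunction:
  assumes f: "f \<noteq> 0" and crit: "0 \<in> energy_grad p form (coef l) f"
  shows "eigen l f"
proof -
  obtain z where z: "\<forall>j. z j \<in> subgrad p (form j \<bullet> f)" "0 = (\<Sum>j\<in>UNIV. (coef l j * z j) *\<^sub>R form j)"
    using energy_gradE[OF crit] by blast
  define Z where "Z x y = (z (Inl (x, y)) - \<sigma> {x, y} * z (Inl (y, x))) / 2" for x y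
  have Z: "Z x y \<in> subgrad p (f $ x - \<sigma> {x, y} * f $ y) \<and> Z x y = - \<sigma> {x, y} * Z y x" if e: "{x, y} \<in> E" for x y
  proof -
    have z1: "z (Inl (x, y)) \<in> subgrad p (f $ x - \<sigma> {x, y} * f $ y)" using z(1)[rule_format, of "Inl (x, y)"] by simp
    have z2: "z (Inl (y, x)) \<in> subgrad p (f $ y - \<sigma> {x, y} * f $ x)"
      using z(1)[rule_format, of "Inl (y, x)"] by (simp add: insert_commute)
    have z3: "- \<sigma> {x, y} * z (Inl (y, x)) \<in> subgrad p (f $ x - \<sigma> {x, y} * f $ y)"
      using sigma_pm[OF e] z2 subgrad_minus[OF z2] by (auto simp: add.commute)
    have "(1/2) *\<^sub>R z (Inl (x, y)) + (1/2) *\<^sub>R (- \<sigma> {x, y} * z (Inl (y, x))) \<in> subgrad p (f $ x - \<sigma> {x, y} * f $ y)"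
      using convexD[OF convex_subgrad z1 z3, of "1/2" "1/2"] by simp
    moreover have "Z x y = (1/2) *\<^sub>R z (Inl (x, y)) + (1/2) *\<^sub>R (- \<sigma> {x, y} * z (Inl (y, x)))"
      by (simp add: Z_def field_simps)
    moreover have "Z x y = - \<sigma> {x, y} * Z y x"
      using sigma_pm[OF e] by (auto simp: Z_def insert_commute field_simps)
    ultimately show ?thesis by simp
  qed
  have eq: "(\<Sum>y\<in>nbrs E x. w {x, y} * Z x y) + \<kappa> x * z (Inr (Inl x)) = l * \<mu> x * z (Inr (Inr x))" for x
  proof -
    have "0 = (\<Sum>j\<in>UNIV. coef l j *\<^sub>R (z j * form j $ x))"
      using arg_cong[OF z(2), of "\<lambda>v. v $ x"] by (simp add: sum_component mult.assoc)
    also have "\<dots> = (\<Sum>(a, y)\<in>arcs. w {a, y} / 2 * (z (Inl (a, y)) * form (Inl (a, y)) $ x)) +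
       ((\<Sum>y\<in>UNIV. \<kappa> y * (z (Inr (Inl y)) * form (Inr (Inl y)) $ x)) + (\<Sum>y\<in>UNIV. - l * \<mu> y * (z (Inr (Inr y)) * form (Inr (Inr y)) $ x)))"
      unfolding sum_index by simp
    also have "(\<Sum>y\<in>UNIV. \<kappa> y * (z (Inr (Inl y)) * form (Inr (Inl y)) $ x)) = \<kappa> x * z (Inr (Inl x))"
      by (simp add: form_def axis_def if_distrib cong: if_cong)
    also have "(\<Sum>y\<in>UNIV. - l * \<mu> y * (z (Inr (Inr y)) * form (Inr (Inr y)) $ x)) = - l * \<mu> x * z (Inr (Inr x))"
      by (simp add: form_def axis_def if_distrib cong: if_cong)
    also have "(\<Sum>(a, y)\<in>arcs. w {a, y} / 2 * (z (Inl (a, y)) * form (Inl (a, y)) $ x)) =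
        (\<Sum>(a, y)\<in>arcs. if a = x then w {a, y} / 2 * z (Inl (a, y)) else 0) -
        (\<Sum>(a, y)\<in>arcs. if y = x then w {a, y} / 2 * \<sigma> {a, y} * z (Inl (a, y)) else 0)"
      unfolding sum_subtractf[symmetric]
      by (rule sum.cong) (auto simp: form_def axis_def edge_neq algebra_simps)
    also have "(\<Sum>(a, y)\<in>arcs. if y = x then w {a, y} / 2 * \<sigma> {a, y} * z (Inl (a, y)) else 0) =
        (\<Sum>(a, y)\<in>arcs. if a = x then w {a, y} / 2 * \<sigma> {a, y} * z (Inl (y, a)) else 0)"
      by (subst sum_arcs_swap) (auto intro!: sum.cong simp: insert_commute)
    also have "(\<Sum>(a, y)\<in>arcs. if a = x then w {a, y} / 2 * z (Inl (a, y)) else 0) -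
        (\<Sum>(a, y)\<in>arcs. if a = x then w {a, y} / 2 * \<sigma> {a, y} * z (Inl (y, a)) else 0) =
        (\<Sum>(a, y)\<in>arcs. if a = x then w {a, y} * Z a y else 0)"
      unfolding sum_subtractf[symmetric] by (rule sum.cong) (auto simp: Z_def field_simps)
    also have "\<dots> = (\<Sum>a\<in>UNIV. if a = x then (\<Sum>y\<in>nbrs E x. w {x, y} * Z x y) else 0)"
      unfolding sum_arcs by (rule sum.cong) auto
    also have "\<dots> = (\<Sum>y\<in>nbrs E x. w {x, y} * Z x y)" by simp
    finally show ?thesis by simp
  qed
  have "\<forall>x. z (Inr (Inl x)) \<in> subgrad p (f $ x) \<and> z (Inr (Inr x)) \<in> subgrad p (f $ x)"
    using z(1) by (metis inner_form(2,3))
  then show ?thesis unfolding eigenfunction_iff using f Z eq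
    by (intro conjI exI[of _ Z] exI[of _ "\<lambda>x. z (Inr (Inl x))"] exI[of _ "\<lambda>x. z (Inr (Inr x))"]) blast+
qed

definition rescale :: "('v \<Rightarrow> real) \<Rightarrow> real^'v \<Rightarrow> real^'v" where
  "rescale t f = (\<chi> x. t x * f $ x)"

text \<open>What the oriented edge contributes to the energy of \<open>t f\<close> in excess of the share that the eigenvalue equation allots to it.\<close>
definition arc_gap :: "('v \<Rightarrow> 'v \<Rightarrow> real) \<Rightarrow> ('v \<Rightarrow> real) \<Rightarrow> real^'v \<Rightarrow> 'v \<Rightarrow> 'v \<Rightarrow> real" where
  "arc_gap z t f x y = \<bar>t x * f $ x - t y * (\<sigma> {x, y} * f $ y)\<bar> powr p -
     z x y * (\<bar>t x\<bar> powr p * f $ x - \<bar>t y\<bar> powr p * (\<sigma> {x, y} * f $ y))"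

text \<open>Pair the eigenvalue equation with \<open>\<bar>t\<bar>\<^sup>p f\<close> and sum by parts: the vertex terms of the energy of \<open>t f\<close> are thereby expressed
  through edges, and the energy becomes a sum of the edgewise gaps.\<close>
lemma energy_rescale:
  assumes eig: "eigen l f"
  obtains z where "\<And>x y. {x, y} \<in> E \<Longrightarrow> z x y \<in> subgrad p (f $ x - \<sigma> {x, y} * f $ y)"
    "\<And>t. J l (rescale t f) = (\<Sum>(x, y)\<in>arcs. w {x, y} / 2 *
      arc_gap z t f x y)"
proof -
  obtain z u u' where z: "\<And>x y. {x, y} \<in> E \<Longrightarrow> z x y \<in> subgrad p (f $ x - \<sigma> {x, y} * f $ y)"
    and anti: "\<And>x y. {x, y} \<in> E \<Longrightarrow> z x y = - \<sigma> {x, y} * z y x"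
    and u: "\<And>x. u x \<in> subgrad p (f $ x)" "\<And>x. u' x \<in> subgrad p (f $ x)"
    and eq: "\<And>x. (\<Sum>y\<in>nbrs E x. w {x, y} * z x y) + \<kappa> x * u x = l * \<mu> x * u' x"
    using eig unfolding eigenfunction_iff by blast
  have "J l (rescale t f) = (\<Sum>(x, y)\<in>arcs. w {x, y} / 2 *
      arc_gap z t f x y)" for t
  proof -
    have tf: "\<bar>t x * f $ x\<bar> powr p = \<bar>t x\<bar> powr p * (u x * f $ x)" "\<bar>t x * f $ x\<bar> powr p = \<bar>t x\<bar> powr p * (u' x * f $ x)" for x
      using subgrad_mult_self[OF u(1)] subgrad_mult_self[OF u(2)] by (simp_all add: abs_mult powr_mult)
    define T where "T x = \<bar>t x\<bar> powr p * f $ x" for x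
    \<comment> \<open>Test the equation with \<open>T = \<bar>t\<bar>\<^sup>p f\<close>.\<close>
    have "(\<Sum>x\<in>UNIV. T x * ((\<Sum>y\<in>nbrs E x. w {x, y} * z x y) + \<kappa> x * u x - l * \<mu> x * u' x)) = 0" using eq by simp
    then have "(\<Sum>x\<in>UNIV. \<Sum>y\<in>nbrs E x. T x * (w {x, y} * z x y)) + (\<Sum>x\<in>UNIV. \<kappa> x * (T x * u x)) - (\<Sum>x\<in>UNIV. l * \<mu> x * (T x * u' x)) = 0"
      by (simp add: sum.distrib sum_subtractf algebra_simps sum_distrib_left)
    moreover have "T x * u x = \<bar>t x * f $ x\<bar> powr p" "T x * u' x = \<bar>t x * f $ x\<bar> powr p" for x
      using tf(1)[of x] tf(2)[of x] by (simp_all only: T_def mult_ac)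
    ultimately have 1: "(\<Sum>(x, y)\<in>arcs. T x * (w {x, y} * z x y)) + (\<Sum>x\<in>UNIV. \<kappa> x * \<bar>t x * f $ x\<bar> powr p) - (\<Sum>x\<in>UNIV. l * \<mu> x * \<bar>t x * f $ x\<bar> powr p) = 0"
      by (simp add: sum_arcs)
    have "(\<Sum>(x, y)\<in>arcs. T x * (w {x, y} * z x y)) = ((\<Sum>(x, y)\<in>arcs. T x * (w {x, y} * z x y)) + (\<Sum>(x, y)\<in>arcs. T y * (w {y, x} * z y x))) / 2"
      using sum_arcs_swap[of "\<lambda>x y. T x * (w {x, y} * z x y)"] by simp
    also have "\<dots> = (\<Sum>(x, y)\<in>arcs. (T x * (w {x, y} * z x y) + T y * (w {y, x} * z y x)) / 2)"
      by (simp add: sum.distrib[symmetric] sum_divide_distrib split_def)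
    also have "\<dots> = (\<Sum>(x, y)\<in>arcs. w {x, y} / 2 * (z x y * (T x - T y * \<sigma> {x, y})))"
    proof (rule sum.cong[OF refl], clarify)
      fix x y assume e: "{x, y} \<in> E"
      have "z y x = - \<sigma> {x, y} * z x y" using anti[of y x] e by (simp add: insert_commute)
      then show "(T x * (w {x, y} * z x y) + T y * (w {y, x} * z y x)) / 2 = w {x, y} / 2 * (z x y * (T x - T y * \<sigma> {x, y}))"
        by (simp add: insert_commute field_simps)
    qed
    finally have 2: "(\<Sum>(x, y)\<in>arcs. T x * (w {x, y} * z x y)) = (\<Sum>(x, y)\<in>arcs. w {x, y} / 2 * (z x y * (T x - T y * \<sigma> {x, y})))" .
    have "J l (rescale t f) = (\<Sum>j\<in>UNIV. coef l j *\<^sub>R \<bar>form j \<bullet> rescale t f\<bar> powr p)" by (simp add: energy_def)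
    also have "\<dots> = (\<Sum>(x, y)\<in>arcs. w {x, y} / 2 * \<bar>t x * f $ x - \<sigma> {x, y} * (t y * f $ y)\<bar> powr p) +
       (\<Sum>x\<in>UNIV. \<kappa> x * \<bar>t x * f $ x\<bar> powr p) - (\<Sum>x\<in>UNIV. l * \<mu> x * \<bar>t x * f $ x\<bar> powr p)"
      unfolding sum_index by (simp add: rescale_def sum_negf)
    also have "\<dots> = (\<Sum>(x, y)\<in>arcs. w {x, y} / 2 * \<bar>t x * f $ x - \<sigma> {x, y} * (t y * f $ y)\<bar> powr p) - 
       (\<Sum>(x, y)\<in>arcs. w {x, y} / 2 * (z x y * (T x - T y * \<sigma> {x, y})))" using 1 2 by simp
    also have "\<dots> = (\<Sum>(x, y)\<in>arcs. w {x, y} / 2 *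
      arc_gap z t f x y)"
      unfolding sum_subtractf[symmetric] by (rule sum.cong) (auto simp: T_def arc_gap_def algebra_simps)
    finally show ?thesis .
  qed
  with z show ?thesis using that by blast
qed

text \<open>Scaling by a factor that is constant on the nodal domains: inside a domain the gap vanishes, and across all
  other edges \<open>f(x)\<close> and \<open>\<sigma> f(y)\<close> have opposite signs or one of them is zero.\<close>
lemma energy_rescale_le:
  assumes eig: "eigen l f"
    and t: "\<And>x y. {x, y} \<in> E \<Longrightarrow> 0 < f $ x * \<sigma> {x, y} * f $ y \<Longrightarrow> t x = t y"
  shows "J l (rescale t f) \<le> 0"
proof (rule energy_rescale[OF eig])
  fix z assume z: "\<And>x y. {x, y} \<in> E \<Longrightarrow> z x y \<in> subgrad p (f $ x - \<sigma> {x, y} * f $ y)"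
    and eq: "\<And>t. J l (rescale t f) = (\<Sum>(x, y)\<in>arcs. w {x, y} / 2 *
      arc_gap z t f x y)"
  have "\<bar>t x * f $ x - t y * (\<sigma> {x, y} * f $ y)\<bar> powr p \<le>
       z x y * (\<bar>t x\<bar> powr p * f $ x - \<bar>t y\<bar> powr p * (\<sigma> {x, y} * f $ y))" if e: "{x, y} \<in> E" for x y
  proof (cases "0 < f $ x * \<sigma> {x, y} * f $ y")
    case True
    then show ?thesis using t[OF e True] edge_eq[OF z[OF e]] by simp
  next
    case False
    then have "f $ x * (\<sigma> {x, y} * f $ y) \<le> 0" by (simp add: mult.assoc)
    then show ?thesis using edge_le[OF p _ z[OF e]] by blast
  qed
  then show ?thesis unfolding eq arc_gap_def using w_pos by (intro sum_nonpos) (auto simp: mult_le_0_iff less_imp_le)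
qed

lemma energy_rescale_ge:
  assumes eig: "eigen l f"
    and t: "\<And>x y. {x, y} \<in> E \<Longrightarrow> f $ x * \<sigma> {x, y} * f $ y < 0 \<Longrightarrow> t x = t y"
  shows "0 \<le> J l (rescale t f)"
proof (rule energy_rescale[OF eig])
  fix z assume z: "\<And>x y. {x, y} \<in> E \<Longrightarrow> z x y \<in> subgrad p (f $ x - \<sigma> {x, y} * f $ y)"
    and eq: "\<And>t. J l (rescale t f) = (\<Sum>(x, y)\<in>arcs. w {x, y} / 2 *
      arc_gap z t f x y)"
  have "z x y * (\<bar>t x\<bar> powr p * f $ x - \<bar>t y\<bar> powr p * (\<sigma> {x, y} * f $ y)) \<le>
     \<bar>t x * f $ x - t y * (\<sigma> {x, y} * f $ y)\<bar> powr p" if e: "{x, y} \<in> E" for x y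
  proof (cases "f $ x * \<sigma> {x, y} * f $ y < 0")
    case True
    then show ?thesis using t[OF e True] edge_eq[OF z[OF e]] by simp
  next
    case False
    then have "0 \<le> f $ x * (\<sigma> {x, y} * f $ y)" by (simp add: mult.assoc)
    then show ?thesis using edge_ge[OF p _ z[OF e]] by blast
  qed
  then show ?thesis unfolding eq arc_gap_def using w_pos by (intro sum_nonneg) (auto simp: zero_le_mult_iff less_imp_le)
qed

end

section \<open>Variational eigenvalues\<close>

context weighted_signed_graph
begin

abbreviation "psphere \<equiv> p_sphere \<mu> p"

lemma rayleigh_eq: "rayleigh_q f = numer f / denom f"
  by (simp add: rayleigh_def numer_def denom_def)

lemma mem_sphere_iff: "f \<in> psphere \<longleftrightarrow> denom f = 1"
  by (simp add: p_sphere_def denom_def)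

lemma denom_pos: "f \<noteq> 0 \<Longrightarrow> 0 < denom f"
proof -
  assume "f \<noteq> 0"
  then obtain x where "f $ x \<noteq> 0" by (auto simp: vec_eq_iff)
  then show ?thesis unfolding denom_def using \<mu>_pos by (intro sum_pos2[of _ x]) (auto simp: less_imp_le)
qed

lemma denom_zero: "denom 0 = 0"
  using p by (simp add: denom_def)

lemma energy_zero: "J l 0 = 0"
  using p by (simp add: energy_def)

lemma energy_scale: "J l (c *\<^sub>R f) = \<bar>c\<bar> powr p * J l f"
  by (simp add: energy_def abs_mult powr_mult sum_distrib_left mult_ac)

lemma denom_scale: "denom (c *\<^sub>R f) = \<bar>c\<bar> powr p * denom f"
  by (simp add: denom_def abs_mult powr_mult sum_distrib_left mult_ac)

lemma rayleigh_minus: "f \<noteq> 0 \<Longrightarrow> rayleigh_q f - l = J l f / denom f"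
  using denom_pos[of f] by (simp add: rayleigh_eq energy_eq field_simps)

lemma continuous_energy: "continuous_on UNIV (J l)"
  unfolding energy_def using p by (intro continuous_intros continuous_on_powr') auto

lemma isCont_energy: "isCont (J l) f"
  using continuous_energy[of l] by (simp add: continuous_on_eq_continuous_at)

lemma continuous_denom: "continuous_on UNIV denom"
  unfolding denom_def[abs_def] using p by (intro continuous_intros continuous_on_powr') auto

definition normalize_p :: "real^'v \<Rightarrow> real^'v" where
  "normalize_p f = (denom f powr (- (1 / p))) *\<^sub>R f"

lemma normalize_p_sphere: "f \<noteq> 0 \<Longrightarrow> normalize_p f \<in> psphere"
proof -
  assume "f \<noteq> 0"
  then have d: "0 < denom f" by (rule denom_pos)
  have "denom (normalize_p f) = (denom f powr (- (1 / p))) powr p * denom f"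
    by (simp add: normalize_p_def denom_scale)
  also have "\<dots> = denom f powr (-1) * denom f" using p by (simp add: powr_powr)
  also have "\<dots> = 1" using d by (simp add: powr_minus)
  finally show ?thesis by (simp add: mem_sphere_iff)
qed

lemma normalize_p_minus: "normalize_p (- f) = - normalize_p f"
  using denom_scale[of "-1" f] by (simp add: normalize_p_def)

lemma continuous_normalize_p: "continuous_on (UNIV - {0}) normalize_p"
proof -
  have "continuous_on (UNIV - {0}) denom" using continuous_denom by (rule continuous_on_subset) auto
  then show ?thesis unfolding normalize_p_def[abs_def]
    using denom_pos by (intro continuous_intros) (auto simp: less_imp_neq[symmetric])
qed

lemma sphere_nonzero: "f \<in> psphere \<Longrightarrow> f \<noteq> 0"
  using denom_zero by (auto simp: mem_sphere_iff)

lemma sphere_minus: "f \<in> psphere \<Longrightarrow> - f \<in> psphere"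
  using denom_scale[of "-1" f] by (simp add: mem_sphere_iff)

lemma compact_sphere: "compact psphere"
proof -
  have "psphere = {f. denom f \<in> {1}}" by (auto simp: mem_sphere_iff)
  also have "closed \<dots>" using continuous_closed_vimage[of "{1}" denom] continuous_denom
    by (simp add: vimage_def continuous_on_eq_continuous_at)
  finally have "closed psphere" .
  moreover have "bounded psphere"
  proof -
    have "norm f \<le> (\<Sum>x\<in>UNIV. (1 / \<mu> x) powr (1 / p))" if f: "f \<in> psphere" for f
    proof -
      have "\<bar>f $ x\<bar> \<le> (1 / \<mu> x) powr (1 / p)" for x
      proof -
        have "\<mu> x * \<bar>f $ x\<bar> powr p \<le> denom f" unfolding denom_def
          using \<mu>_pos by (intro member_le_sum) (auto simp: less_imp_le)
        then have "\<bar>f $ x\<bar> powr p \<le> 1 / \<mu> x" using f \<mu>_pos[of x] by (simp add: mem_sphere_iff field_simps)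
        then have "(\<bar>f $ x\<bar> powr p) powr (1 / p) \<le> (1 / \<mu> x) powr (1 / p)" using p by (intro powr_mono2) auto
        then show ?thesis using p by (simp add: powr_powr)
      qed
      then have "(\<Sum>x\<in>UNIV. \<bar>f $ x\<bar>) \<le> (\<Sum>x\<in>UNIV. (1 / \<mu> x) powr (1 / p))" by (intro sum_mono) auto
      then show ?thesis using norm_le_l1_cart[of f] by simp
    qed
    then show ?thesis by (auto simp: bounded_iff)
  qed
  ultimately show ?thesis by (simp add: compact_eq_bounded_closed)
qed

lemma rayleigh_on_sphere: "f \<in> psphere \<Longrightarrow> rayleigh_q f = J 0 f"
  by (simp add: rayleigh_eq energy_eq mem_sphere_iff)

lemma continuous_rayleigh: "A \<subseteq> psphere \<Longrightarrow> continuous_on A (rayleigh_q)"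
proof -
  assume A: "A \<subseteq> psphere"
  have "continuous_on A (J 0)" by (rule continuous_on_subset[OF continuous_energy]) simp
  moreover have "continuous_on A (rayleigh_q) = continuous_on A (J 0)"
    by (rule continuous_on_cong[OF refl]) (use A rayleigh_on_sphere in blast)
  ultimately show ?thesis by simp
qed

text \<open>The genus is monotone under odd maps, and the punctured space \<open>X - {0}\<close> has genus at least \<open>dim X\<close> by the Borsuk-Ulam theorem.
  Stating it for an odd map \<open>\<phi>\<close> out of \<open>X - {0}\<close> covers spheres as well as their deformations.\<close>
lemma genus_geI:
  fixes X :: "(real^'v) set"
  assumes X: "subspace X" "1 \<le> dim X"
    and \<phi>: "continuous_on (X - {0}) \<phi>" "\<And>v. v \<in> X \<Longrightarrow> v \<noteq> 0 \<Longrightarrow> \<phi> (- v) = - \<phi> v"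
      "\<And>v. v \<in> X \<Longrightarrow> v \<noteq> 0 \<Longrightarrow> \<phi> v \<in> B"
  shows "B \<noteq> {}" "enat (dim X) \<le> krasnoselskii_genus B"
proof -
  have "\<exists>v. v \<in> X \<and> v \<noteq> 0"
  proof (rule ccontr)
    assume "\<not> ?thesis"
    then have "X \<subseteq> {0}" by auto
    then have "dim X = 0" by (simp add: dim_eq_0)
    then show False using X(2) by linarith
  qed
  then show ne: "B \<noteq> {}" using \<phi>(3) by blast
  have "dim X \<le> j" if j: "odd_map_to_punctured B j" for j
  proof (rule ccontr)
    assume "\<not> dim X \<le> j"
    then have jX: "j < dim X" by simp
    obtain h where h: "continuous_map (top_of_set B) (subtopology (Euclidean_space j) (- {\<lambda>i. 0})) h"
      and hodd: "\<forall>f\<in>B. \<forall>i. h (- f) i = - h f i"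
      using j unfolding odd_map_to_punctured_def by blast
    have h1: "continuous_map (top_of_set B) (powertop_real UNIV) h"
      and h2: "h ` B \<subseteq> {x. \<forall>i\<ge>j. x i = 0}" and h3: "h ` B \<subseteq> - {\<lambda>i. 0}"
      using h unfolding Euclidean_space_def continuous_map_in_subtopology by auto
    have ch: "continuous_on B (\<lambda>f. h f i)" for i
      using h1 unfolding continuous_map_componentwise_UNIV by simp
    have "\<exists>v\<in>X. v \<noteq> 0 \<and> (\<forall>i<j. h (\<phi> v) i = 0)"
    proof (rule borsuk_ulam_subspace[OF X(1) jX])
      show "continuous_on (X - {0}) (\<lambda>v. h (\<phi> v) i)" for i
        by (rule continuous_on_compose2[OF ch \<phi>(1)]) (use \<phi>(3) in auto)
      show "h (\<phi> (- v)) i = - h (\<phi> v) i" if "v \<in> X" "v \<noteq> 0" for v i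
        using hodd \<phi>(2,3)[OF that] by simp
    qed
    then obtain v where v: "v \<in> X" "v \<noteq> 0" "\<forall>i<j. h (\<phi> v) i = 0" by blast
    have "h (\<phi> v) = (\<lambda>i. 0)"
    proof
      fix i show "h (\<phi> v) i = 0"
        using v(3) h2 \<phi>(3)[OF v(1,2)] by (cases "i < j") auto
    qed
    moreover have "h (\<phi> v) \<in> h ` B" using \<phi>(3)[OF v(1,2)] by (rule imageI)
    ultimately show False using h3 by auto
  qed
  then show "enat (dim X) \<le> krasnoselskii_genus B"
    using ne by (auto simp: krasnoselskii_genus_def intro!: Inf_greatest)
qed

abbreviation "\<Lambda> \<equiv> variational_eigenvalue E w \<mu> \<kappa> \<sigma> p"

lemma bdd_rayleigh: "A \<subseteq> psphere \<Longrightarrow> bdd_above (rayleigh_q ` A)"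
  "A \<subseteq> psphere \<Longrightarrow> bdd_below (rayleigh_q ` A)"
proof -
  have "compact (rayleigh_q ` psphere)"
    using continuous_rayleigh[OF order_refl] compact_sphere by (rule compact_continuous_image)
  then have "bounded (rayleigh_q ` psphere)" by (rule compact_imp_bounded)
  then show "A \<subseteq> psphere \<Longrightarrow> bdd_above (rayleigh_q ` A)" 
    "A \<subseteq> psphere \<Longrightarrow> bdd_below (rayleigh_q ` A)"
    by (meson bounded_imp_bdd_above bounded_imp_bdd_below bdd_above_mono bdd_below_mono image_mono)+
qed

lemma genus_family_nonempty_set: "1 \<le> k \<Longrightarrow> A \<in> genus_family \<mu> p k \<Longrightarrow> A \<noteq> {}"
  by (auto simp: genus_family_def krasnoselskii_genus_def zero_enat_def)

lemma variational_le:
  assumes k: "1 \<le> k" and A: "A \<in> genus_family \<mu> p k"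
  shows "\<Lambda> k \<le> (SUP f\<in>A. rayleigh_q f)"
  unfolding variational_eigenvalue_def
proof (rule cINF_lower[OF _ A])
  obtain m where m: "\<And>f. f \<in> psphere \<Longrightarrow> m \<le> rayleigh_q f"
    using bdd_rayleigh(2)[OF order_refl] by (auto simp: bdd_below_def)
  show "bdd_below ((\<lambda>S. SUP f\<in>S. rayleigh_q f) ` genus_family \<mu> p k)"
  proof (rule bdd_belowI2)
    fix S assume S: "S \<in> genus_family \<mu> p k"
    then have sub: "S \<subseteq> psphere" by (simp add: genus_family_def)
    obtain f where f: "f \<in> S" using genus_family_nonempty_set[OF k S] by blast
    have "m \<le> rayleigh_q f" using m f sub by blast
    also have "\<dots> \<le> (SUP f\<in>S. rayleigh_q f)" using f bdd_rayleigh(1)[OF sub] by (rule cSUP_upper)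
    finally show "m \<le> (SUP f\<in>S. rayleigh_q f)" .
  qed
qed

text \<open>In particular the families over which the variational eigenvalues are infima are nonempty; without this the infimum
  would be meaningless.\<close>
lemma sphere_in_genus_family: "k \<le> CARD('v) \<Longrightarrow> psphere \<in> genus_family \<mu> p k"
proof -
  assume k: "k \<le> CARD('v)"
  have "enat (dim (UNIV :: (real^'v) set)) \<le> krasnoselskii_genus psphere"
  proof (rule genus_geI(2)[where \<phi> = normalize_p])
    show "1 \<le> dim (UNIV :: (real^'v) set)" by (simp add: Suc_leI)
  qed (use continuous_normalize_p normalize_p_minus normalize_p_sphere in auto)
  then have "enat k \<le> krasnoselskii_genus psphere" using k by (simp add: order_trans[of "enat k" "enat CARD('v)"])
  moreover have "psphere = uminus ` psphere" using sphere_minus by (force simp: image_iff)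
  ultimately show ?thesis using compact_sphere by (simp add: genus_family_def)
qed

lemma variational_approx:
  assumes k: "1 \<le> k" "k \<le> CARD('v)" and e: "0 < e"
  obtains A where "A \<in> genus_family \<mu> p k" "\<And>f. f \<in> A \<Longrightarrow> rayleigh_q f < \<Lambda> k + e"
proof -
  have "genus_family \<mu> p k \<noteq> {}" using sphere_in_genus_family[OF k(2)] by blast
  moreover have "Inf ((\<lambda>S. SUP f\<in>S. rayleigh_q f) ` genus_family \<mu> p k) < \<Lambda> k + e"
    using e by (simp add: variational_eigenvalue_def)
  ultimately obtain A where A: "A \<in> genus_family \<mu> p k" "(SUP f\<in>A. rayleigh_q f) < \<Lambda> k + e"
    using cInf_lessD[of "(\<lambda>S. SUP f\<in>S. rayleigh_q f) ` genus_family \<mu> p k" "\<Lambda> k + e"] by blast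
  have "A \<subseteq> psphere" using A(1) by (simp add: genus_family_def)
  then have "rayleigh_q f < \<Lambda> k + e" if "f \<in> A" for f
    using cSUP_upper[OF that bdd_rayleigh(1)] A(2) by fastforce
  then show ?thesis using that A(1) by blast
qed

text \<open>The points of the sphere of \<open>X\<close> at level 0 form a compact symmetric set, on which only eigenfunctions could be critical.\<close>
lemma descent_field_on_subspace:
  fixes X :: "(real^'v) set"
  assumes X: "subspace X" and no_eig: "\<And>g. g \<in> X \<Longrightarrow> \<not> eigen l g"
  obtains v where "continuous_on UNIV v" "\<And>f. v (- f) = - v f"
    "\<And>f g. f \<in> psphere \<inter> X \<Longrightarrow> J l f = 0 \<Longrightarrow> g \<in> energy_grad p form (coef l) f \<Longrightarrow> g \<bullet> v f < 0"
proof -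
  define K where "K = psphere \<inter> X \<inter> {f. J l f = 0}"
  have "closed {f. J l f = 0}" using continuous_closed_vimage[of "{0}" "J l"] isCont_energy by (simp add: vimage_def)
  then have compK: "compact K" unfolding K_def
    using compact_sphere closed_subspace[OF X] by (intro compact_Int_closed)
  have minusK: "- f \<in> K" if "f \<in> K" for f
    using that sphere_minus subspace_neg[OF X] energy_scale[of l "-1" f] by (auto simp: K_def)
  have nc: "0 \<notin> energy_grad p form (coef l) f" if "f \<in> K" for f
    using that no_eig critical_imp_eigenfunction sphere_nonzero by (auto simp: K_def)
  obtain v where v: "continuous_on UNIV v" "\<And>f. v (- f) = - v f"
    "\<And>f g. f \<in> K \<Longrightarrow> g \<in> energy_grad p form (coef l) f \<Longrightarrow> g \<bullet> v f < 0"
    using odd_descent_field[OF p compK minusK nc] by blast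
  show ?thesis by (rule that[OF v(1,2)]) (use v(3) in \<open>simp_all add: K_def\<close>)
qed

text \<open>The sphere of \<open>X\<close> competes for the eigenvalue of index \<open>dim X\<close>, which gives \<open>\<le> l\<close>. As it contains no
  eigenfunction, its points at level exactly \<open>l\<close> are noncritical, and one short step along an odd descent field pushes
  the whole sphere strictly below \<open>l\<close> without lowering its genus.\<close>
lemma variational_less:
  fixes X :: "(real^'v) set"
  assumes X: "subspace X" "1 \<le> dim X"
    and le: "\<And>g. g \<in> X \<Longrightarrow> J l g \<le> 0"
    and no_eig: "\<And>g. g \<in> X \<Longrightarrow> \<not> eigen l g"
  shows "\<Lambda> (dim X) < l"
proof -
  define A where "A = psphere \<inter> X"
  have compA: "compact A" unfolding A_def using compact_sphere closed_subspace[OF X(1)] by (rule compact_Int_closed)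
  have minusA: "- f \<in> A" if "f \<in> A" for f using that sphere_minus subspace_neg[OF X(1)] by (auto simp: A_def)
  obtain v where v: "continuous_on UNIV v" "\<And>f. v (- f) = - v f"
    "\<And>f g. f \<in> A \<Longrightarrow> J l f = 0 \<Longrightarrow> g \<in> energy_grad p form (coef l) f \<Longrightarrow> g \<bullet> v f < 0"
    unfolding A_def using descent_field_on_subspace[OF X(1) no_eig] by blast
  have contv: "isCont v f" for f using v(1) by (simp add: continuous_on_eq_continuous_at)
  have "\<exists>n. \<forall>f\<in>A. J l (f + (1 / real (Suc n)) *\<^sub>R v f) < 0"
  proof (rule ccontr)
    assume "\<not> ?thesis"
    then have "\<forall>n. \<exists>f. f \<in> A \<and> 0 \<le> J l (f + (1 / real (Suc n)) *\<^sub>R v f)" by (auto simp: not_less)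
    then obtain f where f: "\<And>n. f n \<in> A" "\<And>n. 0 \<le> J l (f n + (1 / real (Suc n)) *\<^sub>R v (f n))" by metis
    obtain a r where r: "a \<in> A" "strict_mono r" "(f \<circ> r) \<longlonglongrightarrow> a"
      using compA f(1) unfolding compact_def by metis
    define x where "x n = f (r n)" for n
    define s where "s n = 1 / real (Suc (r n))" for n
    have x: "x \<longlonglongrightarrow> a" using r(3) by (simp add: x_def[abs_def] o_def)
    have s: "s \<longlonglongrightarrow> 0" "\<And>n. 0 < s n"
      using LIMSEQ_subseq_LIMSEQ[OF LIMSEQ_inverse_real_of_nat r(2)] by (simp_all add: s_def[abs_def] o_def inverse_eq_divide)
    have vx: "(\<lambda>n. v (x n)) \<longlonglongrightarrow> v a" using isCont_tendsto_compose[OF contv x] .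
    have up: "0 \<le> J l (x n + s n *\<^sub>R v (x n))" for n using f(2) by (simp add: x_def s_def)
    have down: "J l (x n) \<le> 0" for n using le f(1) by (simp add: x_def A_def)
    have "(\<lambda>n. x n + s n *\<^sub>R v (x n)) \<longlonglongrightarrow> a + 0 *\<^sub>R v a" using x s(1) vx by (intro tendsto_intros)
    then have "(\<lambda>n. J l (x n + s n *\<^sub>R v (x n))) \<longlonglongrightarrow> J l a" using isCont_tendsto_compose[OF isCont_energy] by simp
    then have "0 \<le> J l a" using up by (intro LIMSEQ_le_const) auto
    moreover have "J l a \<le> 0" using le r(1) by (simp add: A_def)
    ultimately have "J l a = 0" by simp
    moreover have "- (s n * s n) \<le> J l (x n + s n *\<^sub>R v (x n)) - J l (x n)" for n
      using up[of n] down[of n] by (smt (verit) zero_le_square)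
    ultimately show False using energy_no_descent[OF p x s(1) vx s(2)] v(3)[OF r(1)] by (metis not_less)
  qed
  then obtain n where n: "\<And>f. f \<in> A \<Longrightarrow> J l (f + (1 / real (Suc n)) *\<^sub>R v f) < 0" by blast
  define step where "step f = f + (1 / real (Suc n)) *\<^sub>R v f" for f
  have step_odd: "step (- f) = - step f" for f by (simp add: step_def v(2))
  have step_nz: "step f \<noteq> 0" if "f \<in> A" for f using n[OF that] energy_zero[of l] by (auto simp: step_def)
  have cont_step: "continuous_on UNIV step" unfolding step_def[abs_def] using v(1) by (intro continuous_intros)
  define \<eta> where "\<eta> f = normalize_p (step f)" for f
  have cont_\<eta>: "continuous_on A \<eta>" unfolding \<eta>_def[abs_def]
    by (rule continuous_on_compose2[OF continuous_normalize_p continuous_on_subset[OF cont_step]]) (use step_nz in auto)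
  define B where "B = \<eta> ` A"
  have compB: "compact B" unfolding B_def using cont_\<eta> compA by (rule compact_continuous_image)
  have B_sphere: "B \<subseteq> psphere" unfolding B_def \<eta>_def using step_nz normalize_p_sphere by auto
  have \<eta>_odd: "\<eta> (- f) = - \<eta> f" for f by (simp add: \<eta>_def step_odd normalize_p_minus)
  have normA: "normalize_p g \<in> A" if "g \<in> X" "g \<noteq> 0" for g
    using normalize_p_sphere[OF that(2)] subspace_scale[OF X(1) that(1)] by (simp add: A_def normalize_p_def)
  \<comment> \<open>The deformed sphere is an odd image of \<open>X - {0}\<close>, so that its genus is at least \<open>dim X\<close>.\<close>
  have B: "B \<noteq> {}" "enat (dim X) \<le> krasnoselskii_genus B"
  proof -
    have 1: "continuous_on (X - {0}) (\<lambda>g. \<eta> (normalize_p g))"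
      by (rule continuous_on_compose2[OF cont_\<eta> continuous_on_subset[OF continuous_normalize_p]]) (use normA in auto)
    show "B \<noteq> {}" "enat (dim X) \<le> krasnoselskii_genus B"
      by (rule genus_geI[OF X 1]; use normA in \<open>simp add: normalize_p_minus \<eta>_odd B_def\<close>)+
  qed
  have "B = uminus ` B"
  proof -
    have "- b \<in> B" if b: "b \<in> B" for b
    proof -
      obtain f where "f \<in> A" "b = \<eta> f" using b by (auto simp: B_def)
      then have "- b = \<eta> (- f)" "- f \<in> A" using minusA by (simp_all add: \<eta>_odd)
      then show ?thesis by (simp add: B_def)
    qed
    then show ?thesis by (force simp: image_iff)
  qed
  then have "B \<in> genus_family \<mu> p (dim X)" using compB B_sphere B(2) by (simp add: genus_family_def)
  then have "\<Lambda> (dim X) \<le> (SUP f\<in>B. rayleigh_q f)" using X(2) by (intro variational_le)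
  also have "\<dots> < l"
  proof -
    obtain b where b: "b \<in> B" "\<forall>f\<in>B. rayleigh_q f \<le> rayleigh_q b"
      using continuous_attains_sup[OF compB B(1) continuous_rayleigh[OF B_sphere]] by blast
    obtain f where f: "f \<in> A" "b = \<eta> f" using b(1) by (auto simp: B_def)
    have "J l b = \<bar>denom (step f) powr (- (1 / p))\<bar> powr p * J l (step f)"
      unfolding f(2) \<eta>_def normalize_p_def by (rule energy_scale)
    moreover have "0 < \<bar>denom (step f) powr (- (1 / p))\<bar> powr p" using denom_pos[OF step_nz[OF f(1)]] by simp
    ultimately have "J l b < 0" using n[OF f(1)] by (simp add: step_def mult_pos_neg)
    moreover have "b \<noteq> 0" using b(1) B_sphere sphere_nonzero by blast
    ultimately have "rayleigh_q b < l"
      using rayleigh_minus[of b l] denom_pos[of b] by (smt (verit) divide_neg_pos)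
    moreover have "(SUP f\<in>B. rayleigh_q f) \<le> rayleigh_q b"
      using b(2) B(1) by (intro cSUP_least) auto
    ultimately show ?thesis by simp
  qed
  finally show ?thesis .
qed

text \<open>A set of genus at least \<open>j\<close> must meet every subspace of codimension \<open>j - 1\<close>, also after an odd deformation, since otherwise
  the orthogonal projection along \<open>X\<close> would be an odd map into \<open>\<real>\<^sup>j\<^sup>-\<^sup>1\<close> without zeros. If \<open>X\<close> contained no
  eigenfunction, deform almost optimal sets along an odd descent field until they meet \<open>X\<close>. The points of
  departure \<open>f n\<close> have energy at most \<open>\<epsilon> n * \<epsilon> n\<close> and the points of arrival nonnegative energy, so that a step of length
  \<open>\<epsilon> n\<close> gains nothing to first order. The limit is thus a point of \<open>X\<close> at level 0 at which the field does not
  descend.\<close>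
lemma eigenfunction_in_linking_subspace:
  fixes X :: "(real^'v) set"
  assumes X: "subspace X" and j: "j + dim X = CARD('v) + 1" "1 \<le> j" "j \<le> CARD('v)"
    and ge: "\<And>g. g \<in> X \<Longrightarrow> 0 \<le> J (\<Lambda> j) g"
  obtains g where "g \<in> X" "eigen (\<Lambda> j) g"
proof (rule ccontr)
  note linkI = that
  assume neg: "\<not> thesis"
  have no_eig: "\<not> eigen (\<Lambda> j) g" if "g \<in> X" for g
  proof
    assume "eigen (\<Lambda> j) g"
    with \<open>g \<in> X\<close> have thesis by (rule linkI)
    with neg show False ..
  qed
  define l where "l = \<Lambda> j"
  obtain v where v: "continuous_on UNIV v" "\<And>f. v (- f) = - v f"
    "\<And>f g. f \<in> psphere \<inter> X \<Longrightarrow> J l f = 0 \<Longrightarrow> g \<in> energy_grad p form (coef l) f \<Longrightarrow> g \<bullet> v f < 0"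
    using descent_field_on_subspace[OF X no_eig] unfolding l_def by blast
  have contv: "isCont v f" for f using v(1) by (simp add: continuous_on_eq_continuous_at)
  \<comment> \<open>The subspace \<open>X\<close> is invariant under scaling, so that the deformed points can be used without normalizing them.\<close>
  have meets: "\<exists>a\<in>S. a + c *\<^sub>R v a \<in> X" if S: "S \<in> genus_family \<mu> p j" for S c
  proof (rule ccontr)
    assume no: "\<not> (\<exists>a\<in>S. a + c *\<^sub>R v a \<in> X)"
    define d where "d = CARD('v) - dim X"
    have dj: "d + 1 = j" using j dim_subset_UNIV[of X] by (simp add: d_def)
    have S_ne: "S \<noteq> {}" using genus_family_nonempty_set[OF j(2) S] .
    define Y where "Y = {y. \<forall>x\<in>X. orthogonal x y}"
    have Y: "subspace Y" unfolding Y_def by (rule subspace_orthogonal_to_vectors)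
    have dimY: "dim Y = d"
      using dim_subspace_orthogonal_to_vectors[OF X subspace_UNIV subset_UNIV] by (simp add: Y_def d_def)
    obtain C where C: "C \<subseteq> Y" "pairwise orthogonal C" "\<And>x. x \<in> C \<Longrightarrow> norm x = 1" "independent C" "card C = dim Y" "span C = Y"
      using orthonormal_basis_subspace[OF Y] by blast
    have "finite C" using C(4) by (rule independent_imp_finite)
    then obtain b where b: "bij_betw b {..<d} C"
      using ex_bij_betw_nat_finite[of C] C(5) dimY by (auto simp: atLeast0LessThan)
    have inX: "u \<in> X" if u: "\<forall>i<d. b i \<bullet> u = 0" for u
    proof -
      have uY: "orthogonal u y" if y: "y \<in> Y" for y
      proof (rule orthogonal_to_span[of y C u])
        show "y \<in> span C" using y C(6) by simp
        fix c assume "c \<in> C"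
        then obtain i where i: "i < d" "c = b i" using b by (auto simp: bij_betw_def)
        have "b i \<bullet> u = 0" using u i(1) by blast
        then show "orthogonal u c" unfolding i(2) by (simp add: orthogonal_def inner_commute)
      qed
      obtain y1 y2 where y: "y1 \<in> span X" "\<And>w. w \<in> span X \<Longrightarrow> orthogonal y2 w" "u = y1 + y2"
        using orthogonal_subspace_decomp_exists[of X u] by blast
      have "y2 \<in> Y" unfolding Y_def using y(2) by (auto simp: orthogonal_commute span_base)
      then have "orthogonal (y1 + y2) y2" "orthogonal y2 y1" using uY y by auto
      then have "y2 \<bullet> y2 = 0" by (simp add: orthogonal_def inner_add_left inner_commute[of y2 y1])
      then have "y2 = 0" by simp
      then have "u \<in> span X" using y by simp
      then show ?thesis using X by (metis span_eq_iff)
    qed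
    define h where "h a i = (if i < d then b i \<bullet> (a + c *\<^sub>R v a) else 0)" for a i
    have "d \<noteq> 0"
    proof
      assume "d = 0"
      then have "\<And>u. u \<in> X" using inX by simp
      then show False using no S_ne by blast
    qed
    have "odd_map_to_punctured S d"
      unfolding odd_map_to_punctured_def
    proof (intro exI[of _ h] conjI ballI allI)
      have "continuous_map (top_of_set S) (Euclidean_space d) h"
        unfolding h_def[abs_def] continuous_map_componentwise_Euclidean_space
        using continuous_on_subset[OF v(1), of S] by (auto intro!: continuous_intros)
      moreover have "h a \<noteq> (\<lambda>i. 0)" if "a \<in> S" for a
      proof
        assume ha: "h a = (\<lambda>i. 0)"
        have "b i \<bullet> (a + c *\<^sub>R v a) = 0" if "i < d" for i
        proof -
          have "h a i = 0" by (simp only: ha)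
          then show ?thesis using that by (simp only: h_def if_True)
        qed
        then have "a + c *\<^sub>R v a \<in> X" using inX by blast
        then show False using no \<open>a \<in> S\<close> by blast
      qed
      ultimately show "continuous_map (top_of_set S) (subtopology (Euclidean_space d) (- {\<lambda>i. 0})) h"
        by (auto simp: continuous_map_in_subtopology)
      show "h (- a) i = - h a i" for a i by (simp add: h_def v(2) algebra_simps)
    qed
    then have "krasnoselskii_genus S \<le> enat d" using S_ne \<open>d \<noteq> 0\<close>
      by (auto simp: krasnoselskii_genus_def intro!: Inf_lower)
    moreover have "enat j \<le> krasnoselskii_genus S" using S by (simp add: genus_family_def)
    ultimately have "enat j \<le> enat d" by (rule order_trans[rotated])
    then show False using dj by simp
  qed
  define \<epsilon> where "\<epsilon> n = 1 / real (Suc n)" for n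
  have "\<exists>a. a \<in> psphere \<and> a + \<epsilon> n *\<^sub>R v a \<in> X \<and> J l a \<le> \<epsilon> n * \<epsilon> n" for n
  proof -
    have "0 < \<epsilon> n * \<epsilon> n" by (simp add: \<epsilon>_def)
    from variational_approx[OF j(2,3) this] obtain S where S: "S \<in> genus_family \<mu> p j"
      "\<And>f. f \<in> S \<Longrightarrow> rayleigh_q f < l + \<epsilon> n * \<epsilon> n" unfolding l_def by blast
    obtain a where a: "a \<in> S" "a + \<epsilon> n *\<^sub>R v a \<in> X" using meets[OF S(1)] by blast
    have "a \<in> psphere" using S(1) a(1) by (auto simp: genus_family_def)
    moreover from this have "rayleigh_q a - l = J l a"
      using rayleigh_minus[OF sphere_nonzero] by (simp add: mem_sphere_iff)
    ultimately show ?thesis using a(2) S(2)[OF a(1)] by (intro exI[of _ a]) auto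
  qed
  then obtain f where f: "\<And>n. f n \<in> psphere" "\<And>n. f n + \<epsilon> n *\<^sub>R v (f n) \<in> X" "\<And>n. J l (f n) \<le> \<epsilon> n * \<epsilon> n" by metis
  obtain a r where r: "a \<in> psphere" "strict_mono r" "(f \<circ> r) \<longlonglongrightarrow> a"
    using compact_sphere f(1) unfolding compact_def by metis
  define x where "x n = f (r n)" for n
  define s where "s n = \<epsilon> (r n)" for n
  have x: "x \<longlonglongrightarrow> a" using r(3) by (simp add: x_def[abs_def] o_def)
  have s: "s \<longlonglongrightarrow> 0" "\<And>n. 0 < s n"
    using LIMSEQ_subseq_LIMSEQ[OF LIMSEQ_inverse_real_of_nat r(2)] by (simp_all add: s_def[abs_def] \<epsilon>_def o_def inverse_eq_divide)
  have vx: "(\<lambda>n. v (x n)) \<longlonglongrightarrow> v a" using isCont_tendsto_compose[OF contv x] .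
  have inX: "x n + s n *\<^sub>R v (x n) \<in> X" for n using f(2) by (simp add: x_def s_def)
  have Jx: "J l (x n) \<le> s n * s n" for n using f(3) by (simp add: x_def s_def)
  have lim: "(\<lambda>n. x n + s n *\<^sub>R v (x n)) \<longlonglongrightarrow> a + 0 *\<^sub>R v a" using x s(1) vx by (intro tendsto_intros)
  have "a + 0 *\<^sub>R v a \<in> X" by (rule closed_sequentially[OF closed_subspace[OF X] inX lim])
  then have aX: "a \<in> X" by simp
  have "(\<lambda>n. J l (x n)) \<longlonglongrightarrow> J l a" using isCont_tendsto_compose[OF isCont_energy x] .
  moreover have "(\<lambda>n. s n * s n) \<longlonglongrightarrow> 0 * 0" using s(1) by (intro tendsto_intros)
  ultimately have "J l a \<le> 0 * 0" using Jx by (intro LIMSEQ_le) auto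
  then have "J l a = 0" using ge[OF aX] by (simp add: l_def)
  moreover have "- (s n * s n) \<le> J l (x n + s n *\<^sub>R v (x n)) - J l (x n)" for n
    using ge[OF inX[of n]] Jx[of n] by (simp add: l_def)
  ultimately show False using energy_no_descent[OF p x s(1) vx s(2)] v(3)[OF IntI[OF r(1) aX]] by (metis not_less)
qed

end

section \<open>Nodal domains of eigenfunctions with minimal support\<close>

lemma Sgn_diff:
  assumes "a \<noteq> 0" "a * c \<le> 0"
  shows "Sgn (a - c) = Sgn a"
proof (cases "0 < a")
  case True
  then have "c \<le> 0" using assms(2) by (simp add: mult_le_0_iff)
  then show ?thesis using True by (simp add: Sgn_simps)
next
  case False
  then have "a < 0" "0 \<le> c" using assms by (auto simp: mult_le_0_iff)
  then show ?thesis by (simp add: Sgn_simps)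
qed

lemma strong_nodal_relI: "{x, y} \<in> E \<Longrightarrow> 0 < f $ x * s {x, y} * f $ y \<Longrightarrow> (x, y) \<in> strong_nodal_rel E s f"
  unfolding strong_nodal_rel_def strong_nodal_walk_def support_def
  by (auto intro!: exI[of _ "[x, y]"])

lemma equiv_strong_nodal_rel: "equiv (support f) (strong_nodal_rel E s f)"
proof (rule equivI)
  show "strong_nodal_rel E s f \<subseteq> support f \<times> support f" by (auto simp: strong_nodal_rel_def)
  show "refl_on (support f) (strong_nodal_rel E s f)" by (auto simp: refl_on_def strong_nodal_rel_def)
  show "sym (strong_nodal_rel E s f)"
  proof (rule symI)
    fix x y assume xy: "(x, y) \<in> strong_nodal_rel E s f"
    have "\<exists>ys. ys \<noteq> [] \<and> strong_nodal_walk E s f ys \<and> hd ys = y \<and> last ys = x"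
      if "xs \<noteq> []" "strong_nodal_walk E s f xs" "hd xs = x" "last xs = y" for xs
    proof -
      have "strong_nodal_walk E s f (rev xs)"
        using that(2) unfolding strong_nodal_walk_def successively_rev
        by (rule successively_mono) (auto simp: insert_commute mult_ac)
      then show ?thesis using that by (intro exI[of _ "rev xs"]) (simp add: hd_rev last_rev)
    qed
    then show "(y, x) \<in> strong_nodal_rel E s f" using xy unfolding strong_nodal_rel_def by blast
  qed
  show "trans (strong_nodal_rel E s f)"
  proof (rule transI)
    fix x y z assume xyz: "(x, y) \<in> strong_nodal_rel E s f" "(y, z) \<in> strong_nodal_rel E s f"
    have "\<exists>zs. zs \<noteq> [] \<and> strong_nodal_walk E s f zs \<and> hd zs = x \<and> last zs = z"
      if xs: "xs \<noteq> []" "strong_nodal_walk E s f xs" "hd xs = x" "last xs = y"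
        and ys: "ys \<noteq> []" "strong_nodal_walk E s f ys" "hd ys = y" "last ys = z" for xs ys
    proof -
      obtain ys' where ys': "ys = y # ys'" using ys by (cases ys) auto
      have "strong_nodal_walk E s f (xs @ ys')"
        using xs ys unfolding ys' strong_nodal_walk_def successively_append_iff successively_Cons by auto
      moreover have "last (xs @ ys') = z" using xs ys unfolding ys' by (auto split: if_splits)
      ultimately show ?thesis using xs by (intro exI[of _ "xs @ ys'"]) simp
    qed
    then show "(x, z) \<in> strong_nodal_rel E s f" using xyz unfolding strong_nodal_rel_def by blast
  qed
qed

text \<open>The restrictions of \<open>f\<close> to \<open>j\<close> of the classes have disjoint supports, so they are orthogonal and span a space of dimension \<open>j\<close>.
  Since one class is left out, every member has strictly smaller support than \<open>f\<close>.\<close>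
lemma nodal_subspace:
  fixes f :: "real^'v::finite"
  assumes R: "equiv (support f) R" and j: "j < card (support f // R)"
  shows "\<exists>X. subspace X \<and> dim X = j \<and>
    (\<forall>g\<in>X. (\<exists>t. (\<forall>x y. (x, y) \<in> R \<longrightarrow> t x = t y) \<and> g = (\<chi> x. t x * f $ x)) \<and> support g \<subset> support f)"
proof -
  define Q where "Q = support f // R"
  obtain C where C: "C \<subseteq> Q" "card C = j" "finite C"
    using obtain_subset_with_card_n[of j Q] j by (auto simp: Q_def)
  define piece where "piece B = (\<chi> x. if x \<in> B then f $ x else 0)" for B
  have B_sub: "B \<subseteq> support f" "B \<noteq> {}" if "B \<in> Q" for B
    using that in_quotient_imp_subset[OF R] in_quotient_imp_non_empty[OF R] by (auto simp: Q_def)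
  have disj: "B = B' \<or> B \<inter> B' = {}" if "B \<in> Q" "B' \<in> Q" for B B'
    using that quotient_disj[OF R] by (simp add: Q_def)
  have supp: "support (piece B) = B" if "B \<in> Q" for B
    using B_sub[OF that] by (auto simp: support_def piece_def)
  have inj: "inj_on piece C"
  proof (rule inj_onI)
    fix B B' assume "B \<in> C" "B' \<in> C" "piece B = piece B'"
    then show "B = B'" using supp C(1) by (metis subsetD)
  qed
  have "pairwise orthogonal (piece ` C)"
    unfolding pairwise_def
  proof (intro ballI impI)
    fix u v assume "u \<in> piece ` C" "v \<in> piece ` C" "u \<noteq> v"
    then obtain B B' where B: "B \<in> C" "B' \<in> C" "u = piece B" "v = piece B'" "B \<noteq> B'" by auto
    then have "B \<inter> B' = {}" using disj C(1) by blast
    then have "(\<Sum>x\<in>UNIV. u $ x * v $ x) = 0" unfolding B piece_def by (intro sum.neutral) auto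
    then show "orthogonal u v" by (simp add: orthogonal_def inner_vec_def)
  qed
  moreover have "0 \<notin> piece ` C"
  proof
    assume "0 \<in> piece ` C"
    then obtain B where "B \<in> C" "piece B = 0" by auto
    then have "B \<in> Q" "support (piece B) = {}" using C(1) by (auto simp: support_def)
    then show False using supp B_sub by auto
  qed
  ultimately have "independent (piece ` C)" by (rule pairwise_orthogonal_independent)
  then have dim: "dim (span (piece ` C)) = j"
    using dim_span_eq_card_independent card_image[OF inj] C(2) by metis
  have C_Q: "C \<subset> Q" using C j by (auto simp: Q_def)
  then obtain B0 where B0: "B0 \<in> Q" "B0 \<notin> C" by blast
  obtain x0 where x0: "x0 \<in> B0" using B_sub(2)[OF B0(1)] by blast
  have rep: "\<exists>t. (\<forall>x y. (x, y) \<in> R \<longrightarrow> t x = t y) \<and> t x0 = 0 \<and> g = (\<chi> x. t x * f $ x)"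
    if g: "g \<in> span (piece ` C)" for g
  proof -
    obtain u where "g = (\<Sum>v\<in>piece ` C. u v *\<^sub>R v)" using g span_finite[of "piece ` C"] C(3) by auto
    then have g: "g = (\<Sum>B\<in>C. u (piece B) *\<^sub>R piece B)" using inj by (simp add: sum.reindex)
    define t where "t x = (\<Sum>B\<in>C. if x \<in> B then u (piece B) else 0)" for x
    have "t x = t y" if xy: "(x, y) \<in> R" for x y
    proof -
      have "x \<in> B \<longleftrightarrow> y \<in> B" if "B \<in> C" for B
      proof -
        have "B \<in> support f // R" using that C(1) by (auto simp: Q_def)
        moreover have "(y, x) \<in> R" using xy R by (meson equivE symD)
        ultimately show ?thesis using xy in_quotient_imp_closed[OF R] by blast
      qed
      then show ?thesis unfolding t_def by (intro sum.cong) auto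
    qed
    moreover have "t x0 = 0"
      unfolding t_def
    proof (rule sum.neutral, rule ballI)
      fix B assume "B \<in> C"
      then have "B0 \<inter> B = {}" using disj[OF B0(1), of B] B0(2) C(1) by blast
      then show "(if x0 \<in> B then u (piece B) else 0) = 0" using x0 by auto
    qed
    moreover have "g = (\<chi> x. t x * f $ x)"
      unfolding g t_def
      by (simp add: vec_eq_iff sum_component sum_distrib_right piece_def if_distrib if_distribR cong: if_cong)
    ultimately show ?thesis by blast
  qed
  show ?thesis
  proof (intro exI[of _ "span (piece ` C)"] conjI ballI)
    show "subspace (span (piece ` C))" by (rule subspace_span)
    show "dim (span (piece ` C)) = j" by (rule dim)
    show "\<exists>t. (\<forall>x y. (x, y) \<in> R \<longrightarrow> t x = t y) \<and> g = (\<chi> x. t x * f $ x)" if "g \<in> span (piece ` C)" for g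
      using rep[OF that] by blast
    show "support g \<subset> support f" if gX: "g \<in> span (piece ` C)" for g
    proof -
      obtain t where t: "t x0 = 0" "g = (\<chi> x. t x * f $ x)" using rep[OF gX] by blast
      have "support g \<subseteq> support f" unfolding t(2) by (auto simp: support_def)
      moreover have "x0 \<in> support f" using x0 B_sub(1)[OF B0(1)] by blast
      moreover have "x0 \<notin> support g" unfolding t(2) using t(1) by (simp add: support_def)
      ultimately show ?thesis by blast
    qed
  qed
qed

context weighted_signed_graph
begin

lemma minimal_no_eigenfunction:
  assumes "minimal_supp l f" "support g \<subset> support f"
  shows "\<not> eigen l g"
  using assms unfolding minimal_support_def by blast

text \<open>If there were more than \<open>k\<close> domains, the pieces of \<open>k\<close> of them would span a \<open>k\<close>-dimensional space on which the Rayleigh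
  quotient is at most the \<open>k\<close>-th eigenvalue and which, by minimality, contains no eigenfunction.\<close>
lemma nodal_domains_le:
  assumes k: "1 \<le> k" and eig: "eigen (\<Lambda> k) f"
    and min: "minimal_supp (\<Lambda> k) f"
  shows "num_strong_nodal_domains E \<sigma> f \<le> k"
proof (rule ccontr)
  assume "\<not> ?thesis"
  then have "k < card (support f // strong_nodal_rel E \<sigma> f)" by (simp add: num_strong_nodal_domains_def)
  from nodal_subspace[OF equiv_strong_nodal_rel this] obtain X where X: "subspace X" "dim X = k"
    and Xg: "\<forall>g\<in>X. (\<exists>t. (\<forall>x y. (x, y) \<in> strong_nodal_rel E \<sigma> f \<longrightarrow> t x = t y) \<and> g = (\<chi> x. t x * f $ x)) \<and>
      support g \<subset> support f" by blast
  have "\<Lambda> (dim X) < \<Lambda> k"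
  proof (rule variational_less[OF X(1)])
    show "1 \<le> dim X" using k X(2) by simp
    fix g assume g: "g \<in> X"
    obtain t where t: "\<forall>x y. (x, y) \<in> strong_nodal_rel E \<sigma> f \<longrightarrow> t x = t y" "g = rescale t f"
      using bspec[OF Xg g] unfolding rescale_def by blast
    show "J (\<Lambda> k) g \<le> 0" unfolding t(2)
      by (rule energy_rescale_le[OF eig]) (use t(1) strong_nodal_relI in blast)
    show "\<not> eigen (\<Lambda> k) g" using minimal_no_eigenfunction[OF min] bspec[OF Xg g] by blast
  qed
  then show False using X(2) by simp
qed

text \<open>Here \<open>j\<close> may be any index with the given eigenvalue; the bound is best for the largest one. If there were more domains, the
  pieces of all but some of them would span a linking subspace on which the Rayleigh quotient is at least the eigenvalue, and
  so an eigenfunction of smaller support would exist.\<close>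
lemma dual_nodal_domains_le:
  assumes j: "1 \<le> j" "j \<le> CARD('v)" and eig: "eigen (\<Lambda> j) f"
    and min: "minimal_supp (\<Lambda> j) f"
  shows "num_strong_nodal_domains E (\<lambda>e. - \<sigma> e) f \<le> CARD('v) + 1 - j"
proof (rule ccontr)
  assume "\<not> ?thesis"
  then have "CARD('v) + 1 - j < card (support f // strong_nodal_rel E (\<lambda>e. - \<sigma> e) f)" by (simp add: num_strong_nodal_domains_def)
  from nodal_subspace[OF equiv_strong_nodal_rel this] obtain X where X: "subspace X" "dim X = CARD('v) + 1 - j"
    and Xg: "\<forall>g\<in>X. (\<exists>t. (\<forall>x y. (x, y) \<in> strong_nodal_rel E (\<lambda>e. - \<sigma> e) f \<longrightarrow> t x = t y) \<and> g = (\<chi> x. t x * f $ x)) \<and>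
      support g \<subset> support f" by blast
  have "0 \<le> J (\<Lambda> j) g" if g: "g \<in> X" for g
  proof -
    obtain t where t: "\<forall>x y. (x, y) \<in> strong_nodal_rel E (\<lambda>e. - \<sigma> e) f \<longrightarrow> t x = t y" "g = rescale t f"
      using bspec[OF Xg g] unfolding rescale_def by blast
    show ?thesis unfolding t(2)
    proof (rule energy_rescale_ge[OF eig])
      fix x y assume "{x, y} \<in> E" "f $ x * \<sigma> {x, y} * f $ y < 0"
      then have "(x, y) \<in> strong_nodal_rel E (\<lambda>e. - \<sigma> e) f" by (intro strong_nodal_relI) auto
      then show "t x = t y" using t(1) by blast
    qed
  qed
  moreover have "j + dim X = CARD('v) + 1" using X(2) j by simp
  ultimately obtain g where g: "g \<in> X" "eigen (\<Lambda> j) g"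
    using eigenfunction_in_linking_subspace[OF X(1) _ j] by metis
  have "support g \<subset> support f" using bspec[OF Xg g(1)] by (rule conjunct2)
  then show False using minimal_no_eigenfunction[OF min] g(2) by blast
qed

text \<open>For \<open>p = 1\<close> the equation sees \<open>f\<close> only through signs. Across an edge leaving the domain the sign of \<open>f(x) - \<sigma> f(y)\<close>
  is determined by the endpoint inside, so that deleting the values outside does not disturb the multipliers.\<close>
lemma restriction_to_nodal_domain:
  assumes p1: "p = 1" and eig: "eigen l f"
    and B: "B \<in> support f // strong_nodal_rel E \<sigma> f"
  shows "eigen l (\<chi> x. if x \<in> B then f $ x else 0)" (is "eigen l ?g")
proof -
  have sub: "\<And>t. subgrad p t = Sgn t" using p1 by (simp add: subgrad_def)
  obtain z u u' where z: "\<And>x y. {x, y} \<in> E \<Longrightarrow> z x y \<in> Sgn (f $ x - \<sigma> {x, y} * f $ y)"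
    and anti: "\<And>x y. {x, y} \<in> E \<Longrightarrow> z x y = - \<sigma> {x, y} * z y x"
    and u: "\<And>x. u x \<in> Sgn (f $ x)" "\<And>x. u' x \<in> Sgn (f $ x)"
    and eq: "\<And>x. (\<Sum>y\<in>nbrs E x. w {x, y} * z x y) + \<kappa> x * u x = l * \<mu> x * u' x"
    using eig unfolding eigenfunction_iff sub by blast
  have Bs: "B \<subseteq> support f" "B \<noteq> {}"
    using B in_quotient_imp_subset[OF equiv_strong_nodal_rel] in_quotient_imp_non_empty[OF equiv_strong_nodal_rel] by blast+
  then obtain b where b: "b \<in> B" "f $ b \<noteq> 0" by (auto simp: support_def)
  then have "?g $ b \<noteq> 0" by simp
  then have g0: "?g \<noteq> 0" by (metis zero_index)
  have closed: "f $ x * \<sigma> {x, y} * f $ y \<le> 0" if e: "{x, y} \<in> E" and xy: "(x \<in> B) \<noteq> (y \<in> B)" for x y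
  proof (rule ccontr)
    assume "\<not> ?thesis"
    then have "(x, y) \<in> strong_nodal_rel E \<sigma> f" using e by (intro strong_nodal_relI) auto
    moreover from this have "(y, x) \<in> strong_nodal_rel E \<sigma> f" using equiv_strong_nodal_rel by (meson equivE symD)
    ultimately show False using xy in_quotient_imp_closed[OF equiv_strong_nodal_rel B] by blast
  qed
  have zero: "t \<in> Sgn 0" if "t \<in> Sgn c" for t c using Sgn_abs_le[OF that] unfolding Sgn_simps by auto
  have zg: "z x y \<in> Sgn (?g $ x - \<sigma> {x, y} * ?g $ y)" if e: "{x, y} \<in> E" for x y
  proof -
    consider "x \<in> B" "y \<in> B" | "x \<notin> B" "y \<notin> B" | "x \<in> B" "y \<notin> B" | "x \<notin> B" "y \<in> B" by blast
    then show ?thesis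
    proof cases
      case 1 then show ?thesis using z[OF e] by simp
    next
      case 2 then show ?thesis using zero[OF z[OF e]] by simp
    next
      case 3
      then have "f $ x \<noteq> 0" "f $ x * (\<sigma> {x, y} * f $ y) \<le> 0" using Bs(1) closed[OF e] by (auto simp: support_def mult.assoc)
      then show ?thesis using z[OF e] 3 Sgn_diff[of "f $ x" "\<sigma> {x, y} * f $ y"] by simp
    next
      case 4
      then have "\<sigma> {x, y} * f $ y \<noteq> 0" "f $ x * (\<sigma> {x, y} * f $ y) \<le> 0"
        using Bs(1) closed[OF e] sigma_pm[OF e] by (auto simp: support_def mult.assoc)
      then have "Sgn (f $ x - \<sigma> {x, y} * f $ y) = Sgn (- (\<sigma> {x, y} * f $ y))"
        using Sgn_diff[of "- (\<sigma> {x, y} * f $ y)" "- f $ x"] by (simp add: mult.commute)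
      then show ?thesis using z[OF e] 4 by simp
    qed
  qed
  have ug: "u x \<in> Sgn (?g $ x)" "u' x \<in> Sgn (?g $ x)" for x
    using u[of x] zero[OF u(1)] zero[OF u(2)] by simp_all
  show ?thesis unfolding eigenfunction_iff sub using g0 zg anti ug eq
    by (intro conjI exI[of _ z] exI[of _ u] exI[of _ u'] allI impI) simp_all
qed

lemma one_nodal_domain:
  assumes p1: "p = 1" and eig: "eigen l f"
    and min: "minimal_supp l f"
  shows "support f // strong_nodal_rel E \<sigma> f = {support f}"
proof -
  have "B = support f" if B: "B \<in> support f // strong_nodal_rel E \<sigma> f" for B
  proof -
    have "B \<subseteq> support f" using B in_quotient_imp_subset[OF equiv_strong_nodal_rel] by blast
    then have "support (\<chi> x. if x \<in> B then f $ x else 0) = B" by (auto simp: support_def)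
    then show ?thesis
      using min restriction_to_nodal_domain[OF p1 eig B] \<open>B \<subseteq> support f\<close> unfolding minimal_support_def by metis
  qed
  then have "support f // strong_nodal_rel E \<sigma> f \<subseteq> {support f}" by auto
  moreover have "support f \<noteq> {}" using eig by (auto simp: eigenfunction_iff support_def vec_eq_iff)
  then have "support f // strong_nodal_rel E \<sigma> f \<noteq> {}" by (auto simp: quotient_def)
  ultimately show ?thesis by (metis subset_singletonD)
qed

text \<open>After switching by \<open>\<tau>\<close> the function has constant sign on its single domain. Hence no edge has a negative
  product, and every vertex of the support is a dual domain on its own.\<close>
lemma balanced_dual_domains:
  assumes bal: "balanced E \<sigma>" and one: "support f // strong_nodal_rel E \<sigma> f = {support f}"
  shows "num_strong_nodal_domains E (\<lambda>e. - \<sigma> e) f = card (support f)"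
proof -
  obtain \<tau> :: "'v \<Rightarrow> real" where \<tau>: "\<And>x. \<tau> x = -1 \<or> \<tau> x = 1" "\<And>x y. {x, y} \<in> E \<Longrightarrow> \<tau> x * \<sigma> {x, y} * \<tau> y = 1"
    using bal unfolding balanced_def by auto
  have \<sigma>: "\<sigma> {x, y} = \<tau> x * \<tau> y" if "{x, y} \<in> E" for x y
    using \<tau>(1)[of x] \<tau>(1)[of y] \<tau>(2)[OF that] by auto
  define \<phi> where "\<phi> x = \<tau> x * f $ x" for x
  have prod: "f $ x * \<sigma> {x, y} * f $ y = \<phi> x * \<phi> y" if "{x, y} \<in> E" for x y
    unfolding \<sigma>[OF that] \<phi>_def by (simp add: mult_ac)
  have walk: "0 < \<phi> (hd xs) * \<phi> (last xs)" if "xs \<noteq> []" "strong_nodal_walk E \<sigma> f xs" "\<phi> (last xs) \<noteq> 0" for xs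
    using that
  proof (induction xs)
    case (Cons x xs)
    show ?case
    proof (cases "xs = []")
      case True then show ?thesis using Cons.prems(3) by (auto simp: zero_less_mult_iff)
    next
      case False
      have "strong_nodal_walk E \<sigma> f xs" and xy: "{x, hd xs} \<in> E" "0 < f $ x * \<sigma> {x, hd xs} * f $ hd xs"
        using Cons.prems(2) False by (auto simp: strong_nodal_walk_def successively_Cons)
      then have "0 < \<phi> (hd xs) * \<phi> (last xs)" using Cons.IH[OF False] Cons.prems(3) False by simp
      moreover have "0 < \<phi> x * \<phi> (hd xs)" using xy prod by simp
      ultimately show ?thesis using False by (auto simp: zero_less_mult_iff)
    qed
  qed simp
  have same: "0 < \<phi> x * \<phi> y" if xy: "x \<in> support f" "y \<in> support f" for x y
  proof -
    have ny: "\<phi> y \<noteq> 0" using xy(2) \<tau>(1)[of y] by (auto simp: \<phi>_def support_def)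
    have "(x, y) \<in> strong_nodal_rel E \<sigma> f"
      using one xy quotient_eq_iff[OF equiv_strong_nodal_rel, of "support f" f E \<sigma> "support f" x y] by simp
    then show ?thesis using walk ny unfolding strong_nodal_rel_def by (auto simp: zero_less_mult_iff)
  qed
  have no_edge: "\<not> 0 < f $ x * (- \<sigma> {x, y}) * f $ y" if e: "{x, y} \<in> E" for x y
  proof
    assume a: "0 < f $ x * (- \<sigma> {x, y}) * f $ y"
    then have "x \<in> support f" "y \<in> support f" by (auto simp: support_def)
    then have "0 < f $ x * \<sigma> {x, y} * f $ y" using same prod[OF e] by simp
    then show False using a by simp
  qed
  have "x = y" if "(x, y) \<in> strong_nodal_rel E (\<lambda>e. - \<sigma> e) f" for x y
  proof -
    have "hd xs = last xs" if "xs \<noteq> []" "strong_nodal_walk E (\<lambda>e. - \<sigma> e) f xs" for xs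
    proof (cases xs)
      case (Cons a ys)
      then have "ys = []" using that(2) no_edge by (auto simp: strong_nodal_walk_def successively_Cons)
      then show ?thesis using Cons by simp
    qed (use that in simp)
    then show ?thesis using that unfolding strong_nodal_rel_def by blast
  qed
  then have "strong_nodal_rel E (\<lambda>e. - \<sigma> e) f = Id_on (support f)"
    using equiv_strong_nodal_rel[of f E "\<lambda>e. - \<sigma> e"] by (auto simp: equiv_def refl_on_def)
  then have "support f // strong_nodal_rel E (\<lambda>e. - \<sigma> e) f = (\<lambda>x. {x}) ` support f" by (auto simp: quotient_def)
  moreover have "card ((\<lambda>x. {x}) ` support f) = card (support f)" by (rule card_image) simp
  ultimately show ?thesis by (simp add: num_strong_nodal_domains_def)
qed

end

theorem theorem4:
  fixes E :: "'v::finite set set"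
    and w \<sigma> :: "'v set \<Rightarrow> real"
    and \<mu> \<kappa> :: "'v \<Rightarrow> real"
    and p :: real
    and k r :: nat
    and f :: "real^'v"
    and lam :: "nat \<Rightarrow> real"
  assumes "simple_graph E"
    and "signature E \<sigma>"
    and "\<forall>e\<in>E. 0 < w e"
    and "\<forall>x. 0 < \<mu> x"
    and "1 \<le> p"
    and "lam = variational_eigenvalue E w \<mu> \<kappa> \<sigma> p"
    and "1 \<le> k" and "1 \<le> r" and "k + r - 1 \<le> CARD('v)"
    and "1 < k \<longrightarrow> lam (k - 1) < lam k"
    and "\<forall>i\<in>{k..k + r - 1}. lam i = lam k"
    and "k + r - 1 < CARD('v) \<longrightarrow> lam (k + r - 1) < lam (k + r)"
    and "eigenfunction E w \<mu> \<kappa> \<sigma> p (lam k) f"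
    and "minimal_support E w \<mu> \<kappa> \<sigma> p (lam k) f"
  shows "num_strong_nodal_domains E \<sigma> f \<le> k \<and>
    int (num_strong_nodal_domains E (\<lambda>e. - \<sigma> e) f) \<le> int CARD('v) - int k - int r + 2 \<and>
    (p = 1 \<longrightarrow> num_strong_nodal_domains E \<sigma> f = 1) \<and>
    (p = 1 \<and> balanced E \<sigma> \<longrightarrow> k + r - 2 \<le> card {x. f $ x = 0})"
proof -
  interpret weighted_signed_graph E w \<sigma> \<mu> \<kappa> p
    by unfold_locales (use assms(1-5) in auto)
  have eig: "eigenfunction E w \<mu> \<kappa> \<sigma> p (\<Lambda> k) f" and min: "minimal_support E w \<mu> \<kappa> \<sigma> p (\<Lambda> k) f"
    using assms(13,14) unfolding assms(6) .
  \<comment> \<open>The last index of the eigenvalue gives the sharpest dual bound.\<close>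
  define j where "j = k + r - 1"
  have j: "1 \<le> j" "j \<le> CARD('v)" "\<Lambda> j = \<Lambda> k"
    using assms(7-9) bspec[OF assms(11), of "k + r - 1"] unfolding assms(6) by (simp_all add: j_def)
  have upper: "num_strong_nodal_domains E \<sigma> f \<le> k" using assms(7) eig min by (rule nodal_domains_le)
  have dual: "num_strong_nodal_domains E (\<lambda>e. - \<sigma> e) f \<le> CARD('v) + 1 - j"
    using j(1,2) eig min unfolding j(3)[symmetric] by (rule dual_nodal_domains_le)
  then have dual': "int (num_strong_nodal_domains E (\<lambda>e. - \<sigma> e) f) \<le> int CARD('v) - int k - int r + 2"
    using j(1,2) assms(7,8) by (simp add: j_def of_nat_diff)
  have one: "num_strong_nodal_domains E \<sigma> f = 1" if "p = 1"
    using one_nodal_domain[OF that eig min] by (simp add: num_strong_nodal_domains_def)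
  have zeros: "k + r - 2 \<le> card {x. f $ x = 0}" if "p = 1" "balanced E \<sigma>"
  proof -
    have "card (support f) \<le> CARD('v) + 1 - j"
      using dual balanced_dual_domains[OF that(2) one_nodal_domain[OF that(1) eig min]] by simp
    moreover have "card (support f) + card {x. f $ x = 0} = CARD('v)"
    proof -
      have "support f \<union> {x. f $ x = 0} = UNIV" "support f \<inter> {x. f $ x = 0} = {}" by (auto simp: support_def)
      then show ?thesis using card_Un_disjoint[of "support f" "{x. f $ x = 0}"] by simp
    qed
    ultimately show ?thesis using j(1,2) by (simp add: j_def)
  qed
  show ?thesis using upper dual' one zeros by blast
qed

end
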